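(* Let $k$ be a positive integer and write $\underline{k}=\{1,\dots,k\}$, $\underline{k-1}=\{1,\dots,k-1\}$. Let $X_\emptyset$ be a topological space, let $d_1,\dots,d_k\ge -1$ be integers, and for $1\le j\le k$ let $e_j$ be a cell of dimension $d_j+1$ with a chosen attaching map $\partial e_j\to X_\emptyset$. For $T\subset\underline{k}$ let $X_T=X_\emptyset\cup\{e_j : j\in T\}$ be the space obtained from $X_\emptyset$ by attaching the cells $e_j$ with $j\in T$ along the chosen attaching maps. Choose a basepoint $x\in X_{\{k\}}$, and for $T\subset\underline{k-1}$ let $$\mathcal{F}(T)=\operatorname{hofiber}_x\left(X_T\to X_{T\cup\{k\}}\right),$$ the homotopy fiber over $x$ of the inclusion. Then the $(k-1)$-cube $\mathcal{F}=(T\mapsto\mathcal{F}(T))$ is $\left(-1+\sum_{j=1}^k d_j\right)$-cocartesian. That is, the pair $$\left(\mathcal{F}(\underline{k-1}),\ \bigcup_{j\in\underline{k-1}}\mathcal{F}(\underline{k-1}\setminus\{j\})\right)$$ is $\left(-1+\sum_{j=1}^k d_j\right)$-connected.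
   Context: A cell of dimension $m\geq 0$ is a closed disk $D^m$ with boundary $\partial D^m=S^{m-1}$ ($S^{-1}=\emptyset$, so attaching a $0$-cell adds a disjoint point). A space $X$ is $j$-connected if every map $\partial D^{i+1}=S^i\to X$ extends to a map $D^{i+1}\to X$ for $-1\le i\le j$ (no condition if $j\le -2$). For a map $f:Y\to X$ and $x\in X$, the homotopy fiber is $\operatorname{hofiber}_x(f)=\{(y,\gamma): y\in Y,\ \gamma:I\to X,\ \gamma(1)=f(y),\ \gamma(0)=x\}$, where $I=[0,1]$. The map $f$ is $j$-connected if $\operatorname{hofiber}_x(f)$ is $(j-1)$-connected for all $x\in X$. A pair $(X,Y)$ is $j$-connected if the inclusion $Y\to X$ is $j$-connected. For an integer $m\ge 0$, an $m$-cube of spaces is a functor $\mathcal{X}=(T\mapsto X_T)$ from the poset of subsets of $\underline{m}=\{1,\dots,m\}$ (with $\underline{0}=\emptyset$) to topological spaces. It is $j$-cocartesian if the canonical map $\operatorname{hocolim}_{T\subsetneq\underline{m}}X_T\to X_{\underline{m}}$ is $j$-connected. In the claim, each $\mathcal{F}(T)$ is regarded as a subspace of $\mathcal{F}(\underline{k-1})$ via the inclusions $X_T\subset X_{\underline{k-1}}$ and $X_{T\cup\{k\}}\subset X_{\underline{k}}$, and the union is taken inside $\mathcal{F}(\underline{k-1})$.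
   Formalization: The case k = 1 with d_1 ≥ 1 is excluded: there the union and the homotopy colimit are empty while the homotopy fiber F(∅) is nonempty, so the claimed connectivity always fails. *)

theory Defs
  imports "HOL-Analysis.Analysis"
begin

section \<open>Cells and cell attachment\<close>

definition cell :: "nat \<Rightarrow> (nat \<Rightarrow> real) topology" where
  "cell m = subtopology (Euclidean_space m) {v. (\<Sum>i<m. (v i)\<^sup>2) \<le> 1}"

text \<open>The boundary sphere of the \<open>m\<close>-cell.  For \<open>m = 0\<close> the sum is empty, so the boundary is empty.\<close>
definition cell_boundary :: "nat \<Rightarrow> (nat \<Rightarrow> real) topology" where
  "cell_boundary m = subtopology (Euclidean_space m) {v. (\<Sum>i<m. (v i)\<^sup>2) = 1}"

text \<open>
  The space obtained from \<open>X\<close> by attaching, for each \<open>j \<in> T\<close>, a cell of dimension \<open>n j\<close> along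
  \<open>\<phi> j\<close>.  It is the quotient of the disjoint union of \<open>X\<close> and these cells, with
  each class represented by its unique point that lies in \<open>X\<close> or in an open cell.
  Thus the spaces for \<open>S \<subseteq> T\<close> are nested as sets, and all the inclusions are identity maps.
\<close>
definition char_map ::
    "(nat \<Rightarrow> nat) \<Rightarrow> (nat \<Rightarrow> (nat \<Rightarrow> real) \<Rightarrow> 'a) \<Rightarrow> nat \<Rightarrow> (nat \<Rightarrow> real) \<Rightarrow> 'a + nat \<times> (nat \<Rightarrow> real)" where
  "char_map n \<phi> j v = (if v \<in> topspace (cell_boundary (n j)) then Inl (\<phi> j v) else Inr (j, v))"

definition attach_carrier ::
    "'a topology \<Rightarrow> (nat \<Rightarrow> nat) \<Rightarrow> nat set \<Rightarrow> ('a + nat \<times> (nat \<Rightarrow> real)) set" where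
  "attach_carrier X n T =
     Inl ` topspace X \<union> Inr ` (SIGMA j:T. topspace (cell (n j)) - topspace (cell_boundary (n j)))"

definition attach_cells ::
    "'a topology \<Rightarrow> (nat \<Rightarrow> nat) \<Rightarrow> (nat \<Rightarrow> (nat \<Rightarrow> real) \<Rightarrow> 'a) \<Rightarrow> nat set \<Rightarrow>
     ('a + nat \<times> (nat \<Rightarrow> real)) topology" where
  "attach_cells X n \<phi> T =
     topology (\<lambda>U. U \<subseteq> attach_carrier X n T \<and>
       openin X {a \<in> topspace X. Inl a \<in> U} \<and>
       (\<forall>j\<in>T. openin (cell (n j)) {v \<in> topspace (cell (n j)). char_map n \<phi> j v \<in> U}))"

lemma openin_attach_cells:
  "openin (attach_cells X n \<phi> T) U \<longleftrightarrow>
     U \<subseteq> attach_carrier X n T \<and>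
     openin X {a \<in> topspace X. Inl a \<in> U} \<and>
     (\<forall>j\<in>T. openin (cell (n j)) {v \<in> topspace (cell (n j)). char_map n \<phi> j v \<in> U})"
proof -
  have *: "{a \<in> A. f a \<in> U \<inter> V} = {a \<in> A. f a \<in> U} \<inter> {a \<in> A. f a \<in> V}"
    "{a \<in> A. f a \<in> \<Union>K} = (\<Union>W\<in>K. {a \<in> A. f a \<in> W})" for f :: "'c \<Rightarrow> 'd" and A U V K
    by auto
  have "istopology (\<lambda>U. U \<subseteq> attach_carrier X n T \<and>
       openin X {a \<in> topspace X. Inl a \<in> U} \<and>
       (\<forall>j\<in>T. openin (cell (n j)) {v \<in> topspace (cell (n j)). char_map n \<phi> j v \<in> U}))"
    unfolding istopology_def by (simp only: *) (blast intro: openin_Int openin_Union)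
  then show ?thesis
    by (simp add: attach_cells_def topology_inverse')
qed

lemma topspace_attach_cells:
  assumes "\<And>j. j \<in> T \<Longrightarrow> continuous_map (cell_boundary (n j)) X (\<phi> j)"
  shows "topspace (attach_cells X n \<phi> T) = attach_carrier X n T"
proof (rule antisym)
  show "topspace (attach_cells X n \<phi> T) \<subseteq> attach_carrier X n T"
    using openin_attach_cells openin_topspace by blast
  have "char_map n \<phi> j v \<in> attach_carrier X n T" if "j \<in> T" "v \<in> topspace (cell (n j))" for j v
    using that continuous_map_image_subset_topspace[OF assms[OF that(1)]]
    by (auto simp: char_map_def attach_carrier_def)
  then have "{v \<in> topspace (cell (n j)). char_map n \<phi> j v \<in> attach_carrier X n T} = topspace (cell (n j))"
    if "j \<in> T" for j using that by blast
  moreover have "{a \<in> topspace X. Inl a \<in> attach_carrier X n T} = topspace X"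
    by (auto simp: attach_carrier_def)
  ultimately have "openin (attach_cells X n \<phi> T) (attach_carrier X n T)"
    by (simp add: openin_attach_cells)
  then show "attach_carrier X n T \<subseteq> topspace (attach_cells X n \<phi> T)"
    by (rule openin_subset)
qed


section \<open>Path spaces, homotopy fibers and connectivity\<close>

text \<open>Paths are extensional outside the unit interval, so that equal paths are equal as functions.\<close>
definition paths :: "'a topology \<Rightarrow> (real \<Rightarrow> 'a) set" where
  "paths X = {\<gamma> \<in> extensional {0..1}. continuous_map (top_of_set {0..1}) X \<gamma>}"

text \<open>The compact-open topology.\<close>
definition path_space :: "'a topology \<Rightarrow> (real \<Rightarrow> 'a) topology" where
  "path_space X = topology_generated_by
     {{\<gamma> \<in> paths X. \<gamma> ` K \<subseteq> U} | K U. K \<subseteq> {0..1} \<and> compact K \<and> openin X U}"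

lemma topspace_path_space: "topspace (path_space X) = paths X"
proof -
  have "paths X = {\<gamma> \<in> paths X. \<gamma> ` {} \<subseteq> {}}" by simp
  then have "paths X \<in> {{\<gamma> \<in> paths X. \<gamma> ` K \<subseteq> U} | K U. K \<subseteq> {0..1} \<and> compact K \<and> openin X U}"
    using compact_empty openin_empty by blast
  then show ?thesis
    unfolding path_space_def topology_generated_by_topspace by blast
qed

definition hofiber :: "'b topology \<Rightarrow> 'a topology \<Rightarrow> ('b \<Rightarrow> 'a) \<Rightarrow> 'a \<Rightarrow> ('b \<times> (real \<Rightarrow> 'a)) topology" where
  "hofiber Y X f x =
     subtopology (prod_topology Y (path_space X)) {(y, \<gamma>). \<gamma> 1 = f y \<and> \<gamma> 0 = x}"

text \<open>
  Here \<open>n\<close> is the dimension \<open>i + 1\<close> of the disk, so that the condition \<open>-1 \<le> i \<le> j\<close>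
  on the dimension \<open>i\<close> of the sphere becomes \<open>0 \<le> n \<le> j + 1\<close>.
\<close>
definition n_connected_space :: "int \<Rightarrow> 'a topology \<Rightarrow> bool" where
  "n_connected_space j X \<longleftrightarrow>
     (\<forall>n::nat. int n \<le> j + 1 \<longrightarrow>
        (\<forall>g. continuous_map (cell_boundary n) X g \<longrightarrow>
          (\<exists>h. continuous_map (cell n) X h \<and> (\<forall>v\<in>topspace (cell_boundary n). h v = g v))))"

definition n_connected_map :: "int \<Rightarrow> 'b topology \<Rightarrow> 'a topology \<Rightarrow> ('b \<Rightarrow> 'a) \<Rightarrow> bool" where
  "n_connected_map j Y X f \<longleftrightarrow>
     continuous_map Y X f \<and> (\<forall>x\<in>topspace X. n_connected_space (j - 1) (hofiber Y X f x))"

text \<open>The pair consisting of \<open>X\<close> and its subset \<open>A\<close> with the subspace topology.\<close>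
definition n_connected_pair :: "int \<Rightarrow> 'a topology \<Rightarrow> 'a set \<Rightarrow> bool" where
  "n_connected_pair j X A \<longleftrightarrow> A \<subseteq> topspace X \<and> n_connected_map j (subtopology X A) X id"


section \<open>Cubes and homotopy colimits\<close>

definition quotient_topology :: "'a topology \<Rightarrow> ('a \<Rightarrow> 'b) \<Rightarrow> 'b topology" where
  "quotient_topology X q =
     topology (\<lambda>U. U \<subseteq> q ` topspace X \<and> openin X {x \<in> topspace X. q x \<in> U})"

lemma openin_quotient_topology:
  "openin (quotient_topology X q) U \<longleftrightarrow>
     U \<subseteq> q ` topspace X \<and> openin X {x \<in> topspace X. q x \<in> U}"
proof -
  have *: "{a \<in> A. q a \<in> U \<inter> V} = {a \<in> A. q a \<in> U} \<inter> {a \<in> A. q a \<in> V}"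
    "{a \<in> A. q a \<in> \<Union>K} = (\<Union>W\<in>K. {a \<in> A. q a \<in> W})" for A U V K
    by auto
  have "istopology (\<lambda>U. U \<subseteq> q ` topspace X \<and> openin X {x \<in> topspace X. q x \<in> U})"
    unfolding istopology_def by (simp only: *) (blast intro: openin_Int openin_Union)
  then show ?thesis
    by (simp add: quotient_topology_def topology_inverse')
qed

lemma quotient_map_quotient_topology: "quotient_map X (quotient_topology X q) q"
proof -
  have "openin (quotient_topology X q) (q ` topspace X)"
    using openin_topspace[of X] by (auto simp: openin_quotient_topology Collect_conj_eq cong: conj_cong)
  then have "topspace (quotient_topology X q) = q ` topspace X"
    by (meson openin_quotient_topology openin_subset openin_topspace subset_antisym)
  then show ?thesis
    by (auto simp: quotient_map_def openin_quotient_topology)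
qed

text \<open>
  A diagram of spaces indexed by a family \<open>P\<close> of sets ordered by inclusion: \<open>X T\<close> is the space at
  \<open>T\<close>, and \<open>f S T\<close> is the map \<open>X S \<rightarrow> X T\<close> for \<open>S \<subseteq> T\<close>.
\<close>
definition diagram :: "'i set set \<Rightarrow> ('i set \<Rightarrow> 'a topology) \<Rightarrow> ('i set \<Rightarrow> 'i set \<Rightarrow> 'a \<Rightarrow> 'a) \<Rightarrow> bool" where
  "diagram P X f \<longleftrightarrow>
     (\<forall>S\<in>P. \<forall>T\<in>P. S \<subseteq> T \<longrightarrow> continuous_map (X S) (X T) (f S T)) \<and>
     (\<forall>S\<in>P. \<forall>x\<in>topspace (X S). f S S x = x) \<and>
     (\<forall>R\<in>P. \<forall>S\<in>P. \<forall>T\<in>P. R \<subseteq> S \<longrightarrow> S \<subseteq> T \<longrightarrow>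
        (\<forall>x\<in>topspace (X R). f S T (f R S x) = f R T x))"

abbreviation cube :: "nat \<Rightarrow> (nat set \<Rightarrow> 'a topology) \<Rightarrow> (nat set \<Rightarrow> nat set \<Rightarrow> 'a \<Rightarrow> 'a) \<Rightarrow> bool" where
  "cube m \<equiv> diagram (Pow {1..m})"

text \<open>
  The geometric realization of the nerve of a finite poset \<open>P\<close> of sets, that is, of its order
  complex, in barycentric coordinates.
\<close>
definition nerve :: "'i set set \<Rightarrow> ('i set \<Rightarrow> real) topology" where
  "nerve P = subtopology (powertop_real UNIV)
     {t. (\<forall>S. 0 \<le> t S) \<and> subset.chain P {S. t S \<noteq> 0} \<and> (\<Sum>S\<in>P. t S) = 1}"

text \<open>
  The homotopy colimit over a finite poset \<open>P\<close>, given by the Bousfield--Kan formula: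
  the coend over \<open>T\<close> of \<open>X T\<close> times the nerve of the category of objects under \<open>T\<close>.
  Points of the disjoint union are triples \<open>(T, x, t)\<close>.
\<close>
abbreviation above :: "'i set set \<Rightarrow> 'i set \<Rightarrow> 'i set set" where
  "above P T \<equiv> {S \<in> P. T \<subseteq> S}"

definition hocolim_rel ::
    "'i set set \<Rightarrow> ('i set \<Rightarrow> 'a topology) \<Rightarrow> ('i set \<Rightarrow> 'i set \<Rightarrow> 'a \<Rightarrow> 'a) \<Rightarrow>
     'i set \<times> 'a \<times> ('i set \<Rightarrow> real) \<Rightarrow> 'i set \<times> 'a \<times> ('i set \<Rightarrow> real) \<Rightarrow> bool" where
  "hocolim_rel P X f z w \<longleftrightarrow>
     (\<exists>S T x t. S \<in> P \<and> T \<in> P \<and> S \<subseteq> T \<and> x \<in> topspace (X S) \<and> t \<in> topspace (nerve (above P T)) \<and>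
        z = (S, x, t) \<and> w = (T, f S T x, t))"

definition hocolim ::
    "'i set set \<Rightarrow> ('i set \<Rightarrow> 'a topology) \<Rightarrow> ('i set \<Rightarrow> 'i set \<Rightarrow> 'a \<Rightarrow> 'a) \<Rightarrow>
     ('i set \<times> 'a \<times> ('i set \<Rightarrow> real)) set topology" where
  "hocolim P X f =
     quotient_topology
       (sum_topology (\<lambda>T. prod_topology (X T) (nerve (above P T))) P)
       (\<lambda>z. {w. equivclp (hocolim_rel P X f) z w})"

text \<open>
  The canonical map to \<open>X V\<close>, sending the class of \<open>(T, x, t)\<close> to \<open>f T V x\<close>; the value does not
  depend on the representative, as every \<open>T \<in> P\<close> will be contained in \<open>V\<close>.
\<close>
definition hocolim_map ::
    "('i set \<Rightarrow> 'i set \<Rightarrow> 'a \<Rightarrow> 'a) \<Rightarrow> 'i set \<Rightarrow> ('i set \<times> 'a \<times> ('i set \<Rightarrow> real)) set \<Rightarrow> 'a" where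
  "hocolim_map f V c = the_elem ((\<lambda>(T, x, t). f T V x) ` c)"

definition cocartesian ::
    "int \<Rightarrow> nat \<Rightarrow> (nat set \<Rightarrow> 'a topology) \<Rightarrow> (nat set \<Rightarrow> nat set \<Rightarrow> 'a \<Rightarrow> 'a) \<Rightarrow> bool" where
  "cocartesian j m X f \<longleftrightarrow>
     cube m X f \<and>
     n_connected_map j (hocolim {T. T \<subset> {1..m}} X f) (X {1..m}) (hocolim_map f {1..m})"


section \<open>The cube of homotopy fibers\<close>

text \<open>
  The inclusions of cell attachments, and therefore the maps of this cube, are identity maps on
  points (see \<^const>\<open>attach_cells\<close>).
\<close>
definition fiber_cube ::
    "'a topology \<Rightarrow> (nat \<Rightarrow> nat) \<Rightarrow> (nat \<Rightarrow> (nat \<Rightarrow> real) \<Rightarrow> 'a) \<Rightarrow> nat \<Rightarrow>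
     'a + nat \<times> (nat \<Rightarrow> real) \<Rightarrow> nat set \<Rightarrow>
     (('a + nat \<times> (nat \<Rightarrow> real)) \<times> (real \<Rightarrow> 'a + nat \<times> (nat \<Rightarrow> real))) topology" where
  "fiber_cube X n \<phi> k x T =
     hofiber (attach_cells X n \<phi> T) (attach_cells X n \<phi> (T \<union> {k})) id x"

end

theory Submission
  imports Defs
begin

text \<open>
  Let \<open>E\<close> be the union of the \<open>\<F>({1..k-1} - {j})\<close>, or the homotopy colimit, over \<open>\<F> = \<F>({1..k-1})\<close>.
  A sphere in the homotopy fiber of \<open>E \<rightarrow> \<F>\<close> amounts to a disc of dimension
  \<open>m < d\<^sub>1 + \<dots> + d\<^sub>k\<close> in \<open>\<F>\<close> with a lift to \<open>E\<close> over its boundary, that is, to a family of paths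
  \<open>\<gamma>\<^sub>v\<close> from \<open>x\<close>.  After a small perturbation, general position yields centres \<open>p\<^sub>j\<close> of the cells such
  that no \<open>\<gamma>\<^sub>v\<close> meets all of \<open>p\<^sub>1, \<dots>, p\<^sub>k\<close>: the tuples \<open>(v, t\<^sub>1, \<dots>, t\<^sub>k)\<close> form a family of dimension
  \<open>m + k\<close>, on which \<open>k\<close> conditions of total codimension \<open>\<Sum>\<^sub>j (d\<^sub>j + 1)\<close> are imposed.
  So the closed sets \<open>A\<close>, where \<open>\<gamma>\<^sub>v\<close> meets all of \<open>p\<^sub>1, \<dots>, p\<^bsub>k-1\<^esub>\<close>, and \<open>B\<close>, where it meets \<open>p\<^sub>k\<close>,
  are disjoint.  Truncate \<open>\<gamma>\<^sub>v\<close> at time \<open>u v\<close>, where \<open>u = 0\<close> on \<open>A\<close> and \<open>u = 1\<close> on \<open>B\<close>: the endpoints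
  avoid \<open>p\<^sub>k\<close> throughout, and in the end every path misses some \<open>p\<^sub>j\<close> with \<open>j < k\<close>.  Blowing up the
  cells from the \<open>p\<^sub>j\<close> turns this into missing the open cell \<open>e\<^sub>j\<close>.  A partition of unity
  subordinate to the sets of those \<open>v\<close> whose path misses \<open>p\<^sub>j\<close> gives the lift to the homotopy colimit.
\<close>

section \<open>Discs, spheres and path spaces\<close>

text \<open>The deformation cannot be kept fixed over the boundary, so connectivity is reduced to
  lifting up to a homotopy that drags the boundary lift along. Accordingly every move must keep a
  path inside each \<open>carrier T\<close> with \<open>k \<in> T\<close> that contains it, and must
  respect the start \<open>x\<close> and the condition on the end; this dictates the order of the
  moves and the extra segment at the start. Nothing is known about \<open>X\<close>, so all moves
  take place in disc coordinates and fix the boundary spheres; thereby they descend to the quotient.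
  General position is obtained without smoothness: coordinates are approximated by Lipschitz
  functions, and boxes are counted. The count even yields a uniform distance
  \<open>\<epsilon>\<close>, so the centres can be thickened to closed balls, and a blow-up by a
  finite factor clears everything outside them. In the homotopy colimit all structure maps are
  inclusions of closed sets compatible with intersections, so that its points amount to points
  \<open>y\<close> of the fiber with weights, and a partition of unity can serve directly as
  weights.\<close>

abbreviation unit_interval :: "real topology" where
  "unit_interval \<equiv> top_of_set {0..1}"

abbreviation nrm :: "nat \<Rightarrow> (nat \<Rightarrow> real) \<Rightarrow> real" where
  "nrm m v \<equiv> L2_set v {..<m}"

definition disc :: "nat \<Rightarrow> (nat \<Rightarrow> real) set" where
  "disc m = {v. (\<forall>i\<ge>m. v i = 0) \<and> nrm m v \<le> 1}"

definition sph :: "nat \<Rightarrow> (nat \<Rightarrow> real) set" where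
  "sph m = {v. (\<forall>i\<ge>m. v i = 0) \<and> nrm m v = 1}"

lemma Euclidean_space_eq: "Euclidean_space m = top_of_set {v. \<forall>i\<ge>m. v i = 0}"
  by (simp add: Euclidean_space_def euclidean_product_topology)

lemma cell_eq: "cell m = top_of_set (disc m)"
  unfolding cell_def Euclidean_space_eq subtopology_subtopology disc_def
  by (rule arg_cong[where f = "subtopology euclidean"]) (auto simp: L2_set_def)

lemma cell_boundary_eq: "cell_boundary m = top_of_set (sph m)"
  unfolding cell_boundary_def Euclidean_space_eq subtopology_subtopology sph_def
  by (rule arg_cong[where f = "subtopology euclidean"]) (auto simp: L2_set_def)

lemma topspace_cell [simp]: "topspace (cell m) = disc m"
  and topspace_cell_boundary [simp]: "topspace (cell_boundary m) = sph m"
  by (simp_all add: cell_eq cell_boundary_eq)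

lemma sph_subset_disc: "sph m \<subseteq> disc m"
  by (auto simp: sph_def disc_def)

lemma nrm_scale: "nrm m (\<lambda>i. c * v i) = \<bar>c\<bar> * nrm m v"
  by (simp add: L2_set_def power_mult_distrib flip: sum_distrib_left)
     (simp add: real_sqrt_mult)

lemma nrm_diff_triangle: "nrm m v \<le> nrm m w + nrm m (\<lambda>i. v i - w i)"
  using L2_set_triangle_ineq[of w "\<lambda>i. v i - w i" "{..<m}"] by simp

lemma nrm_minus_commute: "nrm m (\<lambda>i. v i - w i) = nrm m (\<lambda>i. w i - v i)"
  by (simp add: L2_set_def power2_commute)

lemma continuous_on_nrm [continuous_intros]:
  assumes "continuous_on S f"
  shows "continuous_on S (\<lambda>x. nrm m (f x))"
  unfolding L2_set_def
  by (intro continuous_intros continuous_on_product_then_coordinatewise[OF assms])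

lemma compact_PiE_interval: "compact (PiE UNIV (\<lambda>i::'i. {a..b::real}))"
proof -
  have "compactin (product_topology (\<lambda>i. euclidean) UNIV) (PiE UNIV (\<lambda>i::'i. {a..b::real}))"
    by (simp add: compactin_PiE)
  then show ?thesis
    by (simp add: euclidean_product_topology)
qed

lemma abs_le_nrm: "\<bar>v i\<bar> \<le> nrm m v" if "i < m"
proof -
  have "\<bar>v i\<bar> \<le> nrm m (\<lambda>i. \<bar>v i\<bar>)"
    using that by (intro member_le_L2_set) auto
  then show ?thesis by (simp add: L2_set_def)
qed

text \<open>The ambient type is an infinite product of lines, where boundedness says nothing about
  compactness; but the disc is closed in a Tychonoff cube.\<close>

lemma compact_disc: "compact (disc m)"
proof -
  have "\<bar>v i\<bar> \<le> 1" if "v \<in> disc m" for v i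
    using abs_le_nrm[of i m v] that by (cases "i < m") (auto simp: disc_def)
  then have "disc m \<subseteq> PiE UNIV (\<lambda>i. {-1..1})"
    by (fastforce simp: abs_le_iff)
  moreover have "closed (disc m)"
  proof -
    have "closed {v::nat \<Rightarrow> real. nrm m v \<le> 1}" "closed {v::nat \<Rightarrow> real. v i = 0}" for i
      by (intro closed_Collect_le closed_Collect_eq continuous_intros continuous_on_product_coordinates)+
    moreover have "disc m = (\<Inter>i\<in>{m..}. {v. v i = 0}) \<inter> {v. nrm m v \<le> 1}"
      by (auto simp: disc_def)
    ultimately show ?thesis by auto
  qed
  ultimately show ?thesis
    using compact_PiE_interval compact_Int_closed[of _ "disc m"] by (metis inf.absorb_iff2)
qed

text \<open>One half of the exponential law, for arbitrary \<open>Z\<close>. The points whose path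
  does not map \<open>K\<close> into \<open>U\<close> form the projection of a closed subset of
  \<open>Z \<times> K\<close>, and projection along a compact factor is a closed map.\<close>

lemma continuous_map_into_path_space:
  assumes "continuous_map (prod_topology Z unit_interval) X (\<lambda>(z, t). \<Phi> z t)"
  shows "continuous_map Z (path_space X) (\<lambda>z. restrict (\<Phi> z) {0..1})"
proof -
  have path: "restrict (\<Phi> z) {0..1} \<in> paths X" if "z \<in> topspace Z" for z
  proof -
    have "continuous_map unit_interval X ((\<lambda>(z, t). \<Phi> z t) \<circ> (\<lambda>t. (z, t)))"
      using that by (intro continuous_map_compose[OF _ assms] continuous_map_pairedI) auto
    then have "continuous_map unit_interval X (restrict (\<Phi> z) {0..1})"
      by (rule continuous_map_eq) auto
    then show ?thesis by (simp add: paths_def)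
  qed
  show ?thesis
    unfolding path_space_def
  proof (rule continuous_on_generated_topo)
    fix V assume "V \<in> {{\<gamma> \<in> paths X. \<gamma> ` K \<subseteq> U} | K U. K \<subseteq> {0..1} \<and> compact K \<and> openin X U}"
    then obtain K U where V: "V = {\<gamma> \<in> paths X. \<gamma> ` K \<subseteq> U}" and K: "K \<subseteq> {0..1}" "compact K"
      and U: "openin X U" by blast
    let ?P = "prod_topology Z (top_of_set K)"
    have cont: "continuous_map ?P X (\<lambda>(z, t). \<Phi> z t)"
    proof -
      have "top_of_set K = subtopology unit_interval K"
        using K by (simp add: subtopology_subtopology inf.absorb2)
      then show ?thesis
        using assms by (metis prod_topology_subtopology(2) continuous_map_from_subtopology)
    qed
    let ?C = "{p \<in> topspace ?P. (\<lambda>(z, t). \<Phi> z t) p \<in> topspace X - U}"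
    have "closedin ?P ?C"
      using U by (intro closedin_continuous_map_preimage[OF cont]) auto
    then have "closedin Z (fst ` ?C)"
      using closed_map_fst[of "top_of_set K" Z] K
      by (simp add: closed_map_def compact_space_subtopology compactin_euclidean_iff)
    moreover have "(\<lambda>z. restrict (\<Phi> z) {0..1}) -` V \<inter> topspace Z = topspace Z - fst ` ?C"
    proof -
      have X: "\<Phi> z t \<in> topspace X" if "z \<in> topspace Z" "t \<in> K" for z t
        using continuous_map_image_subset_topspace[OF cont] that by auto
      have "restrict (\<Phi> z) {0..1} ` K = \<Phi> z ` K" for z
        using K(1) by (intro image_cong) auto
      moreover have "\<Phi> z ` K \<subseteq> U \<longleftrightarrow> z \<notin> fst ` ?C" if "z \<in> topspace Z" for z
        using X[OF that] that by (force simp: image_iff)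
      ultimately have "restrict (\<Phi> z) {0..1} \<in> V \<longleftrightarrow> z \<notin> fst ` ?C" if "z \<in> topspace Z" for z
        unfolding V using path[OF that] that by simp
      then show ?thesis by blast
    qed
    ultimately show "openin Z ((\<lambda>z. restrict (\<Phi> z) {0..1}) -` V \<inter> topspace Z)"
      by auto
  next
    have "paths X \<in> {{\<gamma> \<in> paths X. \<gamma> ` K \<subseteq> U} | K U. K \<subseteq> {0..1} \<and> compact K \<and> openin X U}"
      using compact_empty openin_empty[of X] by (intro CollectI exI[of _ "{}"]) auto
    then show "(\<lambda>z. restrict (\<Phi> z) {0..1}) ` topspace Z
        \<subseteq> \<Union> {{\<gamma> \<in> paths X. \<gamma> ` K \<subseteq> U} | K U. K \<subseteq> {0..1} \<and> compact K \<and> openin X U}"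
      using path by blast
  qed
qed

text \<open>The other half rests on local compactness of the interval: a path that sends
  \<open>t\<close> into \<open>U\<close> sends a whole compact neighbourhood \<open>K\<close> of
  \<open>t\<close> into \<open>U\<close>, and this is a subbasic condition.\<close>

lemma continuous_map_path_eval:
  "continuous_map (prod_topology (path_space X) unit_interval) X (\<lambda>(\<gamma>, t). \<gamma> t)"
proof -
  have *: "\<gamma> t \<in> topspace X" if "\<gamma> \<in> paths X" "t \<in> {0..1}" for \<gamma> t
    using that continuous_map_image_subset_topspace[of unit_interval X \<gamma>] by (auto simp: paths_def)
  show ?thesis
    unfolding continuous_map_def
  proof (intro conjI allI impI)
    show "(\<lambda>(\<gamma>, t). \<gamma> t) \<in> topspace (prod_topology (path_space X) unit_interval) \<rightarrow> topspace X"
      using * by (auto simp: topspace_path_space)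
    fix U assume U: "openin X U"
    show "openin (prod_topology (path_space X) unit_interval)
        {p \<in> topspace (prod_topology (path_space X) unit_interval). (case p of (\<gamma>, t) \<Rightarrow> \<gamma> t) \<in> U}"
      (is "openin _ ?O")
      unfolding openin_prod_topology_alt
    proof (intro allI impI)
      fix \<gamma> t assume "(\<gamma>, t) \<in> ?O"
      then have g: "\<gamma> \<in> paths X" "t \<in> {0..1}" "\<gamma> t \<in> U" by (auto simp: topspace_path_space)
      then have "openin unit_interval {s \<in> {0..1}. \<gamma> s \<in> U}"
        using U openin_continuous_map_preimage[of unit_interval X \<gamma> U] by (auto simp: paths_def)
      then obtain e where e: "e > 0" "\<And>s. s \<in> {0..1} \<Longrightarrow> dist s t < e \<Longrightarrow> \<gamma> s \<in> U"
        using g by (auto simp: openin_euclidean_subtopology_iff)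
      define K where "K = {0..1} \<inter> cball t (e/2)"
      have K: "K \<subseteq> {0..1}" "compact K" by (auto simp: K_def)
      have "openin (path_space X) {\<gamma> \<in> paths X. \<gamma> ` K \<subseteq> U}"
        unfolding path_space_def using K U by (intro topology_generated_by_Basis) blast
      moreover have "openin unit_interval ({0..1} \<inter> ball t (e/2))"
        by blast
      moreover have "\<gamma> ` K \<subseteq> U"
        using e by (auto simp: K_def dist_commute)
      moreover have "{\<gamma> \<in> paths X. \<gamma> ` K \<subseteq> U} \<times> ({0..1} \<inter> ball t (e/2)) \<subseteq> ?O"
        by (auto simp: topspace_path_space K_def)
      ultimately show "\<exists>V W. openin (path_space X) V \<and> openin unit_interval W \<and> \<gamma> \<in> V \<and> t \<in> W \<and> V \<times> W \<subseteq> ?O"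
        using g e(1) by (intro exI[of _ "{\<gamma> \<in> paths X. \<gamma> ` K \<subseteq> U}"] exI[of _ "{0..1} \<inter> ball t (e/2)"]) auto
    qed
  qed
qed

lemma continuous_map_path_uncurry:
  assumes "continuous_map Z (path_space X) g"
  shows "continuous_map (prod_topology Z unit_interval) X (\<lambda>(z, t). g z t)"
proof -
  have "continuous_map (prod_topology Z unit_interval) X ((\<lambda>(\<gamma>, t). \<gamma> t) \<circ> (\<lambda>p. (g (fst p), snd p)))"
  proof (intro continuous_map_compose[OF _ continuous_map_path_eval] continuous_map_pairedI continuous_map_snd)
    show "continuous_map (prod_topology Z unit_interval) (path_space X) (\<lambda>p. g (fst p))"
      using continuous_map_compose[OF continuous_map_fst assms] by (simp add: o_def)
  qed
  then show ?thesis by (simp add: o_def case_prod_unfold)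
qed

section \<open>Maps into and out of homotopy fibers\<close>

lemma topspace_hofiber:
  "topspace (hofiber Y X f x) = {(y, \<gamma>). y \<in> topspace Y \<and> \<gamma> \<in> paths X \<and> \<gamma> 1 = f y \<and> \<gamma> 0 = x}"
  by (auto simp: hofiber_def topspace_path_space)

lemma continuous_map_into_hofiber:
  assumes "continuous_map Z Y a"
    and "continuous_map (prod_topology Z unit_interval) X (\<lambda>(z, t). \<Phi> z t)"
    and "\<And>z. z \<in> topspace Z \<Longrightarrow> \<Phi> z 0 = x \<and> \<Phi> z 1 = f (a z)"
  shows "continuous_map Z (hofiber Y X f x) (\<lambda>z. (a z, restrict (\<Phi> z) {0..1}))"
  unfolding hofiber_def
  using assms by (intro continuous_map_into_subtopology continuous_map_pairedI continuous_map_into_path_space) auto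

lemma continuous_map_from_hofiber:
  assumes "continuous_map Z (hofiber Y X f x) g"
  shows "continuous_map Z Y (\<lambda>z. fst (g z))"
    and "continuous_map (prod_topology Z unit_interval) X (\<lambda>(z, t). snd (g z) t)"
    and "z \<in> topspace Z \<Longrightarrow> snd (g z) 0 = x"
    and "z \<in> topspace Z \<Longrightarrow> snd (g z) 1 = f (fst (g z))"
    and "z \<in> topspace Z \<Longrightarrow> snd (g z) \<in> paths X"
proof -
  have *: "continuous_map Z (prod_topology Y (path_space X)) g"
    using assms unfolding hofiber_def continuous_map_in_subtopology by blast
  then show "continuous_map Z Y (\<lambda>z. fst (g z))"
    by (simp add: continuous_map_pairwise o_def)
  have "continuous_map Z (path_space X) (\<lambda>z. snd (g z))"
    using * by (simp add: continuous_map_pairwise o_def)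
  then show "continuous_map (prod_topology Z unit_interval) X (\<lambda>(z, t). snd (g z) t)"
    by (rule continuous_map_path_uncurry)
  show "z \<in> topspace Z \<Longrightarrow> snd (g z) 0 = x"
    "z \<in> topspace Z \<Longrightarrow> snd (g z) 1 = f (fst (g z))"
    "z \<in> topspace Z \<Longrightarrow> snd (g z) \<in> paths X"
    using continuous_map_image_subset_topspace[OF assms]
    by (force simp: topspace_hofiber image_subset_iff case_prod_unfold)+
qed

section \<open>A criterion for connectivity of maps\<close>

lemma continuous_map_compose_continuous_on:
  assumes "continuous_map (top_of_set S) Y f" "continuous_on T h" "h ` T \<subseteq> S"
  shows "continuous_map (top_of_set T) Y (\<lambda>x. f (h x))"
proof -
  have "continuous_map (top_of_set T) (top_of_set S) h"
    using assms by auto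
  then show ?thesis
    using continuous_map_compose[OF _ assms(1), of _ h] by (simp add: o_def)
qed

lemma continuous_map_glue_le:
  fixes p :: "'a::topological_space \<Rightarrow> real"
  assumes p: "continuous_on S p"
    and f: "continuous_map (top_of_set {x\<in>S. p x \<le> c}) Y f"
    and g: "continuous_map (top_of_set {x\<in>S. c \<le> p x}) Y g"
    and eq: "\<And>x. x \<in> S \<Longrightarrow> p x = c \<Longrightarrow> f x = g x"
  shows "continuous_map (top_of_set S) Y (\<lambda>x. if p x \<le> c then f x else g x)"
proof (rule continuous_map_cases_le)
  have "subtopology (top_of_set S) A = top_of_set A" if "A \<subseteq> S" for A
    using that by (simp add: subtopology_subtopology inf.absorb2)
  then show "continuous_map (subtopology (top_of_set S) {x \<in> topspace (top_of_set S). p x \<le> c}) Y f"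
    "continuous_map (subtopology (top_of_set S) {x \<in> topspace (top_of_set S). c \<le> p x}) Y g"
    using f g by auto
qed (use p eq in auto)

lemma continuous_on_fun [continuous_intros]:
  fixes f :: "'a::topological_space \<Rightarrow> 'i \<Rightarrow> 'b::topological_space"
  assumes "\<And>i. continuous_on S (\<lambda>x. f x i)"
  shows "continuous_on S f"
  using continuous_on_coordinatewise_then_product[of S "\<lambda>x i. f x i"] assms by simp

text \<open>\<open>Y\<close> moves the disc in \<open>F\<close>, \<open>B\<close> moves the given
  lift over the sphere compatibly, and \<open>C\<close> lifts the end of \<open>Y\<close>. As
  \<open>B\<close> may move, \<open>C\<close> need not extend \<open>b\<close>; the difference is
  absorbed in a collar of the sphere.\<close>

definition lifts_up_to_homotopy ::
    "nat \<Rightarrow> 'e topology \<Rightarrow> 'f topology \<Rightarrow> ('e \<Rightarrow> 'f) \<Rightarrow> ((nat \<Rightarrow> real) \<Rightarrow> 'f) \<Rightarrow> ((nat \<Rightarrow> real) \<Rightarrow> 'e) \<Rightarrow> bool"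
  where "lifts_up_to_homotopy m E F \<pi> y b \<longleftrightarrow>
    (\<exists>Y B C. continuous_map (top_of_set (disc m \<times> {0..1::real})) F (\<lambda>(v, s). Y v s) \<and>
         continuous_map (top_of_set (sph m \<times> {0..1::real})) E (\<lambda>(v, s). B v s) \<and>
         continuous_map (top_of_set (disc m)) E C \<and>
         (\<forall>v\<in>disc m. Y v 0 = y v \<and> \<pi> (C v) = Y v 1) \<and>
         (\<forall>v\<in>sph m. B v 0 = b v \<and> C v = B v 1 \<and> (\<forall>s\<in>{0..1}. \<pi> (B v s) = Y v s)))"

lemma lifts_up_to_homotopyI:
  assumes "continuous_map (top_of_set (disc m \<times> {0..1::real})) F (\<lambda>(v, s). Y v s)"
    and "continuous_map (top_of_set (sph m \<times> {0..1::real})) E (\<lambda>(v, s). B v s)"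
    and "continuous_map (top_of_set (disc m)) E C"
    and "\<And>v. v \<in> disc m \<Longrightarrow> Y v 0 = y v" "\<And>v. v \<in> disc m \<Longrightarrow> \<pi> (C v) = Y v 1"
    and "\<And>v. v \<in> sph m \<Longrightarrow> B v 0 = b v" "\<And>v. v \<in> sph m \<Longrightarrow> C v = B v 1"
    and "\<And>v s. v \<in> sph m \<Longrightarrow> s \<in> {0..1} \<Longrightarrow> \<pi> (B v s) = Y v s"
  shows "lifts_up_to_homotopy m E F \<pi> y b"
  unfolding lifts_up_to_homotopy_def
  by (rule exI[of _ Y], rule exI[of _ B], rule exI[of _ C]) (use assms in simp)

lemma lifts_up_to_homotopyE:
  assumes "lifts_up_to_homotopy m E F \<pi> y b"
  obtains Y B C where "continuous_map (top_of_set (disc m \<times> {0..1::real})) F (\<lambda>(v, s). Y v s)"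
    "continuous_map (top_of_set (sph m \<times> {0..1::real})) E (\<lambda>(v, s). B v s)"
    "continuous_map (top_of_set (disc m)) E C"
    "\<And>v. v \<in> disc m \<Longrightarrow> Y v 0 = y v" "\<And>v. v \<in> disc m \<Longrightarrow> \<pi> (C v) = Y v 1"
    "\<And>v. v \<in> sph m \<Longrightarrow> B v 0 = b v" "\<And>v. v \<in> sph m \<Longrightarrow> C v = B v 1"
    "\<And>v s. v \<in> sph m \<Longrightarrow> s \<in> {0..1} \<Longrightarrow> \<pi> (B v s) = Y v s"
proof -
  obtain Y B C where "continuous_map (top_of_set (disc m \<times> {0..1::real})) F (\<lambda>(v, s). Y v s) \<and>
     continuous_map (top_of_set (sph m \<times> {0..1::real})) E (\<lambda>(v, s). B v s) \<and>
     continuous_map (top_of_set (disc m)) E C \<and>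
     (\<forall>v\<in>disc m. Y v 0 = y v \<and> \<pi> (C v) = Y v 1) \<and>
     (\<forall>v\<in>sph m. B v 0 = b v \<and> C v = B v 1 \<and> (\<forall>s\<in>{0..1}. \<pi> (B v s) = Y v s))"
    using assms unfolding lifts_up_to_homotopy_def by (elim exE) (rule that)
  then show ?thesis by (intro that[of Y B C]) simp_all
qed

text \<open>
  Given a map of the disc into \<open>F\<close> with a lift to \<open>E\<close> over the sphere, a point \<open>w\<close> of the outer
  half of the disc is sent to \<open>B\<close> at radial time \<open>2 - 2|w|\<close>, the inner half to the lift \<open>C\<close>, and the
  path from the basepoint is traced inside the homotopy \<open>Y\<close>.
\<close>
lemma hofiber_extension:
  assumes pi: "continuous_map E F \<pi>"
    and g: "continuous_map (top_of_set (sph m)) (hofiber E F \<pi> y0) g"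
    and y0: "y0 \<in> topspace F"
    and lift: "\<And>y b. continuous_map (top_of_set (disc m)) F y \<Longrightarrow>
       continuous_map (top_of_set (sph m)) E b \<Longrightarrow> (\<forall>v\<in>sph m. \<pi> (b v) = y v) \<Longrightarrow>
       lifts_up_to_homotopy m E F \<pi> y b"
  obtains h where "continuous_map (top_of_set (disc m)) (hofiber E F \<pi> y0) h"
    "\<And>v. v \<in> sph m \<Longrightarrow> h v = g v"
proof -
  define b where "b = (\<lambda>v. fst (g v))"
  define \<delta> where "\<delta> = (\<lambda>v. snd (g v))"
  have b: "continuous_map (top_of_set (sph m)) E b"
    using continuous_map_from_hofiber(1)[OF g] by (simp add: b_def)
  have \<delta>: "continuous_map (top_of_set (sph m \<times> {0..1})) F (\<lambda>(v, t). \<delta> v t)"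
    using continuous_map_from_hofiber(2)[OF g] by (simp add: \<delta>_def)
  have \<delta>0: "\<delta> v 0 = y0" and \<delta>1: "\<delta> v 1 = \<pi> (b v)" and \<delta>p: "\<delta> v \<in> paths F" if "v \<in> sph m" for v
    using continuous_map_from_hofiber(3-5)[OF g] that by (auto simp: \<delta>_def b_def)
  \<comment> \<open>The paths from \<open>y0\<close> fill the disc: radius serves as time on the
    outer half, and the inner half is sent to \<open>y0\<close>.\<close>
  define y where "y = (\<lambda>w. if nrm m w \<le> 1/2 then y0
    else \<delta> (\<lambda>i. w i / nrm m w) (2 * nrm m w - 1))"
  have unit: "(\<lambda>i. w i / nrm m w) \<in> sph m" if "w \<in> disc m" "nrm m w > 0" for w
    using that nrm_scale[where m = m and c = "1 / nrm m w" and v = w] by (auto simp: disc_def sph_def)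
  have y: "continuous_map (top_of_set (disc m)) F y"
    unfolding y_def
  proof (rule continuous_map_glue_le)
    show "continuous_map (top_of_set {x \<in> disc m. nrm m x \<le> 1/2}) F (\<lambda>x. y0)"
      using y0 by simp
    have "continuous_map (top_of_set {x \<in> disc m. 1/2 \<le> nrm m x}) F
       (\<lambda>w. (\<lambda>(v, t). \<delta> v t) (\<lambda>i. w i / nrm m w, 2 * nrm m w - 1))"
    proof (rule continuous_map_compose_continuous_on[OF \<delta>])
      show "continuous_on {x \<in> disc m. 1/2 \<le> nrm m x} (\<lambda>w. (\<lambda>i. w i / nrm m w, 2 * nrm m w - 1))"
        by (intro continuous_intros continuous_on_product_then_coordinatewise[OF continuous_on_id]) auto
      show "(\<lambda>w. (\<lambda>i. w i / nrm m w, 2 * nrm m w - 1)) ` {x \<in> disc m. 1/2 \<le> nrm m x} \<subseteq> sph m \<times> {0..1}"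
        using unit by (auto simp: disc_def)
    qed
    then show "continuous_map (top_of_set {x \<in> disc m. 1/2 \<le> nrm m x}) F
       (\<lambda>w. \<delta> (\<lambda>i. w i / nrm m w) (2 * nrm m w - 1))"
      by simp
    show "y0 = \<delta> (\<lambda>i. x i / nrm m x) (2 * nrm m x - 1)" if "x \<in> disc m" "nrm m x = 1/2" for x
    proof -
      have "2 * nrm m x - 1 = 0" "nrm m x > 0" using that(2) by simp_all
      then show ?thesis using \<delta>0[OF unit[OF that(1)]] by simp
    qed
    show "continuous_on (disc m) (nrm m)"
      by (intro continuous_intros)
  qed
  have "\<pi> (b v) = y v" if "v \<in> sph m" for v
    using \<delta>1[OF that] that by (simp add: y_def sph_def)
  then have "lifts_up_to_homotopy m E F \<pi> y b" using lift[OF y b] by simp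
  then obtain Y B C where Y: "continuous_map (top_of_set (disc m \<times> {0..1::real})) F (\<lambda>(v, s). Y v s)"
    and B: "continuous_map (top_of_set (sph m \<times> {0..1::real})) E (\<lambda>(v, s). B v s)"
    and C: "continuous_map (top_of_set (disc m)) E C"
    and Y0: "\<And>v. v \<in> disc m \<Longrightarrow> Y v 0 = y v" and Y1: "\<And>v. v \<in> disc m \<Longrightarrow> \<pi> (C v) = Y v 1"
    and B0: "\<And>v. v \<in> sph m \<Longrightarrow> B v 0 = b v" and B1: "\<And>v. v \<in> sph m \<Longrightarrow> C v = B v 1"
    and BY: "\<And>v s. v \<in> sph m \<Longrightarrow> s \<in> {0..1} \<Longrightarrow> \<pi> (B v s) = Y v s"
    by (rule lifts_up_to_homotopyE) (rule that)
  \<comment> \<open>\<open>c\<close> doubles the inner half and pushes the collar radially to the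
    sphere; \<open>r\<close> is 1 on the inner half and decreases to 0 at the sphere, where
    \<open>B\<close> has to be \<open>b\<close>.\<close>
  define c where "c = (\<lambda>w i. w i / max (1/2) (nrm m w))"
  define r where "r = (\<lambda>w. min 1 (2 - 2 * nrm m w))"
  have nc: "nrm m (c w) = nrm m w / max (1/2) (nrm m w)" for w
    using nrm_scale[where m = m and c = "1 / max (1/2) (nrm m w)" and v = w] by (simp add: c_def)
  have c0: "c w i = 0" if "w \<in> disc m" "i \<ge> m" for w i
    using that by (auto simp: disc_def c_def)
  have c: "c w \<in> disc m" if "w \<in> disc m" for w
    using c0[OF that] by (auto simp: disc_def nc divide_le_eq)
  have cs: "c w \<in> sph m" if "w \<in> disc m" "1/2 \<le> nrm m w" for w
    using c0[OF that(1)] that(2) by (auto simp: sph_def nc)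
  have r: "r w \<in> {0..1}" if "w \<in> disc m" for w
    using that by (auto simp: disc_def r_def)
  have ccont: "continuous_on T (\<lambda>x. c (f x))" if "continuous_on T f" for T and f :: "'x::topological_space \<Rightarrow> _"
    unfolding c_def
    by (intro continuous_intros continuous_on_product_then_coordinatewise[OF that] that) (auto simp: max_def)
  have rcont: "continuous_on T (\<lambda>x. r (f x))" if "continuous_on T f" for T and f :: "'x::topological_space \<Rightarrow> _"
    unfolding r_def by (intro continuous_intros that)
  define e where "e = (\<lambda>w. if nrm m w \<le> 1/2 then C (c w) else B (c w) (r w))"
  have e: "continuous_map (top_of_set (disc m)) E e"
    unfolding e_def
  proof (rule continuous_map_glue_le)
    show "continuous_map (top_of_set {x \<in> disc m. nrm m x \<le> 1/2}) E (\<lambda>x. C (c x))"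
      using c by (intro continuous_map_compose_continuous_on[OF C] ccont continuous_on_id) auto
    have "continuous_map (top_of_set {x \<in> disc m. 1/2 \<le> nrm m x}) E (\<lambda>x. (\<lambda>(v, s). B v s) (c x, r x))"
      using cs r by (intro continuous_map_compose_continuous_on[OF B] continuous_on_Pair
        ccont rcont continuous_on_id) auto
    then show "continuous_map (top_of_set {x \<in> disc m. 1/2 \<le> nrm m x}) E (\<lambda>x. B (c x) (r x))"
      by simp
    show "C (c x) = B (c x) (r x)" if "x \<in> disc m" "nrm m x = 1/2" for x
      using B1[OF cs] that by (simp add: r_def)
    show "continuous_on (disc m) (nrm m)"
      by (intro continuous_intros)
  qed
  \<comment> \<open>The path ends at \<open>c w\<close> at homotopy time \<open>r w\<close>. It
    begins at half of \<open>c w\<close> at homotopy time 0, where \<open>Y\<close> is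
    \<open>y\<close> and \<open>y\<close> is \<open>y0\<close> up to radius 1/2. Over the sphere
    \<open>r w = 0\<close>, and the path retraces \<open>\<delta>\<close>.\<close>
  define \<Psi> where "\<Psi> = (\<lambda>w t. Y (\<lambda>i. c w i * ((1 + t) / 2)) (t * r w))"
  have half: "nrm m (\<lambda>i. c w i * ((1 + t) / 2)) = (1 + t) / 2 * nrm m (c w)" if "t \<in> {0..1}" for t w
    using that nrm_scale[where m = m and c = "(1 + t) / 2" and v = "c w"] by (simp add: mult.commute)
  have half_disc: "(\<lambda>i. c w i * ((1 + t) / 2)) \<in> disc m" if "t \<in> {0..1}" "w \<in> disc m" for t w
  proof -
    have "(1 + t) / 2 * nrm m (c w) \<le> 1"
      using that c[OF that(2)] by (intro mult_le_one) (auto simp: disc_def)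
    then have "nrm m (\<lambda>i. c w i * ((1 + t) / 2)) \<le> 1"
      unfolding half[OF that(1)] .
    then show ?thesis
      using c0[OF that(2)] by (simp add: disc_def)
  qed
  have "continuous_map (top_of_set (disc m \<times> {0..1})) F
      (\<lambda>p. (\<lambda>(v, s). Y v s) (\<lambda>i. c (fst p) i * ((1 + snd p) / 2), snd p * r (fst p)))"
  proof (rule continuous_map_compose_continuous_on[OF Y])
    show "continuous_on (disc m \<times> {0..1}) (\<lambda>p. (\<lambda>i. c (fst p) i * ((1 + snd p) / 2), snd p * r (fst p)))"
      by (intro continuous_intros rcont continuous_on_product_then_coordinatewise[OF ccont]) auto
    show "(\<lambda>p. (\<lambda>i. c (fst p) i * ((1 + snd p) / 2), snd p * r (fst p))) ` (disc m \<times> {0..1}) \<subseteq> disc m \<times> {0..1}"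
      using half_disc r by (auto simp: mult_le_one)
  qed
  then have \<Psi>: "continuous_map (prod_topology (top_of_set (disc m)) unit_interval) F (\<lambda>(w, t). \<Psi> w t)"
    by (simp add: \<Psi>_def case_prod_unfold)
  define h where "h = (\<lambda>w. (e w, restrict (\<Psi> w) {0..1}))"
  have "continuous_map (top_of_set (disc m)) (hofiber E F \<pi> y0) h"
    unfolding h_def
  proof (rule continuous_map_into_hofiber[OF e \<Psi>])
    fix w assume "w \<in> topspace (top_of_set (disc m))"
    then have w: "w \<in> disc m" by simp
    have "nrm m (\<lambda>i. c w i * ((1 + 0) / 2)) \<le> 1/2"
      using half[of 0 w] c[OF w] by (simp add: disc_def)
    then have "\<Psi> w 0 = y0"
      using Y0[OF half_disc[of 0 w]] w by (simp add: \<Psi>_def y_def)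
    moreover have "\<Psi> w 1 = \<pi> (e w)"
    proof (cases "nrm m w \<le> 1/2")
      case True
      then show ?thesis
        using Y1[OF c[OF w]] by (simp add: \<Psi>_def e_def r_def)
    next
      case False
      then show ?thesis
        using BY[OF cs[OF w] r[OF w]] by (simp add: \<Psi>_def e_def)
    qed
    ultimately show "\<Psi> w 0 = y0 \<and> \<Psi> w 1 = \<pi> (e w)" ..
  qed
  moreover have "h v = g v" if v: "v \<in> sph m" for v
  proof -
    have n: "nrm m v = 1" and vd: "v \<in> disc m" using v sph_subset_disc by (auto simp: sph_def)
    then have cv: "c v = v" and rv: "r v = 0" by (simp_all add: c_def r_def)
    have "e v = b v" using n cv rv B0[OF v] by (simp add: e_def)
    moreover have "\<Psi> v t = \<delta> v t" if t: "t \<in> {0..1}" for t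
    proof -
      have *: "\<Psi> v t = y (\<lambda>i. v i * ((1 + t) / 2))"
        using Y0[OF half_disc[OF t vd]] by (simp add: \<Psi>_def cv rv)
      have nh: "nrm m (\<lambda>i. v i * ((1 + t) / 2)) = (1 + t) / 2"
        using half[OF t, of v] by (simp add: cv n)
      show ?thesis
      proof (cases "t = 0")
        case True
        then show ?thesis using * nh \<delta>0[OF v] by (simp add: y_def)
      next
        case False
        then have "1 + t \<noteq> 0" "\<not> (1 + t) / 2 \<le> 1/2" using t by auto
        moreover have "v i * ((1 + t) / 2) / ((1 + t) / 2) = v i" for i
          using \<open>1 + t \<noteq> 0\<close> by simp
        moreover have "2 * ((1 + t) / 2) - 1 = t" by (simp add: field_simps)
        ultimately show ?thesis unfolding * y_def nh by simp
      qed
    qed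
    then have "restrict (\<Psi> v) {0..1} = \<delta> v"
      using \<delta>p[OF v] by (intro extensionalityI[of _ "{0..1}"]) (auto simp: paths_def)
    ultimately show ?thesis by (simp add: h_def b_def \<delta>_def)
  qed
  ultimately show ?thesis using that by blast
qed

text \<open>A sphere in the homotopy fiber is a map \<open>b\<close> of the sphere to
  \<open>E\<close> with a null-homotopy of its image in \<open>F\<close>, which amounts to a disc
  \<open>y\<close>. The bound on \<open>m\<close> is the one for discs in a
  \<open>j - 1\<close>-connected space, namely \<open>m \<le> (j - 1) + 1\<close>.\<close>

lemma n_connected_mapI:
  assumes pi: "continuous_map E F \<pi>"
    and lift: "\<And>m y b. int m \<le> j \<Longrightarrow> continuous_map (top_of_set (disc m)) F y \<Longrightarrow>
       continuous_map (top_of_set (sph m)) E b \<Longrightarrow> (\<forall>v\<in>sph m. \<pi> (b v) = y v) \<Longrightarrow>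
       lifts_up_to_homotopy m E F \<pi> y b"
  shows "n_connected_map j E F \<pi>"
  unfolding n_connected_map_def n_connected_space_def cell_eq cell_boundary_eq
proof (intro conjI ballI allI impI pi)
  fix y0 and m :: nat and g
  assume y0: "y0 \<in> topspace F" and m: "int m \<le> j - 1 + 1"
    and g: "continuous_map (top_of_set (sph m)) (hofiber E F \<pi> y0) g"
  obtain h where "continuous_map (top_of_set (disc m)) (hofiber E F \<pi> y0) h"
    "\<And>v. v \<in> sph m \<Longrightarrow> h v = g v"
    by (rule hofiber_extension[OF pi g y0]) (use lift m in auto)
  then show "\<exists>h. continuous_map (top_of_set (disc m)) (hofiber E F \<pi> y0) h \<and>
      (\<forall>v\<in>topspace (top_of_set (sph m)). h v = g v)"
    by auto
qed

section \<open>General position\<close>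

text \<open>On \<open>disc m \<times> {0..1}\<close> this is a genuine distance. Unlike the weighted
  metric of the function type it treats all coordinates alike, as the count of boxes
  requires.\<close>

definition dist_l1 :: "nat \<Rightarrow> (nat \<Rightarrow> real) \<times> real \<Rightarrow> (nat \<Rightarrow> real) \<times> real \<Rightarrow> real" where
  "dist_l1 m p q = (\<Sum>i<m. \<bar>fst p i - fst q i\<bar>) + \<bar>snd p - snd q\<bar>"

lemma dist_l1_nonneg: "0 \<le> dist_l1 m p q"
  by (simp add: dist_l1_def sum_nonneg)

definition lipschitz_l1 :: "nat \<Rightarrow> ((nat \<Rightarrow> real) \<times> real) set \<Rightarrow> ((nat \<Rightarrow> real) \<times> real \<Rightarrow> real) \<Rightarrow> bool" where
  "lipschitz_l1 m S f \<longleftrightarrow> (\<exists>L\<ge>0. \<forall>p\<in>S. \<forall>q\<in>S. \<bar>f p - f q\<bar> \<le> L * dist_l1 m p q)"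

text \<open>Stone-Weierstrass: continuous Lipschitz functions on a compact set are bounded, hence
  closed under products, and the coordinates and the time separate points.\<close>

lemma lipschitz_l1_approximation:
  assumes f: "continuous_on (disc m \<times> {0..1}) f" and e: "e > 0"
  obtains g where "continuous_on (disc m \<times> {0..1}) g" "lipschitz_l1 m (disc m \<times> {0..1}) g"
    "\<And>p. p \<in> disc m \<times> {0..1} \<Longrightarrow> \<bar>f p - g p\<bar> < e"
proof -
  let ?S = "disc m \<times> {0..1::real}"
  let ?R = "{f. continuous_on ?S f \<and> lipschitz_l1 m ?S f}"
  have S: "compact ?S" by (intro compact_Times compact_disc) auto
  interpret function_ring_on ?R ?S
  proof
    fix f g assume fg: "f \<in> ?R" "g \<in> ?R"
    then obtain L M where L: "L \<ge> 0" "\<And>p q. p \<in> ?S \<Longrightarrow> q \<in> ?S \<Longrightarrow> \<bar>f p - f q\<bar> \<le> L * dist_l1 m p q"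
      and M: "M \<ge> 0" "\<And>p q. p \<in> ?S \<Longrightarrow> q \<in> ?S \<Longrightarrow> \<bar>g p - g q\<bar> \<le> M * dist_l1 m p q"
      unfolding lipschitz_l1_def by blast
    have "\<bar>f p + g p - (f q + g q)\<bar> \<le> (L + M) * dist_l1 m p q" if "p \<in> ?S" "q \<in> ?S" for p q
      using L(2)[OF that] M(2)[OF that] by (simp add: distrib_right abs_le_iff)
    then have "lipschitz_l1 m ?S (\<lambda>x. f x + g x)"
      unfolding lipschitz_l1_def using L(1) M(1) by (intro exI[of _ "L + M"]) auto
    then show "(\<lambda>x. f x + g x) \<in> ?R"
      using fg by (auto intro: continuous_on_add)
    have bound: "\<exists>B\<ge>0. \<forall>p\<in>?S. \<bar>h p\<bar> \<le> B" if "continuous_on ?S h" for h :: "_ \<Rightarrow> real"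
    proof -
      have "bounded (h ` ?S)"
        using compact_imp_bounded compact_continuous_image that S by blast
      then obtain B where "\<forall>p\<in>?S. \<bar>h p\<bar> \<le> B" by (auto simp: bounded_iff)
      then show ?thesis by (intro exI[of _ "\<bar>B\<bar>"]) force
    qed
    obtain A where A: "A \<ge> 0" "\<And>p. p \<in> ?S \<Longrightarrow> \<bar>f p\<bar> \<le> A" using bound fg by blast
    obtain B where B: "B \<ge> 0" "\<And>p. p \<in> ?S \<Longrightarrow> \<bar>g p\<bar> \<le> B" using bound fg by blast
    have "\<bar>f p * g p - f q * g q\<bar> \<le> (A * M + L * B) * dist_l1 m p q" if "p \<in> ?S" "q \<in> ?S" for p q
    proof -
      have "f p * g p - f q * g q = f p * (g p - g q) + (f p - f q) * g q"
        by (simp add: algebra_simps)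
      also have "\<bar>\<dots>\<bar> \<le> \<bar>f p\<bar> * \<bar>g p - g q\<bar> + \<bar>f p - f q\<bar> * \<bar>g q\<bar>"
        using abs_triangle_ineq by (metis abs_mult)
      also have "\<dots> \<le> A * (M * dist_l1 m p q) + (L * dist_l1 m p q) * B"
        using A B L M that dist_l1_nonneg by (intro add_mono mult_mono) auto
      finally show ?thesis by (simp add: algebra_simps)
    qed
    then have "lipschitz_l1 m ?S (\<lambda>x. f x * g x)"
      unfolding lipschitz_l1_def using A(1) B(1) L(1) M(1) by (intro exI[of _ "A * M + L * B"]) auto
    then show "(\<lambda>x. f x * g x) \<in> ?R"
      using fg by (auto intro: continuous_on_mult)
  next
    fix c show "(\<lambda>_. c) \<in> ?R" by (auto simp: lipschitz_l1_def)
  next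
    fix p q :: "(nat \<Rightarrow> real) \<times> real" assume pq: "p \<in> ?S" "q \<in> ?S" "p \<noteq> q"
    show "\<exists>f\<in>?R. f p \<noteq> f q"
    proof (cases "snd p = snd q")
      case False
      have "lipschitz_l1 m ?S snd"
        unfolding lipschitz_l1_def by (intro exI[of _ 1]) (auto simp: dist_l1_def sum_nonneg)
      then show ?thesis using False by (intro bexI[of _ snd]) (auto intro: continuous_intros)
    next
      case True
      then obtain i where i: "fst p i \<noteq> fst q i" using pq(3) by (metis prod_eqI ext)
      then have im: "i < m" using pq(1,2) by (auto simp: disc_def) (metis not_le)
      have "\<bar>fst a i - fst b i\<bar> \<le> dist_l1 m a b" for a b :: "(nat \<Rightarrow> real) \<times> real"
        using member_le_sum[of i "{..<m}" "\<lambda>i. \<bar>fst a i - fst b i\<bar>"] im by (auto simp: dist_l1_def)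
      then have "lipschitz_l1 m ?S (\<lambda>p. fst p i)"
        unfolding lipschitz_l1_def by (intro exI[of _ 1]) auto
      moreover have "continuous_on ?S (\<lambda>p. fst p i)"
        by (rule continuous_on_product_then_coordinatewise[OF continuous_on_fst[OF continuous_on_id]])
      ultimately show ?thesis using i by (intro bexI[of _ "\<lambda>p. fst p i"]) auto
    qed
  qed (use S in auto)
  show ?thesis
    using Stone_Weierstrass_basic[OF f e] that by blast
qed

text \<open>
  Pigeonhole: a grid of \<open>Q ^ N\<close> separated values, \<open>N = (\<Sum>j\<in>J. n j)\<close>, cannot be approximated at the
  points of a family of dimension \<open>D < N\<close>, which is covered by \<open>O(Q ^ D)\<close> boxes of size \<open>O(1/Q)\<close>.
\<close>
lemma general_position:
  fixes f :: "nat \<Rightarrow> nat \<Rightarrow> (nat \<Rightarrow> real) \<times> real \<Rightarrow> real"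
  assumes J: "finite J" and dim: "m + card J < (\<Sum>j\<in>J. n j)" and r: "r > 0"
    and lip: "\<And>j i. j \<in> J \<Longrightarrow> i < n j \<Longrightarrow> lipschitz_l1 m (disc m \<times> {0..1}) (f j i)"
  obtains a :: "nat \<Rightarrow> nat \<Rightarrow> real" and \<epsilon> where "\<epsilon> > 0" "\<And>j i. 0 \<le> a j i \<and> a j i \<le> r"
    "\<And>v t. v \<in> disc m \<Longrightarrow> (\<And>j. j \<in> J \<Longrightarrow> t j \<in> {0..1}) \<Longrightarrow>
       \<exists>j\<in>J. \<exists>i<n j. \<epsilon> < \<bar>f j i (v, t j) - a j i\<bar>"
proof -
  let ?S = "disc m \<times> {0..1::real}"
  define IX where "IX = (SIGMA j:J. {..<n j})"
  have IX: "finite IX" "card IX = (\<Sum>j\<in>J. n j)" using J by (auto simp: IX_def)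
  define D where "D = m + card J"
  have "\<forall>x\<in>IX. \<exists>L\<ge>0. \<forall>p\<in>?S. \<forall>q\<in>?S. \<bar>f (fst x) (snd x) p - f (fst x) (snd x) q\<bar> \<le> L * dist_l1 m p q"
    using lip unfolding lipschitz_l1_def IX_def by auto
  then obtain L' where L': "\<And>x. x \<in> IX \<Longrightarrow> L' x \<ge> 0 \<and>
      (\<forall>p\<in>?S. \<forall>q\<in>?S. \<bar>f (fst x) (snd x) p - f (fst x) (snd x) q\<bar> \<le> L' x * dist_l1 m p q)"
    by metis
  define L where "L = (\<Sum>x\<in>IX. L' x)"
  have L0: "L \<ge> 0" using L' by (auto simp: L_def intro: sum_nonneg)
  have L: "\<bar>f j i p - f j i q\<bar> \<le> L * dist_l1 m p q"
    if "j \<in> J" "i < n j" "p \<in> ?S" "q \<in> ?S" for j i p q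
  proof -
    have x: "(j, i) \<in> IX" using that by (auto simp: IX_def)
    then have "L' (j, i) \<le> L" unfolding L_def using IX(1) L' by (intro member_le_sum) auto
    then have "L' (j, i) * dist_l1 m p q \<le> L * dist_l1 m p q"
      using dist_l1_nonneg by (rule mult_right_mono)
    moreover have "\<bar>f j i p - f j i q\<bar> \<le> L' (j, i) * dist_l1 m p q"
      using bspec[OF bspec[OF conjunct2[OF L'[OF x]] that(3)] that(4)] by simp
    ultimately show ?thesis by (rule order_trans[rotated])
  qed
  \<comment> \<open>Points in one box of side \<open>1 / M\<close> differ by at most
    \<open>2 / M\<close> in each disc coordinate, since \<open>[-1, 1]\<close> is rescaled to
    \<open>[0, 1]\<close>, and by \<open>1 / M\<close> in time: hence \<open>2 * m + 1\<close>. With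
    \<open>M = Q * K\<close> this \<open>K\<close> keeps the variation of \<open>f\<close> over a
    box below half a grid step.\<close>
  obtain K :: nat where K: "K > 2 * L * (2 * m + 1) / r" using reals_Archimedean2 by blast
  have K0: "K \<ge> 1"
  proof -
    have "0 \<le> 2 * L * (2 * m + 1) / r" using L0 r by simp
    then show ?thesis using K by linarith
  qed
  \<comment> \<open>There are at most \<open>(2 * M) ^ D = (2 * K) ^ D * Q ^ D\<close> boxes. Taking
    \<open>Q\<close> larger than \<open>(2 * K) ^ D\<close> makes this less than
    \<open>Q ^ (D + 1)\<close>, which is at most the number of grid points.\<close>
  define Q where "Q = (2 * K) ^ D + 1"
  define M where "M = Q * K"
  have Q0: "Q \<ge> 1" by (simp add: Q_def)
  have M0: "M \<ge> 1" using K0 Q0 by (simp add: M_def)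
  define \<delta> where "\<delta> = r / Q"
  have \<delta>: "\<delta> > 0" using r Q0 by (simp add: \<delta>_def)
  have small: "L * ((2 * m + 1) / M) < \<delta> / 2"
  proof -
    define c :: real where "c = 2 * m + 1"
    have "2 * L * c / r < K" using K by (simp add: c_def)
    then have "L * c / K < r / 2"
      using r K0 by (simp add: field_simps)
    then have "L * c / K / Q < r / 2 / Q"
      using Q0 by (intro divide_strict_right_mono) auto
    then show ?thesis
      by (simp add: M_def \<delta>_def c_def mult.commute)
  qed
  define grid where "grid = PiE IX (\<lambda>_. {..<Q})"
  define near where "near = (\<lambda>p v t. v \<in> disc m \<and> (\<forall>j\<in>J. t j \<in> {0..1}) \<and>
     (\<forall>j\<in>J. \<forall>i<n j. \<bar>f j i (v, t j) - real (p (j, i)) * \<delta>\<bar> \<le> \<delta> / 4))"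
  have "\<exists>p\<in>grid. \<forall>v t. \<not> near p v t"
  proof (rule ccontr)
    assume "\<not> ?thesis"
    then have "\<forall>p\<in>grid. \<exists>v t. near p v t" by blast
    then obtain V T where VT: "\<And>p. p \<in> grid \<Longrightarrow> near p (V p) (T p)" by metis
    define box where "box = (\<lambda>p. (restrict (\<lambda>i. nat \<lfloor>(V p i + 1) / 2 * M\<rfloor>) {..<m},
      restrict (\<lambda>j. nat \<lfloor>T p j * M\<rfloor>) J))"
    have floor: "nat \<lfloor>x * real M\<rfloor> \<le> M" if "x \<in> {0..1}" for x :: real
    proof -
      have "x * real M \<le> real M" using that by (simp add: mult_left_le_one_le)
      then show ?thesis by linarith
    qed
    have coord: "(V p i + 1) / 2 \<in> {0..1}" if "p \<in> grid" "i < m" for p i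
      using abs_le_nrm[OF that(2), of "V p"] VT[OF that(1)] by (auto simp: near_def disc_def abs_le_iff)
    have T01: "T p j \<in> {0..1}" if "p \<in> grid" "j \<in> J" for p j
      using VT[OF that(1)] that(2) by (simp add: near_def)
    have "box ` grid \<subseteq> PiE {..<m} (\<lambda>_. {..M}) \<times> PiE J (\<lambda>_. {..M})"
    proof (rule image_subsetI)
      fix p assume p: "p \<in> grid"
      show "box p \<in> PiE {..<m} (\<lambda>_. {..M}) \<times> PiE J (\<lambda>_. {..M})"
        unfolding box_def
        by (intro SigmaI restrict_PiE_iff[THEN iffD2] ballI atMost_iff[THEN iffD2] floor
            coord[OF p] T01[OF p]) auto
    qed
    \<comment> \<open>If two grid points share a box, their entries differ by less than
      \<open>\<delta> / 4 + \<delta> / 2 + \<delta> / 4\<close>, which is one grid step, so they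
      agree.\<close>
    moreover have "inj_on box grid"
    proof (rule inj_onI)
      fix p q assume p: "p \<in> grid" and q: "q \<in> grid" and eq: "box p = box q"
      have same: "\<bar>x - y\<bar> \<le> 1 / M" if "nat \<lfloor>x * real M\<rfloor> = nat \<lfloor>y * real M\<rfloor>" "x \<in> {0..1}" "y \<in> {0..1}" for x y :: real
      proof -
        have "0 \<le> x * real M" "0 \<le> y * real M" using that by auto
        then have "\<lfloor>x * real M\<rfloor> = \<lfloor>y * real M\<rfloor>" using that(1) by linarith
        then have "\<bar>x * real M - y * real M\<bar> \<le> 1" by linarith
        then have "\<bar>x - y\<bar> * real M \<le> 1" by (simp add: abs_mult flip: left_diff_distrib)
        then show ?thesis using M0 by (simp add: field_simps)
      qed
      have v: "\<bar>V p i - V q i\<bar> \<le> 2 / M" if "i < m" for i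
      proof -
        have "nat \<lfloor>(V p i + 1) / 2 * M\<rfloor> = nat \<lfloor>(V q i + 1) / 2 * M\<rfloor>"
          using eq that unfolding box_def by (auto dest!: fun_cong[of _ _ i])
        then have "\<bar>(V p i + 1) / 2 - (V q i + 1) / 2\<bar> \<le> 1 / M"
          using same coord[OF p that] coord[OF q that] by blast
        then show ?thesis by (simp add: abs_le_iff field_simps)
      qed
      have t: "\<bar>T p j - T q j\<bar> \<le> 1 / M" if "j \<in> J" for j
      proof -
        have "nat \<lfloor>T p j * M\<rfloor> = nat \<lfloor>T q j * M\<rfloor>"
          using eq that unfolding box_def by (auto dest!: fun_cong[of _ _ j])
        then show ?thesis
          using same T01[OF p that] T01[OF q that] by blast
      qed
      have "p (j, i) = q (j, i)" if ji: "j \<in> J" "i < n j" for j i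
      proof (rule ccontr)
        assume ne: "p (j, i) \<noteq> q (j, i)"
        have "dist_l1 m (V p, T p j) (V q, T q j) \<le> (\<Sum>i<m. 2 / M) + 1 / M"
          unfolding dist_l1_def using v t[OF ji(1)] by (intro add_mono sum_mono) auto
        also have "\<dots> = (2 * m + 1) / M" by (simp add: add_divide_distrib)
        finally have "L * dist_l1 m (V p, T p j) (V q, T q j) \<le> L * ((2 * m + 1) / M)"
          using L0 by (intro mult_left_mono)
        then have "\<bar>f j i (V p, T p j) - f j i (V q, T q j)\<bar> < \<delta> / 2"
        proof -
          have "(V p, T p j) \<in> ?S" "(V q, T q j) \<in> ?S"
            using VT[OF p] VT[OF q] ji(1) by (auto simp: near_def)
          from L[OF ji this] show ?thesis
            using \<open>L * dist_l1 m _ _ \<le> _\<close> small by linarith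
        qed
        moreover have "\<bar>f j i (V p, T p j) - real (p (j, i)) * \<delta>\<bar> \<le> \<delta> / 4"
          "\<bar>f j i (V q, T q j) - real (q (j, i)) * \<delta>\<bar> \<le> \<delta> / 4"
          using VT[OF p] VT[OF q] ji by (auto simp: near_def)
        ultimately have "\<bar>real (p (j, i)) * \<delta> - real (q (j, i)) * \<delta>\<bar> < \<delta>" by linarith
        then have "\<bar>real (p (j, i)) - real (q (j, i))\<bar> * \<delta> < 1 * \<delta>"
          using \<delta> by (simp add: abs_mult flip: left_diff_distrib)
        then have "\<bar>real (p (j, i)) - real (q (j, i))\<bar> < 1" using \<delta> by simp
        then show False using ne by linarith
      qed
      then show "p = q"
        using p q unfolding grid_def by (intro PiE_ext[of p IX _ q]) (auto simp: IX_def)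
    qed
    ultimately have "card grid \<le> card (PiE {..<m} (\<lambda>_. {..M}) \<times> PiE J (\<lambda>_. {..M}))"
      using J by (intro card_inj_on_le[of box]) (auto intro!: finite_PiE)
    then have "Q ^ card IX \<le> (M + 1) ^ D"
      using J IX(1) by (simp add: grid_def card_PiE card_cartesian_product D_def power_add)
    also have "\<dots> \<le> (2 * M) ^ D" using M0 by (intro power_mono) auto
    also have "\<dots> = (2 * K) ^ D * Q ^ D" by (simp add: M_def power_mult_distrib)
    also have "\<dots> < Q * Q ^ D" using Q0 by (simp add: Q_def)
    also have "\<dots> \<le> Q ^ card IX"
      using dim IX(2) Q0 by (simp add: D_def flip: power_Suc) (rule power_increasing, auto)
    finally show False by simp
  qed
  then obtain p where p: "p \<in> grid" "\<And>v t. \<not> near p v t" by blast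
  define a where "a = (\<lambda>j i. if (j, i) \<in> IX then real (p (j, i)) * \<delta> else 0)"
  show ?thesis
  proof (rule that[of "\<delta> / 4" a])
    show "0 < \<delta> / 4" using \<delta> by simp
    show "0 \<le> a j i \<and> a j i \<le> r" for j i
    proof (cases "(j, i) \<in> IX")
      case True
      then have "p (j, i) \<le> Q" using PiE_mem[OF p(1)[unfolded grid_def]] by fastforce
      then have "real (p (j, i)) * \<delta> \<le> Q * \<delta>" using \<delta> by (intro mult_right_mono) auto
      moreover have "Q * \<delta> = r" using Q0 by (simp add: \<delta>_def)
      ultimately show ?thesis using \<delta> True by (simp add: a_def)
    qed (use r in \<open>simp add: a_def\<close>)
    fix v and t :: "nat \<Rightarrow> real" assume "v \<in> disc m" "\<And>j. j \<in> J \<Longrightarrow> t j \<in> {0..1}"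
    then show "\<exists>j\<in>J. \<exists>i<n j. \<delta> / 4 < \<bar>f j i (v, t j) - a j i\<bar>"
      using p(2)[of v t] by (force simp: near_def a_def IX_def not_le)
  qed
qed

section \<open>Spaces with attached cells\<close>

text \<open>A form of the tube lemma: the complement is the projection of a closed set along the
  compact \<open>C\<close>.\<close>

lemma openin_forall_compact:
  assumes C: "compactin W C" and G: "continuous_map (prod_topology W Z) Y G" and U: "openin Y U"
  shows "openin Z {z \<in> topspace Z. \<forall>w\<in>C. G (w, z) \<in> U}"
proof -
  let ?P = "prod_topology (subtopology W C) Z"
  have CW: "C \<subseteq> topspace W" using C by (rule compactin_subset_topspace)
  have cont: "continuous_map ?P Y G"
    using G by (simp add: prod_topology_subtopology(1) continuous_map_from_subtopology)
  let ?D = "{p \<in> topspace ?P. G p \<in> topspace Y - U}"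
  have "closedin ?P ?D"
    using U by (intro closedin_continuous_map_preimage[OF cont]) auto
  then have "closedin Z (snd ` ?D)"
    using closed_map_snd[of "subtopology W C" Z] C by (simp add: closed_map_def compact_space_subtopology)
  moreover have "{z \<in> topspace Z. \<forall>w\<in>C. G (w, z) \<in> U} = topspace Z - snd ` ?D"
    using continuous_map_image_subset_topspace[OF cont] CW by force
  ultimately show ?thesis by auto
qed

lemma closed_sph: "closed (sph m)"
proof -
  have "closed {v::nat \<Rightarrow> real. nrm m v = 1}" "closed {v::nat \<Rightarrow> real. v i = 0}" for i
    by (intro closed_Collect_eq continuous_intros continuous_on_product_coordinates)+
  moreover have "sph m = (\<Inter>i\<in>{m..}. {v. v i = 0}) \<inter> {v. nrm m v = 1}"
    by (auto simp: sph_def)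
  ultimately show ?thesis by auto
qed

lemma closedin_disc_sph: "closedin (top_of_set (disc m)) (sph m)"
  using closed_sph sph_subset_disc by (simp add: closed_subset)

lemma attach_carrier_iff [simp]:
  "Inl a \<in> attach_carrier X n T \<longleftrightarrow> a \<in> topspace X"
  "Inr (j, v) \<in> attach_carrier X n T \<longleftrightarrow> j \<in> T \<and> v \<in> disc (n j) \<and> v \<notin> sph (n j)"
  by (auto simp: attach_carrier_def)

lemma attach_carrier_mono: "S \<subseteq> T \<Longrightarrow> attach_carrier X n S \<subseteq> attach_carrier X n T"
  by (auto simp: attach_carrier_def)

lemma attach_carrier_Int: "attach_carrier X n S \<inter> attach_carrier X n T = attach_carrier X n (S \<inter> T)"
  by (auto simp: attach_carrier_def)

section \<open>Topology of the spaces with attached cells\<close>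

locale cell_attachment =
  fixes X :: "'a topology" and n :: "nat \<Rightarrow> nat" and \<phi> :: "nat \<Rightarrow> (nat \<Rightarrow> real) \<Rightarrow> 'a" and J :: "nat set"
  assumes attaching: "j \<in> J \<Longrightarrow> continuous_map (cell_boundary (n j)) X (\<phi> j)"
begin

abbreviation "XT T \<equiv> attach_cells X n \<phi> T"
abbreviation "carrier T \<equiv> attach_carrier X n T"
abbreviation "ch j \<equiv> char_map n \<phi> j"

lemma openin_XT:
  "openin (XT T) U \<longleftrightarrow> U \<subseteq> carrier T \<and> openin X {a \<in> topspace X. Inl a \<in> U} \<and>
     (\<forall>j\<in>T. openin (top_of_set (disc (n j))) {v \<in> disc (n j). ch j v \<in> U})"
  by (simp add: openin_attach_cells cell_eq)

lemma topspace_XT: "T \<subseteq> J \<Longrightarrow> topspace (XT T) = carrier T"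
  using attaching by (intro topspace_attach_cells) auto

lemma ch_in_carrier: "j \<in> J \<Longrightarrow> j \<in> T \<Longrightarrow> v \<in> disc (n j) \<Longrightarrow> ch j v \<in> carrier T"
  using continuous_map_image_subset_topspace[OF attaching] by (auto simp: char_map_def)

lemma ch_interior: "v \<notin> sph (n j) \<Longrightarrow> ch j v = Inr (j, v)"
  by (simp add: char_map_def)

lemma ch_eq_Inr: "ch j v = Inr (i, w) \<longleftrightarrow> v \<notin> sph (n j) \<and> i = j \<and> w = v"
  by (auto simp: char_map_def)

text \<open>The universal property of the quotient. The carrier is covered by the two kinds of test
  maps because a point of an open cell is the image of its own coordinate under
  \<open>ch j\<close>.\<close>

lemma continuous_map_XT_iff:
  assumes "T \<subseteq> J"
  shows "continuous_map (XT T) Y f \<longleftrightarrow> continuous_map X Y (\<lambda>a. f (Inl a)) \<and>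
     (\<forall>j\<in>T. continuous_map (top_of_set (disc (n j))) Y (\<lambda>v. f (ch j v)))" (is "?L \<longleftrightarrow> ?R")
proof
  have Inl: "continuous_map X (XT T) Inl"
    unfolding continuous_map_def openin_XT topspace_XT[OF assms] by auto
  have ch: "continuous_map (top_of_set (disc (n j))) (XT T) (ch j)" if "j \<in> T" for j
    unfolding continuous_map_def openin_XT topspace_XT[OF assms]
    using ch_in_carrier assms that by auto
  show ?R if ?L
  proof (intro conjI ballI)
    show "continuous_map X Y (\<lambda>a. f (Inl a))"
      using continuous_map_compose[OF Inl that] by (simp add: o_def)
    show "continuous_map (top_of_set (disc (n j))) Y (\<lambda>v. f (ch j v))" if "j \<in> T" for j
      using continuous_map_compose[OF ch[OF that] \<open>?L\<close>] by (simp add: o_def)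
  qed
  assume R: ?R
  show ?L
    unfolding continuous_map_def
  proof (intro conjI allI impI)
    have "f q \<in> topspace Y" if "q \<in> carrier T" for q
    proof (cases q)
      case (Inl a)
      moreover have "(\<lambda>a. f (Inl a)) ` topspace X \<subseteq> topspace Y"
        using R continuous_map_image_subset_topspace by blast
      ultimately show ?thesis using that by auto
    next
      case (Inr p)
      then obtain j v where q: "q = Inr (j, v)" by (cases p) auto
      then have j: "j \<in> T" "v \<in> disc (n j)" "q = ch j v" using that ch_interior by auto
      then have "(\<lambda>v. f (ch j v)) ` disc (n j) \<subseteq> topspace Y"
        using R continuous_map_image_subset_topspace[of "top_of_set (disc (n j))" Y "\<lambda>v. f (ch j v)"] by auto
      then show ?thesis using j by auto
    qed
    then show "f \<in> topspace (XT T) \<rightarrow> topspace Y" using topspace_XT[OF assms] by auto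
    fix U assume U: "openin Y U"
    have "{a \<in> topspace X. Inl a \<in> {q \<in> carrier T. f q \<in> U}} = {a \<in> topspace X. f (Inl a) \<in> U}"
      by auto
    moreover have "{v \<in> disc (n j). ch j v \<in> {q \<in> carrier T. f q \<in> U}} = {v \<in> disc (n j). f (ch j v) \<in> U}"
      if "j \<in> T" for j
      using ch_in_carrier that assms by auto
    moreover have "openin X {a \<in> topspace X. f (Inl a) \<in> U}"
      using R U openin_continuous_map_preimage by blast
    moreover have "openin (top_of_set (disc (n j))) {v \<in> disc (n j). f (ch j v) \<in> U}" if "j \<in> T" for j
      using R U that openin_continuous_map_preimage[of "top_of_set (disc (n j))" Y "\<lambda>v. f (ch j v)" U] by simp
    ultimately show "openin (XT T) {q \<in> topspace (XT T). f q \<in> U}"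
      unfolding openin_XT topspace_XT[OF assms] by simp
  qed
qed

lemma continuous_map_Inl: "T \<subseteq> J \<Longrightarrow> continuous_map X (XT T) Inl"
  using continuous_map_XT_iff[of T "XT T" id] by simp

lemma continuous_map_ch: "T \<subseteq> J \<Longrightarrow> j \<in> T \<Longrightarrow> continuous_map (top_of_set (disc (n j))) (XT T) (ch j)"
  using continuous_map_XT_iff[of T "XT T" id] by simp

text \<open>The complement is a union of open cells, whose preimage in each disc is empty or the
  disc without its boundary sphere.\<close>

lemma closedin_carrier:
  assumes "S \<subseteq> T" "T \<subseteq> J"
  shows "closedin (XT T) (carrier S)"
proof -
  have "openin (XT T) (carrier T - carrier S)"
    unfolding openin_XT
  proof (intro conjI ballI)
    show "openin X {a \<in> topspace X. Inl a \<in> carrier T - carrier S}" by simp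
    fix j assume j: "j \<in> T"
    have "{v \<in> disc (n j). ch j v \<in> carrier T - carrier S} = (if j \<in> S then {} else disc (n j) - sph (n j))"
      using ch_in_carrier[of j S] ch_in_carrier[of j T] j assms continuous_map_image_subset_topspace[OF attaching, of j]
      by (auto simp: char_map_def split: if_splits)
    then show "openin (top_of_set (disc (n j))) {v \<in> disc (n j). ch j v \<in> carrier T - carrier S}"
      using closedin_disc_sph by (auto simp: openin_diff)
  qed auto
  then show ?thesis
    using assms attach_carrier_mono[OF assms(1), of X n] by (simp add: closedin_def topspace_XT)
qed

text \<open>An open set \<open>U\<close> of \<open>XT S\<close> becomes open in \<open>XT T\<close>
  once all further open cells are added to it: the preimage in a new disc then omits only those
  boundary points that are attached outside \<open>U\<close>, a closed set.\<close>

lemma subtopology_XT: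
  assumes "S \<subseteq> T" "T \<subseteq> J"
  shows "XT S = subtopology (XT T) (carrier S)"
proof (rule topology_eq[THEN iffD2], intro allI iffI)
  fix U
  assume "openin (subtopology (XT T) (carrier S)) U"
  then obtain V where V: "openin (XT T) V" "U = V \<inter> carrier S" by (auto simp: openin_subtopology)
  have "{a \<in> topspace X. Inl a \<in> U} = {a \<in> topspace X. Inl a \<in> V}" using V by auto
  moreover have "{v \<in> disc (n j). ch j v \<in> U} = {v \<in> disc (n j). ch j v \<in> V}" if "j \<in> S" for j
    using V ch_in_carrier that assms by auto
  ultimately show "openin (XT S) U"
    using V assms by (auto simp: openin_XT)
next
  fix U
  assume U: "openin (XT S) U"
  then have US: "U \<subseteq> carrier S" by (simp add: openin_XT)
  define V where "V = U \<union> (carrier T - carrier S)"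
  have "openin (XT T) V"
    unfolding openin_XT
  proof (intro conjI ballI)
    show "V \<subseteq> carrier T" using US attach_carrier_mono[OF assms(1)] by (auto simp: V_def)
    have "{a \<in> topspace X. Inl a \<in> V} = {a \<in> topspace X. Inl a \<in> U}" by (auto simp: V_def)
    then show "openin X {a \<in> topspace X. Inl a \<in> V}" using U by (simp add: openin_XT)
    fix j assume j: "j \<in> T"
    show "openin (top_of_set (disc (n j))) {v \<in> disc (n j). ch j v \<in> V}"
    proof (cases "j \<in> S")
      case True
      then have "{v \<in> disc (n j). ch j v \<in> V} = {v \<in> disc (n j). ch j v \<in> U}"
        using ch_in_carrier[of j S] assms by (auto simp: V_def)
      then show ?thesis using U True by (simp add: openin_XT)
    next
      case False
      let ?A = "{v \<in> sph (n j). \<phi> j v \<in> topspace X - {a \<in> topspace X. Inl a \<in> U}}"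
      have "openin X {a \<in> topspace X. Inl a \<in> U}"
        using U by (simp add: openin_XT)
      then have "closedin (top_of_set (sph (n j))) ?A"
        using closedin_continuous_map_preimage[OF attaching[of j], of "topspace X - {a \<in> topspace X. Inl a \<in> U}"] j assms
        by (auto simp: cell_boundary_eq)
      then have "closedin (top_of_set (disc (n j))) ?A"
        using closedin_disc_sph closedin_trans by blast
      moreover have "{v \<in> disc (n j). ch j v \<in> V} = disc (n j) - ?A"
        using j assms US False continuous_map_image_subset_topspace[OF attaching, of j]
        by (auto simp: V_def char_map_def split: if_splits)
      ultimately show ?thesis by (simp add: openin_diff)
    qed
  qed
  moreover have "U = V \<inter> carrier S" using US by (auto simp: V_def)
  ultimately show "openin (subtopology (XT T) (carrier S)) U" by (auto simp: openin_subtopology)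
qed

text \<open>A product with a quotient map need not be a quotient map, and compactness of
  \<open>W\<close> is what saves the test on cells. Near \<open>(w, q)\<close> a compact
  neighbourhood \<open>C\<close> of \<open>w\<close> is fixed; the points \<open>q\<close> with
  \<open>f (C \<times> {q})\<close> inside \<open>U\<close> form an open set, because the tube lemma
  applies on \<open>X\<close> and on every disc separately.\<close>

lemma continuous_map_prod_XT:
  fixes W :: "'w::metric_space set" and f :: "'w \<times> ('a + nat \<times> (nat \<Rightarrow> real)) \<Rightarrow> 'b"
  assumes W: "compact W" and T: "T \<subseteq> J"
    and f1: "continuous_map (prod_topology (top_of_set W) X) Y (\<lambda>(w, a). f (w, Inl a))"
    and f2: "\<And>j. j \<in> T \<Longrightarrow> continuous_map (top_of_set (W \<times> disc (n j))) Y (\<lambda>(w, v). f (w, ch j v))"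
  shows "continuous_map (prod_topology (top_of_set W) (XT T)) Y f"
proof -
  have f2': "continuous_map (prod_topology (top_of_set W) (top_of_set (disc (n j)))) Y (\<lambda>(w, v). f (w, ch j v))"
    if "j \<in> T" for j using f2[OF that] by simp
  have slice: "continuous_map (top_of_set W) Y (\<lambda>w. f (w, q))" if q: "q \<in> carrier T" for q
  proof (cases q)
    case (Inl a)
    then have "continuous_map (top_of_set W) Y ((\<lambda>(w, a). f (w, Inl a)) \<circ> (\<lambda>w. (w, a)))"
      using q by (intro continuous_map_compose[OF _ f1] continuous_map_pairedI) auto
    then show ?thesis using Inl by (simp add: o_def)
  next
    case (Inr p)
    then obtain j v where jv: "q = Inr (j, v)" by (cases p) auto
    then have j: "j \<in> T" "v \<in> disc (n j)" "q = ch j v" using q ch_interior by auto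
    then have "continuous_map (top_of_set W) Y ((\<lambda>(w, v). f (w, ch j v)) \<circ> (\<lambda>w. (w, v)))"
      by (intro continuous_map_compose[OF _ f2'[OF j(1)]] continuous_map_pairedI) auto
    then show ?thesis using j by (simp add: o_def)
  qed
  have top: "topspace (prod_topology (top_of_set W) (XT T)) = W \<times> carrier T"
    by (simp add: topspace_XT[OF T])
  show ?thesis
    unfolding continuous_map_def
  proof (intro conjI allI impI)
    show "f \<in> topspace (prod_topology (top_of_set W) (XT T)) \<rightarrow> topspace Y"
      using slice continuous_map_image_subset_topspace unfolding top by fastforce
    fix U assume U: "openin Y U"
    show "openin (prod_topology (top_of_set W) (XT T)) {p \<in> topspace (prod_topology (top_of_set W) (XT T)). f p \<in> U}"
      unfolding openin_prod_topology_alt top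
    proof (intro allI impI)
      fix w q assume wq: "(w, q) \<in> {p \<in> W \<times> carrier T. f p \<in> U}"
      then have "openin (top_of_set W) {w \<in> W. f (w, q) \<in> U}"
        using openin_continuous_map_preimage[OF slice U, of q] by simp
      then obtain e where e: "e > 0" "\<And>w'. w' \<in> W \<Longrightarrow> dist w' w < e \<Longrightarrow> f (w', q) \<in> U"
        using wq by (auto simp: openin_euclidean_subtopology_iff)
      define C where "C = W \<inter> cball w (e/2)"
      have C: "compactin (top_of_set W) C"
        using W by (auto simp: C_def compactin_subtopology compact_Int_closed)
      define V where "V = {q \<in> carrier T. \<forall>w\<in>C. f (w, q) \<in> U}"
      have "openin (XT T) V"
        unfolding openin_XT
      proof (intro conjI ballI)
        have "{a \<in> topspace X. Inl a \<in> V} = {a \<in> topspace X. \<forall>w\<in>C. (\<lambda>(w, a). f (w, Inl a)) (w, a) \<in> U}"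
          by (auto simp: V_def)
        then show "openin X {a \<in> topspace X. Inl a \<in> V}"
          using openin_forall_compact[OF C f1 U] by simp
        fix j assume j: "j \<in> T"
        have "{v \<in> disc (n j). ch j v \<in> V} = {v \<in> disc (n j). \<forall>w\<in>C. (\<lambda>(w, v). f (w, ch j v)) (w, v) \<in> U}"
          using ch_in_carrier j T by (auto simp: V_def)
        then show "openin (top_of_set (disc (n j))) {v \<in> disc (n j). ch j v \<in> V}"
          using openin_forall_compact[OF C f2'[OF j] U] by simp
      qed (auto simp: V_def)
      moreover have "openin (top_of_set W) (W \<inter> ball w (e/2))" by blast
      moreover have "q \<in> V"
        using e wq by (auto simp: V_def C_def dist_commute)
      moreover have "(W \<inter> ball w (e/2)) \<times> V \<subseteq> {p \<in> W \<times> carrier T. f p \<in> U}"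
        by (auto simp: V_def C_def)
      ultimately show "\<exists>A V. openin (top_of_set W) A \<and> openin (XT T) V \<and> w \<in> A \<and> q \<in> V \<and>
          A \<times> V \<subseteq> {p \<in> W \<times> carrier T. f p \<in> U}"
        using e(1) wq by (intro exI[of _ "W \<inter> ball w (e/2)"] exI[of _ V]) auto
    qed
  qed
qed

text \<open>The value goes through \<open>ch j\<close> because \<open>g j\<close> may push a point
  of the open cell onto the sphere, where it becomes a point of \<open>X\<close>. If
  \<open>g j\<close> fixes the sphere, this descends to the quotient.\<close>

definition cellwise :: "(nat \<Rightarrow> 'w \<Rightarrow> (nat \<Rightarrow> real) \<Rightarrow> nat \<Rightarrow> real) \<Rightarrow> 'w \<Rightarrow>
    'a + nat \<times> (nat \<Rightarrow> real) \<Rightarrow> 'a + nat \<times> (nat \<Rightarrow> real)" where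
  "cellwise g w q = (case q of Inl a \<Rightarrow> Inl a | Inr (j, v) \<Rightarrow> ch j (g j w v))"

lemma cellwise_simps [simp]:
  "cellwise g w (Inl a) = Inl a"
  "cellwise g w (Inr (j, v)) = ch j (g j w v)"
  by (simp_all add: cellwise_def)

lemma cellwise_ch:
  assumes "\<And>v. v \<in> sph (n j) \<Longrightarrow> g j w v = v"
  shows "cellwise g w (ch j v) = ch j (g j w v)"
  using assms by (auto simp: char_map_def)

lemma cellwise_in_carrier:
  assumes "T \<subseteq> J" "q \<in> carrier T" "\<And>j v. j \<in> T \<Longrightarrow> v \<in> disc (n j) \<Longrightarrow> g j w v \<in> disc (n j)"
  shows "cellwise g w q \<in> carrier T"
proof (cases q)
  case (Inr p)
  then show ?thesis using assms ch_in_carrier by (cases p) auto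
qed (use assms in auto)

lemma cellwise_eq_Inr:
  assumes "cellwise g w q = Inr (j, u)"
  obtains v where "q = Inr (j, v)" "g j w v = u" "u \<notin> sph (n j)"
  using assms by (cases q) (auto simp: ch_eq_Inr split: prod.splits)

lemma continuous_map_cellwise:
  fixes W :: "'w::metric_space set"
  assumes W: "compact W" and T: "T \<subseteq> J"
    and cont: "\<And>j. j \<in> T \<Longrightarrow> continuous_on (W \<times> disc (n j)) (\<lambda>p. g j (fst p) (snd p))"
    and maps: "\<And>j w v. j \<in> T \<Longrightarrow> w \<in> W \<Longrightarrow> v \<in> disc (n j) \<Longrightarrow> g j w v \<in> disc (n j)"
    and bd: "\<And>j w v. j \<in> T \<Longrightarrow> w \<in> W \<Longrightarrow> v \<in> sph (n j) \<Longrightarrow> g j w v = v"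
  shows "continuous_map (prod_topology (top_of_set W) (XT T)) (XT T) (\<lambda>(w, q). cellwise g w q)"
proof (rule continuous_map_prod_XT[OF W T])
  have "continuous_map (prod_topology (top_of_set W) X) (XT T) (Inl \<circ> snd)"
    by (intro continuous_map_compose[OF continuous_map_snd] continuous_map_Inl[OF T])
  then show "continuous_map (prod_topology (top_of_set W) X) (XT T)
      (\<lambda>(w, a). case (w, Inl a) of (w, q) \<Rightarrow> cellwise g w q)"
    by (simp add: o_def case_prod_unfold)
  fix j assume j: "j \<in> T"
  have "continuous_map (top_of_set (W \<times> disc (n j))) (XT T) (\<lambda>p. ch j (g j (fst p) (snd p)))"
    using maps[OF j] by (intro continuous_map_compose_continuous_on[OF continuous_map_ch[OF T j] cont[OF j]]) auto
  then show "continuous_map (top_of_set (W \<times> disc (n j))) (XT T)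
      (\<lambda>(w, v). case (w, ch j v) of (w, q) \<Rightarrow> cellwise g w q)"
    by (rule continuous_map_eq) (auto simp: cellwise_ch bd[OF j])
qed

lemma closedin_XT_cell:
  assumes "T \<subseteq> J" "j \<in> T" "closed Z" "Z \<subseteq> disc (n j) - sph (n j)"
  shows "closedin (XT T) {Inr (j, v) | v. v \<in> Z}"
proof -
  have "openin (XT T) (carrier T - {Inr (j, v) | v. v \<in> Z})"
    unfolding openin_XT
  proof (intro conjI ballI)
    have "{a \<in> topspace X. Inl a \<in> carrier T - {Inr (j, v) | v. v \<in> Z}} = topspace X" by auto
    then show "openin X {a \<in> topspace X. Inl a \<in> carrier T - {Inr (j, v) | v. v \<in> Z}}" by simp
    fix i assume i: "i \<in> T"
    have "{v \<in> disc (n i). ch i v \<in> carrier T - {Inr (j, v) | v. v \<in> Z}} = disc (n i) - (if i = j then Z else {})"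
      using assms i ch_in_carrier[of i T] ch_interior[of _ i] by (auto simp: ch_eq_Inr)
    moreover have "closedin (top_of_set (disc (n j))) Z"
      using assms by (intro closed_subset) auto
    ultimately show "openin (top_of_set (disc (n i))) {v \<in> disc (n i). ch i v \<in> carrier T - {Inr (j, v) | v. v \<in> Z}}"
      by (auto simp: openin_diff)
  qed auto
  moreover have "{Inr (j, v) | v. v \<in> Z} \<subseteq> carrier T"
    using assms by auto
  ultimately show ?thesis using topspace_XT[OF assms(1)] by (simp add: closedin_def)
qed

end

section \<open>Moving a family of paths off the cells\<close>

text \<open>The radial retraction of Euclidean space onto the unit disc.\<close>

definition clip :: "nat \<Rightarrow> (nat \<Rightarrow> real) \<Rightarrow> nat \<Rightarrow> real" where
  "clip m v = (\<lambda>i. v i / max 1 (nrm m v))"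

lemma nrm_clip: "nrm m (clip m v) = min 1 (nrm m v)"
  using nrm_scale[where m = m and c = "1 / max 1 (nrm m v)" and v = v]
  by (auto simp: clip_def min_def max_def)

lemma clip_id: "nrm m v \<le> 1 \<Longrightarrow> clip m v = v"
  by (simp add: clip_def)

lemma clip_in_disc: "(\<And>i. i \<ge> m \<Longrightarrow> v i = 0) \<Longrightarrow> clip m v \<in> disc m"
  using nrm_clip[of m v] by (simp add: disc_def) (simp add: clip_def)

lemma clip_in_sph: "(\<And>i. i \<ge> m \<Longrightarrow> v i = 0) \<Longrightarrow> 1 \<le> nrm m v \<Longrightarrow> clip m v \<in> sph m"
  using nrm_clip[of m v] by (simp add: sph_def) (simp add: clip_def)

lemma clip_scale_sph: "v \<in> sph m \<Longrightarrow> 1 \<le> c \<Longrightarrow> clip m (\<lambda>i. c * v i) = v"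
  by (auto simp: clip_def nrm_scale sph_def)

lemma continuous_on_clip [continuous_intros]:
  assumes "continuous_on S f"
  shows "continuous_on S (\<lambda>x. clip m (f x))"
  unfolding clip_def
  by (intro continuous_intros continuous_on_product_then_coordinatewise[OF assms] assms) (auto simp: max_def)

lemma nrm_lt_if_coord_lt:
  assumes "\<And>i. i < m \<Longrightarrow> \<bar>v i\<bar> \<le> e" "real m * e < c"
  shows "nrm m v < c"
proof -
  have "nrm m v \<le> (\<Sum>i<m. \<bar>v i\<bar>)" by (rule L2_set_le_sum_abs)
  also have "\<dots> \<le> (\<Sum>i<m. e)" using assms(1) by (intro sum_mono) auto
  finally show ?thesis using assms(2) by simp
qed

context cell_attachment
begin

definition cell_ball :: "nat \<Rightarrow> (nat \<Rightarrow> real) \<Rightarrow> real \<Rightarrow> ('a + nat \<times> (nat \<Rightarrow> real)) set" where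
  "cell_ball j a \<epsilon> = {Inr (j, u) | u. u \<in> disc (n j) \<and> nrm (n j) (\<lambda>i. u i - a i) \<le> \<epsilon>}"

lemma closedin_cell_ball:
  assumes "T \<subseteq> J" "j \<in> T" "nrm (n j) a + \<epsilon> < 1"
  shows "closedin (XT T) (cell_ball j a \<epsilon>)"
proof -
  define Z where "Z = disc (n j) \<inter> {u. nrm (n j) (\<lambda>i. u i - a i) \<le> \<epsilon>}"
  have "closed {u. nrm (n j) (\<lambda>i. u i - a i) \<le> \<epsilon>}"
    by (intro closed_Collect_le continuous_intros continuous_on_product_coordinates)
  then have "closed Z" using compact_disc compact_imp_closed by (auto simp: Z_def)
  moreover have "u \<notin> sph (n j)" if "u \<in> Z" for u
    using that nrm_diff_triangle[where m = "n j" and v = u and w = a] assms(3) by (auto simp: Z_def sph_def)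
  ultimately have "closedin (XT T) {Inr (j, u) | u. u \<in> Z}"
    using assms by (intro closedin_XT_cell) (auto simp: Z_def)
  then show ?thesis by (simp add: cell_ball_def Z_def)
qed

text \<open>The true coordinate up to radius 3/4, damped to 0 at the sphere so that it extends
  continuously by 0 to the rest of the space.\<close>

definition cell_coord :: "nat \<Rightarrow> nat \<Rightarrow> 'a + nat \<times> (nat \<Rightarrow> real) \<Rightarrow> real" where
  "cell_coord j i q = (case q of Inl a \<Rightarrow> 0
     | Inr (l, v) \<Rightarrow> if l = j then min 1 (4 * (1 - nrm (n j) v)) * v i else 0)"

lemma continuous_map_cell_coord:
  assumes "T \<subseteq> J"
  shows "continuous_map (XT T) euclideanreal (cell_coord j i)"
  unfolding continuous_map_XT_iff[OF assms]
proof (intro conjI ballI)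
  show "continuous_map X euclideanreal (\<lambda>a. cell_coord j i (Inl a))"
    by (simp add: cell_coord_def)
  fix l assume "l \<in> T"
  have "cell_coord j i (ch l v) = (if l = j then min 1 (4 * (1 - nrm (n j) v)) * v i else 0)" for v
    by (auto simp: cell_coord_def char_map_def sph_def)
  moreover have "continuous_on (disc (n l)) (\<lambda>v. min 1 (4 * (1 - nrm (n j) v)) * v i)"
    by (intro continuous_intros continuous_on_product_then_coordinatewise[OF continuous_on_id])
  ultimately show "continuous_map (top_of_set (disc (n l))) euclideanreal (\<lambda>v. cell_coord j i (ch l v))"
    by (cases "l = j") simp_all
qed

text \<open>In the inner half of each cell a point is replaced by Lipschitz approximations of its
  coordinates, in the outer quarter it is left alone. Since the approximation is close, only points
  of the inner half can land near the centre \<open>a j\<close>, and for those the general position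
  statement about the approximations applies.\<close>

lemma perturbation:
  assumes J: "finite J" and dim: "m + card J < (\<Sum>j\<in>J. n j)"
    and \<Phi>: "continuous_map (top_of_set (disc m \<times> {0..1})) (XT J) (\<lambda>(v, t). \<Phi> v t)"
    and \<Phi>0: "\<And>v. v \<in> disc m \<Longrightarrow> \<Phi> v 0 = x"
  obtains \<Theta> :: "(nat \<Rightarrow> real) \<Rightarrow> real \<Rightarrow> real \<Rightarrow> 'a + nat \<times> (nat \<Rightarrow> real)" and a \<epsilon> where
    "continuous_map (top_of_set (disc m \<times> {0..1} \<times> {0..1})) (XT J) (\<lambda>(v, s, t). \<Theta> v s t)"
    "\<And>v t. v \<in> disc m \<Longrightarrow> t \<in> {0..1} \<Longrightarrow> \<Theta> v 0 t = \<Phi> v t"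
    "\<And>v s. v \<in> disc m \<Longrightarrow> s \<in> {0..1} \<Longrightarrow> \<Theta> v s 0 = x"
    "\<And>v s t T. v \<in> disc m \<Longrightarrow> s \<in> {0..1} \<Longrightarrow> t \<in> {0..1} \<Longrightarrow> T \<subseteq> J \<Longrightarrow> \<Phi> v t \<in> carrier T \<Longrightarrow> \<Theta> v s t \<in> carrier T"
    "\<epsilon> > 0" "\<epsilon> \<le> 1/8" "\<And>j. j \<in> J \<Longrightarrow> nrm (n j) (a j) \<le> 1/8 \<and> (\<forall>i\<ge>n j. a j i = 0)"
    "\<And>v \<tau>. v \<in> disc m \<Longrightarrow> (\<And>j. j \<in> J \<Longrightarrow> \<tau> j \<in> {0..1}) \<Longrightarrow> \<exists>j\<in>J. \<Theta> v 1 (\<tau> j) \<notin> cell_ball j (a j) \<epsilon>"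
proof -
  let ?S = "disc m \<times> {0..1::real}"
  have X\<Phi>: "\<Phi> v t \<in> carrier J" if "v \<in> disc m" "t \<in> {0..1}" for v t
    using continuous_map_image_subset_topspace[OF \<Phi>] that topspace_XT[of J] by (auto simp: image_subset_iff)
  \<comment> \<open>Small enough that an error of \<open>2 * r\<close> in each coordinate amounts to
    less than 1/8 in every cell.\<close>
  define r :: real where "r = 1 / (16 * (1 + (\<Sum>j\<in>J. n j)))"
  have r: "r > 0" by (simp add: r_def del: of_nat_sum)
  have nr: "real (n j) * (2 * r) < 1/8" if "j \<in> J" for j
  proof -
    have "n j \<le> (\<Sum>j\<in>J. n j)" using that J by (intro member_le_sum) auto
    then have "real (n j) < 1 + real (\<Sum>j\<in>J. n j)" by linarith
    then show ?thesis by (simp add: r_def field_simps del: of_nat_sum)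
  qed
  define c where "c = (\<lambda>j i p. cell_coord j i (\<Phi> (fst p) (snd p)))"
  have c: "continuous_on ?S (c j i)" for j i
    using continuous_map_compose[OF \<Phi> continuous_map_cell_coord[of J j i]]
    by (simp add: c_def o_def case_prod_unfold)
  have "\<exists>g. continuous_on ?S g \<and> lipschitz_l1 m ?S g \<and> (\<forall>p\<in>?S. \<bar>c j i p - g p\<bar> < r)" for j i
    using lipschitz_l1_approximation[OF c r] by metis
  then obtain g where g: "\<And>j i. continuous_on ?S (g j i)" "\<And>j i. lipschitz_l1 m ?S (g j i)"
    "\<And>j i p. p \<in> ?S \<Longrightarrow> \<bar>c j i p - g j i p\<bar> < r" by metis
  \<comment> \<open>The correction makes the approximation exact at time 0, where every path is at
    \<open>x\<close>. It costs a second error \<open>r\<close>, hence \<open>2 * r\<close>.\<close>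
  define f where "f = (\<lambda>j i p. if i < n j then g j i p - g j i (fst p, 0) + cell_coord j i x else 0)"
  have g0: "continuous_on ?S (\<lambda>p. g j i (fst p, 0))" for j i
    by (rule continuous_on_compose2[OF g(1)])
      (auto intro!: continuous_on_Pair continuous_on_fst continuous_on_const continuous_on_id)
  have f: "continuous_on ?S (f j i)" for j i
    by (cases "i < n j") (simp_all add: f_def continuous_on_add continuous_on_diff g(1) g0)
  have "lipschitz_l1 m ?S (f j i)" if i: "i < n j" for j i
  proof -
    obtain L where L: "L \<ge> 0" "\<And>p q. p \<in> ?S \<Longrightarrow> q \<in> ?S \<Longrightarrow> \<bar>g j i p - g j i q\<bar> \<le> L * dist_l1 m p q"
      using g(2)[of j i] unfolding lipschitz_l1_def by blast
    have "\<bar>f j i p - f j i q\<bar> \<le> 2 * L * dist_l1 m p q" if p: "p \<in> ?S" and q: "q \<in> ?S" for p q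
    proof -
      have "(fst p, 0) \<in> ?S" "(fst q, 0) \<in> ?S" using p q by auto
      then have "\<bar>g j i (fst p, 0) - g j i (fst q, 0)\<bar> \<le> L * dist_l1 m (fst p, 0) (fst q, 0)"
        by (rule L(2))
      also have "\<dots> \<le> L * dist_l1 m p q"
        using L(1) by (intro mult_left_mono) (auto simp: dist_l1_def)
      finally show ?thesis
        using L(2)[OF p q] i by (simp add: f_def abs_le_iff)
    qed
    then show ?thesis unfolding lipschitz_l1_def using L(1) by (intro exI[of _ "2 * L"]) auto
  qed
  then obtain a0 \<epsilon>0 where a0: "\<epsilon>0 > 0" "\<And>j i. 0 \<le> a0 j i \<and> a0 j i \<le> r"
    and avoid: "\<And>v t. v \<in> disc m \<Longrightarrow> (\<And>j. j \<in> J \<Longrightarrow> t j \<in> {0..1}) \<Longrightarrow>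
       \<exists>j\<in>J. \<exists>i<n j. \<epsilon>0 < \<bar>f j i (v, t j) - a0 j i\<bar>"
    using general_position[OF J dim r, of f] by metis
  define a where "a = (\<lambda>j i. if i < n j then a0 j i else 0)"
  define \<epsilon> where "\<epsilon> = min \<epsilon>0 (1/8)"
  have na: "nrm (n j) (a j) < 1/8" if "j \<in> J" for j
  proof (rule nrm_lt_if_coord_lt[of _ _ "2 * r"])
    show "\<bar>a j i\<bar> \<le> 2 * r" if "i < n j" for i using a0(2)[of j i] by (simp add: a_def)
  qed (rule nr[OF that])
  define fv where "fv = (\<lambda>j p i. f j i p)"
  have fv0: "fv j p i = 0" if "i \<ge> n j" for j p i using that by (simp add: fv_def f_def)
  have near: "nrm (n j) (\<lambda>i. fv j p i - c j i p) < 1/8" if "j \<in> J" "p \<in> ?S" for j p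
  proof (rule nrm_lt_if_coord_lt[of _ _ "2 * r"])
    fix i assume i: "i < n j"
    have "(fst p, 0) \<in> ?S" using that by auto
    moreover have "c j i (fst p, 0) = cell_coord j i x" using that(2) \<Phi>0 by (auto simp: c_def)
    ultimately have "\<bar>cell_coord j i x - g j i (fst p, 0)\<bar> < r" using g(3) by metis
    then show "\<bar>fv j p i - c j i p\<bar> \<le> 2 * r"
      using g(3)[OF that(2), of j i] i unfolding fv_def f_def by (simp add: abs_less_iff abs_le_iff)
  qed (rule nr[OF that(1)])
  have fvx: "fv j (v, 0) i = cell_coord j i x" if "i < n j" for j i v
    using that by (simp add: fv_def f_def)
  \<comment> \<open>This is 1 up to radius 1/2 and 0 from radius 3/4 on, so a point moves only where
    \<open>cell_coord\<close> is its true coordinate.\<close>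
  define lam :: "real \<Rightarrow> real" where "lam = (\<lambda>\<rho>. max 0 (min 1 (3 - 4 * \<rho>)))"
  define P where "P = (\<lambda>j w q. clip (n j) (\<lambda>i. q i + snd (snd w) * lam (nrm (n j) q) * (fv j (fst w, fst (snd w)) i - q i)))"
  let ?W = "disc m \<times> {0..1::real} \<times> {0..1::real}"
  have W: "compact ?W" by (intro compact_Times compact_disc) auto
  have P_disc: "P j w q \<in> disc (n j)" if "q \<in> disc (n j)" for j w q
    unfolding P_def by (rule clip_in_disc) (use that fv0 in \<open>auto simp: disc_def\<close>)
  have P_sph: "P j w q = q" if "q \<in> sph (n j)" for j w q
    using that by (simp add: P_def lam_def sph_def clip_id)
  have fvc: "continuous_on A (\<lambda>x. fv j (h x) i)" if "continuous_on A h" "h ` A \<subseteq> ?S"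
    for A and h :: "'z::topological_space \<Rightarrow> _" and j i
    unfolding fv_def using continuous_on_compose2[OF f that] .
  have Pc: "continuous_on (?W \<times> disc (n j)) (\<lambda>p. P j (fst p) (snd p))" for j
    unfolding P_def lam_def
    by (intro continuous_intros fvc continuous_on_product_then_coordinatewise[OF continuous_on_snd[OF continuous_on_id]]) auto
  define \<Theta> where "\<Theta> = (\<lambda>v s t. cellwise P (v, t, s) (\<Phi> v t))"
  have cw: "continuous_map (prod_topology (top_of_set ?W) (XT J)) (XT J) (\<lambda>(w, q). cellwise P w q)"
    by (rule continuous_map_cellwise[OF W order_refl Pc]) (use P_disc P_sph in auto)
  show ?thesis
  proof (rule that[of \<Theta> \<epsilon> a])
    have "continuous_map (top_of_set ?W) (XT J)
        ((\<lambda>(w, q). cellwise P w q) \<circ> (\<lambda>p. ((fst p, snd (snd p), fst (snd p)), \<Phi> (fst p) (snd (snd p)))))"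
    proof (intro continuous_map_compose[OF _ cw] continuous_map_pairedI)
      show "continuous_map (top_of_set ?W) (top_of_set ?W) (\<lambda>p. (fst p, snd (snd p), fst (snd p)))"
        by (auto intro!: continuous_on_Pair continuous_on_fst continuous_on_snd continuous_on_id)
      show "continuous_map (top_of_set ?W) (XT J) (\<lambda>p. \<Phi> (fst p) (snd (snd p)))"
      proof -
        have "continuous_map (top_of_set ?W) (XT J) (\<lambda>p. (\<lambda>(v, t). \<Phi> v t) (fst p, snd (snd p)))"
          by (rule continuous_map_compose_continuous_on[OF \<Phi>])
            (auto intro!: continuous_on_Pair continuous_on_fst continuous_on_snd continuous_on_id)
        then show ?thesis by simp
      qed
    qed
    then show "continuous_map (top_of_set ?W) (XT J) (\<lambda>(v, s, t). \<Theta> v s t)"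
      by (simp add: \<Theta>_def o_def case_prod_unfold)
    show "\<Theta> v 0 t = \<Phi> v t" if "v \<in> disc m" "t \<in> {0..1}" for v t
      using X\<Phi>[OF that] by (cases "\<Phi> v t") (auto simp: \<Theta>_def P_def disc_def clip_id ch_interior)
    show "\<Theta> v s t \<in> carrier T"
      if "v \<in> disc m" "s \<in> {0..1}" "t \<in> {0..1}" "T \<subseteq> J" "\<Phi> v t \<in> carrier T" for v s t T
      unfolding \<Theta>_def by (rule cellwise_in_carrier[OF that(4,5) P_disc])
    show "\<Theta> v s 0 = x" if v: "v \<in> disc m" and s: "s \<in> {0..1}" for v s
    proof (cases x)
      case (Inl a)
      then show ?thesis by (simp add: \<Theta>_def \<Phi>0[OF v])
    next
      case (Inr p)
      then obtain j u where x: "x = Inr (j, u)" by (cases p) auto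
      have u: "j \<in> J" "u \<in> disc (n j)" "u \<notin> sph (n j)"
        using X\<Phi>[OF v, of 0] by (auto simp: \<Phi>0[OF v] x)
      \<comment> \<open>The start stays fixed: the target differs from \<open>u\<close> only beyond
        radius 3/4, where \<open>lam\<close> vanishes.\<close>
      have "s * lam (nrm (n j) u) * (fv j (v, 0) i - u i) = 0" for i
      proof (cases "i < n j")
        case True
        then have "fv j (v, 0) i - u i = (min 1 (4 * (1 - nrm (n j) u)) - 1) * u i"
          by (simp add: fvx x cell_coord_def algebra_simps)
        moreover have "lam (nrm (n j) u) * (min 1 (4 * (1 - nrm (n j) u)) - 1) = 0"
          by (auto simp: lam_def)
        ultimately show ?thesis by (metis mult.assoc mult_zero_left mult_zero_right)
      qed (use u fv0 in \<open>auto simp: disc_def\<close>)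
      then have "(\<lambda>i. u i + s * lam (nrm (n j) u) * (fv j (v, 0) i - u i)) = u"
        by (simp only: add_0_right)
      then have "P j (v, 0, s) u = u"
        using u unfolding P_def by (simp add: disc_def clip_id)
      then show ?thesis using u by (simp add: \<Theta>_def \<Phi>0[OF v] x ch_interior)
    qed
    show "0 < \<epsilon>" "\<epsilon> \<le> 1/8" using a0 by (auto simp: \<epsilon>_def)
    show "nrm (n j) (a j) \<le> 1/8 \<and> (\<forall>i\<ge>n j. a j i = 0)" if "j \<in> J" for j
      using na[OF that] by (simp add: a_def)
    show "\<exists>j\<in>J. \<Theta> v 1 (\<tau> j) \<notin> cell_ball j (a j) \<epsilon>"
      if v: "v \<in> disc m" and \<tau>: "\<And>j. j \<in> J \<Longrightarrow> \<tau> j \<in> {0..1}" for v \<tau>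
    proof -
      obtain j i where j: "j \<in> J" "i < n j" and far: "\<epsilon>0 < \<bar>f j i (v, \<tau> j) - a0 j i\<bar>"
        using avoid[of v \<tau>, OF v \<tau>] by blast
      let ?N = "nrm (n j)"
      have "\<Theta> v 1 (\<tau> j) \<notin> cell_ball j (a j) \<epsilon>"
      proof
        assume "\<Theta> v 1 (\<tau> j) \<in> cell_ball j (a j) \<epsilon>"
        then obtain u where u: "\<Theta> v 1 (\<tau> j) = Inr (j, u)" "?N (\<lambda>i. u i - a j i) \<le> \<epsilon>"
          by (auto simp: cell_ball_def)
        then obtain q where q: "\<Phi> v (\<tau> j) = Inr (j, q)" "P j (v, \<tau> j, 1) q = u"
          unfolding \<Theta>_def by (auto elim: cellwise_eq_Inr)
        \<comment> \<open>Tracing \<open>u\<close> back: its radius is at most 1/8 + 1/8, so nothing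
          was clipped; its origin \<open>q\<close> has radius below 3/4, as otherwise it would not
          have moved; hence it moved by less than 1/8, so \<open>q\<close> lies within radius 1/2
          and was carried exactly to the approximation, which stays away from the centre.\<close>
        have Nu: "?N u \<le> 1/4"
          using nrm_diff_triangle[where m = "n j" and v = u and w = "a j"] na[OF j(1)] u(2) by (simp add: \<epsilon>_def)
        have qd: "?N q \<le> 1" using X\<Phi>[OF v \<tau>[OF j(1)]] q by (simp add: disc_def)
        define F where "F = fv j (v, \<tau> j)"
        define z where "z = (\<lambda>i. q i + lam (?N q) * (F i - q i))"
        have z: "clip (n j) z = u" using q(2) by (simp add: P_def z_def F_def)
        then have "min 1 (?N z) \<le> 1/4" using nrm_clip[of "n j" z] Nu by simp
        then have Nz: "?N z \<le> 1/4" by linarith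
        then have zu: "z = u" using z clip_id[where m = "n j" and v = z] by simp
        have "?N q < 3/4"
        proof (rule ccontr)
          assume "\<not> ?thesis"
          then have "z = q" "3/4 \<le> ?N q" by (simp_all add: z_def lam_def)
          then show False using Nz by simp
        qed
        then have "c j i (v, \<tau> j) = q i" for i
          by (simp add: c_def cell_coord_def q(1))
        then have "?N (\<lambda>i. F i - q i) < 1/8"
          using near[OF j(1), of "(v, \<tau> j)"] v \<tau>[OF j(1)] by (simp add: F_def)
        moreover have "?N (\<lambda>i. z i - q i) = lam (?N q) * ?N (\<lambda>i. F i - q i)"
          by (simp add: z_def nrm_scale lam_def)
        moreover have "0 \<le> lam (?N q)" "lam (?N q) \<le> 1" by (auto simp: lam_def)
        ultimately have "?N (\<lambda>i. z i - q i) < 1/8"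
          using mult_left_le_one_le[of "?N (\<lambda>i. F i - q i)" "lam (?N q)"] by simp
        then have "?N q < 1/2"
          using nrm_diff_triangle[where m = "n j" and v = q and w = z] nrm_minus_commute[where m = "n j" and v = q and w = z] Nz by linarith
        then have "lam (?N q) = 1" by (simp add: lam_def)
        then have "u i = f j i (v, \<tau> j)" using zu by (auto simp: z_def F_def fv_def)
        moreover have "\<bar>u i - a j i\<bar> \<le> \<epsilon>"
          using abs_le_nrm[OF j(2), of "\<lambda>i. u i - a j i"] u(2) by simp
        ultimately show False using far j(2) by (simp add: a_def \<epsilon>_def)
      qed
      then show ?thesis using j(1) by blast
    qed
  qed
qed

text \<open>A linear expansion by \<open>1 + M\<close> away from \<open>a j\<close>, clipped to the
  disc. The weight \<open>\<mu>\<close> is 1 up to radius 1/2 and fades to 0 at the sphere, moving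
  the centre of expansion to the origin there, so that the sphere is fixed.\<close>

lemma expansion:
  assumes \<epsilon>: "\<epsilon> > 0" and a: "\<And>j. j \<in> J \<Longrightarrow> nrm (n j) (a j) \<le> 1/8 \<and> (\<forall>i\<ge>n j. a j i = 0)"
  obtains G :: "real \<Rightarrow> 'a + nat \<times> (nat \<Rightarrow> real) \<Rightarrow> 'a + nat \<times> (nat \<Rightarrow> real)" where
    "continuous_map (prod_topology unit_interval (XT J)) (XT J) (\<lambda>(s, q). G s q)"
    "\<And>q. q \<in> carrier J \<Longrightarrow> G 0 q = q"
    "\<And>s q T. T \<subseteq> J \<Longrightarrow> s \<in> {0..1} \<Longrightarrow> q \<in> carrier T \<Longrightarrow> G s q \<in> carrier T"
    "\<And>q j u. q \<in> carrier J \<Longrightarrow> G 1 q = Inr (j, u) \<Longrightarrow> q \<in> cell_ball j (a j) \<epsilon>"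
proof -
  \<comment> \<open>For a point that is not pushed out of the cell the vector from the centre has
    length below \<open>2 / M\<close>. The bound \<open>M \<ge> 8\<close> then places the point
    within radius 1/2, where \<open>\<mu>\<close> is 1 and the centre is truly \<open>a j\<close>;
    the bound \<open>M * \<epsilon> \<ge> 2\<close> places it within \<open>\<epsilon>\<close> of
    \<open>a j\<close>.\<close>
  define M where "M = 8 + 2 / \<epsilon>"
  have M: "M \<ge> 8" "M * \<epsilon> \<ge> 2" using \<epsilon> by (auto simp: M_def field_simps)
  define \<mu> :: "real \<Rightarrow> real" where "\<mu> = (\<lambda>\<rho>. max 0 (min 1 (2 * (1 - \<rho>))))"
  define g where "g = (\<lambda>j s q. clip (n j) (\<lambda>i. q i + s * M * (q i - \<mu> (nrm (n j) q) * a j i)))"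
  have g_disc: "g j s q \<in> disc (n j)" if "j \<in> J" "q \<in> disc (n j)" for j s q
    unfolding g_def by (rule clip_in_disc) (use that a in \<open>auto simp: disc_def\<close>)
  have g_sph: "g j s q = q" if "s \<in> {0..1}" "q \<in> sph (n j)" for j s q
  proof -
    have "\<mu> (nrm (n j) q) = 0" using that by (simp add: \<mu>_def sph_def)
    then have "g j s q = clip (n j) (\<lambda>i. (1 + s * M) * q i)"
      by (simp add: g_def algebra_simps)
    then show ?thesis using that M clip_scale_sph[OF that(2), of "1 + s * M"] by simp
  qed
  have g_cont: "continuous_on ({0..1} \<times> disc (n j)) (\<lambda>p. g j (fst p) (snd p))" for j
    unfolding g_def \<mu>_def
    by (intro continuous_intros continuous_on_product_then_coordinatewise[OF continuous_on_snd[OF continuous_on_id]])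
  show ?thesis
  proof (rule that[of "cellwise g"])
    show "continuous_map (prod_topology unit_interval (XT J)) (XT J) (\<lambda>(s, q). cellwise g s q)"
      by (rule continuous_map_cellwise[OF _ order_refl g_cont]) (use g_disc g_sph in auto)
    show "cellwise g 0 q = q" if "q \<in> carrier J" for q
      using that by (cases q) (auto simp: g_def disc_def clip_id ch_interior)
    show "cellwise g s q \<in> carrier T" if "T \<subseteq> J" "s \<in> {0..1}" "q \<in> carrier T" for s q T
      by (rule cellwise_in_carrier[OF that(1,3)]) (use g_disc that in auto)
    fix q j u assume q: "q \<in> carrier J" and "cellwise g 1 q = Inr (j, u)"
    then obtain p where p: "q = Inr (j, p)" "g j 1 p = u" "u \<notin> sph (n j)"
      by (auto elim: cellwise_eq_Inr)
    then have j: "j \<in> J" and pd: "p \<in> disc (n j)" using q by auto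
    let ?N = "nrm (n j)"
    define b where "b = (\<lambda>i. p i - \<mu> (?N p) * a j i)"
    define z where "z = (\<lambda>i. p i + M * b i)"
    have "clip (n j) z = u" using p(2) by (simp add: g_def z_def b_def)
    moreover have "z i = 0" if "i \<ge> n j" for i
      using that pd a[OF j] by (simp add: z_def b_def disc_def)
    \<comment> \<open>Otherwise clipping would put the image on the sphere, so that it would be a
      point of \<open>X\<close>.\<close>
    ultimately have Nz: "?N z < 1"
      using clip_in_sph[of "n j" z] p(3) by force
    have "M * ?N b = ?N (\<lambda>i. z i - p i)"
      using M by (simp add: z_def nrm_scale)
    also have "\<dots> \<le> ?N z + ?N p"
      using nrm_diff_triangle[where m = "n j" and v = "\<lambda>i. z i - p i" and w = z]
      by (simp add: L2_set_def)
    finally have Mb: "M * ?N b < 2" using Nz pd by (simp add: disc_def)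
    have "?N p \<le> ?N b + ?N (\<lambda>i. \<mu> (?N p) * a j i)"
      using nrm_diff_triangle[where m = "n j" and v = p and w = b] by (simp add: b_def)
    also have "?N (\<lambda>i. \<mu> (?N p) * a j i) \<le> 1/8"
    proof -
      have "?N (\<lambda>i. \<mu> (?N p) * a j i) = \<mu> (?N p) * ?N (a j)"
        by (simp add: nrm_scale \<mu>_def)
      also have "\<dots> \<le> ?N (a j)" by (rule mult_left_le_one_le) (auto simp: \<mu>_def)
      finally show ?thesis using a[OF j] by linarith
    qed
    finally have Np: "?N p \<le> ?N b + 1/8" by simp
    have "8 * ?N b \<le> M * ?N b" using M by (intro mult_right_mono) auto
    then have "?N p \<le> 1/2" using Mb Np by simp
    then have "\<mu> (?N p) = 1" by (simp add: \<mu>_def)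
    moreover have "M * ?N b < M * \<epsilon>" using Mb M(2) by linarith
    then have "?N b < \<epsilon>" using M(1) by (simp add: mult_less_cancel_left_pos)
    ultimately show "q \<in> cell_ball j (a j) \<epsilon>"
      using p pd by (auto simp: cell_ball_def b_def)
  qed
qed

end

lemma closedin_exists_unit_interval:
  assumes H: "continuous_map (top_of_set (D \<times> {0..1::real})) Y (\<lambda>(v, t). H v t)" and C: "closedin Y C"
  shows "closedin (top_of_set D) {v \<in> D. \<exists>t\<in>{0..1}. H v t \<in> C}"
proof -
  have "closedin (top_of_set (D \<times> {0..1})) {p \<in> topspace (top_of_set (D \<times> {0..1})). (\<lambda>(v, t). H v t) p \<in> C}"
    (is "closedin _ ?A")
    by (rule closedin_continuous_map_preimage[OF H C])
  then have "closedin (prod_topology (top_of_set D) unit_interval) ?A" by simp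
  then have "closedin (top_of_set D) (fst ` ?A)"
    using closed_map_fst[of unit_interval "top_of_set D"]
    by (simp add: closed_map_def compact_space_subtopology)
  moreover have "fst ` ?A = {v \<in> D. \<exists>t\<in>{0..1}. H v t \<in> C}" by force
  ultimately show ?thesis by simp
qed

lemma Urysohn_compact:
  fixes D :: "'a::metric_space set"
  assumes "compact D" "closedin (top_of_set D) A" "closedin (top_of_set D) B" "A \<inter> B = {}"
  obtains u :: "'a \<Rightarrow> real" where "continuous_on D u" "u ` D \<subseteq> {0..1}"
    "\<And>v. v \<in> A \<Longrightarrow> u v = 0" "\<And>v. v \<in> B \<Longrightarrow> u v = 1"
proof -
  have "compact_space (top_of_set D)" "Hausdorff_space (top_of_set D)"
    using assms(1) by (auto simp: compact_space_subtopology Hausdorff_space_subtopology)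
  then have "normal_space (top_of_set D)"
    by (simp add: compact_Hausdorff_or_regular_imp_normal_space)
  then obtain u where "continuous_map (top_of_set D) (top_of_set {0..1::real}) u" "u ` A \<subseteq> {0}" "u ` B \<subseteq> {1}"
    using Urysohn_lemma[of "top_of_set D" A B 0 1] assms by (auto simp: disjnt_def)
  then show ?thesis
    by (intro that[of u]) (auto simp: image_subset_iff Pi_iff)
qed

context cell_attachment
begin

text \<open>
  The cells are blown up completely before the paths are truncated: the endpoint of a truncated path
  is only known to avoid the centre of \<open>e\<^sub>k\<close>, not \<open>e\<^sub>k\<close> itself.
\<close>
lemma path_family_deformation:
  assumes J: "finite J" and k: "k \<in> J" "J \<noteq> {k}" and x: "x \<in> carrier {k}"
    and dim: "m + card J < (\<Sum>j\<in>J. n j)"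
    and \<Phi>: "continuous_map (top_of_set (disc m \<times> {0..1})) (XT J) (\<lambda>(v, t). \<Phi> v t)"
    and \<Phi>0: "\<And>v. v \<in> disc m \<Longrightarrow> \<Phi> v 0 = x"
    and \<Phi>1: "\<And>v. v \<in> disc m \<Longrightarrow> \<Phi> v 1 \<in> carrier (J - {k})"
  obtains \<Psi> :: "(nat \<Rightarrow> real) \<Rightarrow> real \<Rightarrow> real \<Rightarrow> 'a + nat \<times> (nat \<Rightarrow> real)" and V where
    "continuous_map (top_of_set (disc m \<times> {0..1} \<times> {0..1})) (XT J) (\<lambda>(v, s, t). \<Psi> v s t)"
    "\<And>v t. v \<in> disc m \<Longrightarrow> t \<in> {0..1} \<Longrightarrow> \<Psi> v 0 t = \<Phi> v t"
    "\<And>v s. v \<in> disc m \<Longrightarrow> s \<in> {0..1} \<Longrightarrow> \<Psi> v s 0 = x"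
    "\<And>v s. v \<in> disc m \<Longrightarrow> s \<in> {0..1} \<Longrightarrow> \<Psi> v s 1 \<in> carrier (J - {k})"
    "\<And>v s t T. v \<in> disc m \<Longrightarrow> s \<in> {0..1} \<Longrightarrow> t \<in> {0..1} \<Longrightarrow> k \<in> T \<Longrightarrow> T \<subseteq> J \<Longrightarrow>
       (\<forall>t\<in>{0..1}. \<Phi> v t \<in> carrier T) \<Longrightarrow> \<Psi> v s t \<in> carrier T"
    "\<And>j. j \<in> J - {k} \<Longrightarrow> openin (top_of_set (disc m)) (V j)"
    "disc m \<subseteq> (\<Union>j\<in>J - {k}. V j)"
    "\<And>v j. v \<in> disc m \<Longrightarrow> j \<in> J - {k} \<Longrightarrow> (\<forall>t\<in>{0..1}. \<Phi> v t \<in> carrier (J - {j})) \<Longrightarrow> v \<in> V j"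
    "\<And>v j t. j \<in> J - {k} \<Longrightarrow> v \<in> V j \<Longrightarrow> t \<in> {0..1} \<Longrightarrow> \<Psi> v 1 t \<in> carrier (J - {j})"
proof -
  let ?I = "{0..1::real}"
  obtain \<Theta> a \<epsilon> where
    \<Theta>: "continuous_map (top_of_set (disc m \<times> ?I \<times> ?I)) (XT J) (\<lambda>(v, s, t). \<Theta> v s t)"
    and \<Theta>s0: "\<And>v t. v \<in> disc m \<Longrightarrow> t \<in> ?I \<Longrightarrow> \<Theta> v 0 t = \<Phi> v t"
    and \<Theta>t0: "\<And>v s. v \<in> disc m \<Longrightarrow> s \<in> ?I \<Longrightarrow> \<Theta> v s 0 = x"
    and \<Theta>T: "\<And>v s t T. v \<in> disc m \<Longrightarrow> s \<in> ?I \<Longrightarrow> t \<in> ?I \<Longrightarrow> T \<subseteq> J \<Longrightarrow> \<Phi> v t \<in> carrier T \<Longrightarrow> \<Theta> v s t \<in> carrier T"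
    and \<epsilon>: "\<epsilon> > 0" "\<epsilon> \<le> 1/8" and a: "\<And>j. j \<in> J \<Longrightarrow> nrm (n j) (a j) \<le> 1/8 \<and> (\<forall>i\<ge>n j. a j i = 0)"
    and miss: "\<And>v \<tau>. v \<in> disc m \<Longrightarrow> (\<And>j. j \<in> J \<Longrightarrow> \<tau> j \<in> ?I) \<Longrightarrow> \<exists>j\<in>J. \<Theta> v 1 (\<tau> j) \<notin> cell_ball j (a j) \<epsilon>"
    by (rule perturbation[OF J dim \<Phi> \<Phi>0]) blast+
  obtain G where
    G: "continuous_map (prod_topology unit_interval (XT J)) (XT J) (\<lambda>(s, q). G s q)"
    and G0: "\<And>q. q \<in> carrier J \<Longrightarrow> G 0 q = q"
    and GT: "\<And>s q T. T \<subseteq> J \<Longrightarrow> s \<in> ?I \<Longrightarrow> q \<in> carrier T \<Longrightarrow> G s q \<in> carrier T"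
    and G1: "\<And>q j u. q \<in> carrier J \<Longrightarrow> G 1 q = Inr (j, u) \<Longrightarrow> q \<in> cell_ball j (a j) \<epsilon>"
    by (rule expansion[OF \<epsilon>(1) a]) blast+
  have \<Phi>J: "\<Phi> v t \<in> carrier J" if "v \<in> disc m" "t \<in> ?I" for v t
    using continuous_map_image_subset_topspace[OF \<Phi>] that topspace_XT[of J] by (auto simp: image_subset_iff)
  define C where "C = (\<lambda>j. cell_ball j (a j) \<epsilon>)"
  have C: "closedin (XT J) (C j)" if "j \<in> J" for j
    unfolding C_def using a[OF that] \<epsilon>(2) that by (intro closedin_cell_ball) auto
  have CT: "q \<notin> C j" if "q \<in> carrier (J - {j})" for q j
    using that by (auto simp: C_def cell_ball_def)
  have G1T: "G 1 q \<in> carrier (J - {j})" if "q \<in> carrier J" "q \<notin> C j" for q j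
  proof -
    have "G 1 q \<in> carrier J" using GT[of J 1 q] that by simp
    moreover have "G 1 q \<noteq> Inr (j, u)" for u using G1[OF that(1)] that(2) by (auto simp: C_def)
    ultimately show ?thesis by (cases "G 1 q") fastforce+
  qed
  have \<Theta>1: "continuous_map (top_of_set (disc m \<times> ?I)) (XT J) (\<lambda>(v, t). \<Theta> v 1 t)"
    using continuous_map_compose_continuous_on[OF \<Theta>, of "disc m \<times> ?I" "\<lambda>p. (fst p, 1, snd p)"]
    by (simp add: case_prod_unfold image_subset_iff continuous_on_Pair continuous_on_fst continuous_on_snd continuous_on_id)
  define A where "A = (\<Inter>j\<in>J - {k}. {v \<in> disc m. \<exists>t\<in>?I. \<Theta> v 1 t \<in> C j})"
  define B where "B = {v \<in> disc m. \<exists>t\<in>?I. \<Theta> v 1 t \<in> C k}"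
  have A: "closedin (top_of_set (disc m)) A"
    unfolding A_def using k C closedin_exists_unit_interval[OF \<Theta>1] by (intro closedin_INT) auto
  have B: "closedin (top_of_set (disc m)) B"
    unfolding B_def using k C closedin_exists_unit_interval[OF \<Theta>1] by blast
  have "A \<inter> B = {}"
  proof (rule ccontr)
    assume "A \<inter> B \<noteq> {}"
    then obtain v where v: "v \<in> A" "v \<in> B" by blast
    then have "\<forall>j\<in>J. \<exists>t\<in>?I. \<Theta> v 1 t \<in> C j" unfolding A_def B_def by auto
    then obtain \<tau> where "\<And>j. j \<in> J \<Longrightarrow> \<tau> j \<in> ?I \<and> \<Theta> v 1 (\<tau> j) \<in> C j" by metis
    then show False using miss[of v \<tau>] v(2) by (auto simp: B_def C_def)
  qed
  then obtain u where u: "continuous_on (disc m) u" "u ` disc m \<subseteq> ?I"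
    and uA: "\<And>v. v \<in> A \<Longrightarrow> u v = 0" and uB: "\<And>v. v \<in> B \<Longrightarrow> u v = 1"
    using Urysohn_compact[OF compact_disc A B] by blast
  \<comment> \<open>Three stages, one in each third of the homotopy time: perturbation, blow-up,
    truncation.\<close>
  define s1 :: "real \<Rightarrow> real" where "s1 = (\<lambda>s. min 1 (3 * s))"
  define s2 :: "real \<Rightarrow> real" where "s2 = (\<lambda>s. max 0 (min 1 (3 * s - 1)))"
  define s3 :: "real \<Rightarrow> real" where "s3 = (\<lambda>s. max 0 (3 * s - 2))"
  \<comment> \<open>During the blow-up the original path is compressed into
    \<open>[s2 s / 2, 1]\<close>, and the parameter waits at 0 before that. The last factor
    decreases from 1 to \<open>u v\<close> and performs the truncation.\<close>
  define \<tau> where "\<tau> = (\<lambda>v s t. max 0 ((t - s2 s / 2) / (1 - s2 s / 2)) * (1 - s3 s + s3 s * u v))"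
  have s01: "s1 s \<in> ?I" "s2 s \<in> ?I" "s3 s \<in> ?I" if "s \<in> ?I" for s
    using that by (auto simp: s1_def s2_def s3_def)
  have \<tau>01: "\<tau> v s t \<in> ?I" if "v \<in> disc m" "s \<in> ?I" "t \<in> ?I" for v s t
  proof -
    have "(t - s2 s / 2) / (1 - s2 s / 2) \<le> 1" using s01(2)[OF that(2)] that(3) by simp
    moreover have "u v \<in> ?I" using u(2) that(1) by blast
    then have "0 \<le> 1 - s3 s + s3 s * u v" "1 - s3 s + s3 s * u v \<le> 1"
      using s01(3)[OF that(2)] mult_left_le[of "u v" "s3 s"] by auto
    ultimately show ?thesis unfolding \<tau>_def by (auto intro!: mult_le_one mult_nonneg_nonneg)
  qed
  \<comment> \<open>The blow-up moves \<open>x\<close> if it lies in \<open>e\<^sub>k\<close>, so the trace of \<open>x\<close> is prepended to the path.\<close>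
  define \<Psi> where "\<Psi> = (\<lambda>v s t. G (min (2 * t) (s2 s)) (\<Theta> v (s1 s) (\<tau> v s t)))"
  have min01: "min (2 * t) (s2 s) \<in> ?I" if "s \<in> ?I" "t \<in> ?I" for s t
    using s01(2)[OF that(1)] that(2) by auto
  let ?W = "disc m \<times> ?I \<times> ?I"
  define V where "V = (\<lambda>j. {v \<in> disc m. \<forall>t\<in>?I. \<Theta> v 1 (t * u v) \<notin> C j})"
  show ?thesis
  proof (rule that[of \<Psi> V])
    have "continuous_map (top_of_set ?W) (XT J)
        ((\<lambda>(s, q). G s q) \<circ> (\<lambda>p. (min (2 * snd (snd p)) (s2 (fst (snd p))),
           \<Theta> (fst p) (s1 (fst (snd p))) (\<tau> (fst p) (fst (snd p)) (snd (snd p))))))"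
    proof (intro continuous_map_compose[OF _ G] continuous_map_pairedI)
      have "continuous_on ?W (\<lambda>p. min (2 * snd (snd p)) (s2 (fst (snd p))))"
        unfolding s2_def by (intro continuous_intros)
      then show "continuous_map (top_of_set ?W) unit_interval (\<lambda>p. min (2 * snd (snd p)) (s2 (fst (snd p))))"
        using min01 by (auto simp: image_subset_iff)
      have nz: "1 - s2 s / 2 \<noteq> 0" if "s \<in> ?I" for s using s01(2)[OF that] by auto
      have uc: "continuous_on ?W (\<lambda>p. u (fst p))"
        by (rule continuous_on_compose2[OF u(1)]) (auto intro!: continuous_on_fst continuous_on_id)
      have s1c: "continuous_on ?W (\<lambda>p. s1 (fst (snd p)))" and s2c: "continuous_on ?W (\<lambda>p. s2 (fst (snd p)))"
        and s3c: "continuous_on ?W (\<lambda>p. s3 (fst (snd p)))"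
        unfolding s1_def s2_def s3_def by (intro continuous_intros)+
      have "continuous_on ?W (\<lambda>p. \<tau> (fst p) (fst (snd p)) (snd (snd p)))"
        unfolding \<tau>_def by (intro continuous_intros uc s2c s3c) (use nz in auto)
      then have "continuous_map (top_of_set ?W) (XT J)
          (\<lambda>p. (\<lambda>(v, s, t). \<Theta> v s t) (fst p, s1 (fst (snd p)), \<tau> (fst p) (fst (snd p)) (snd (snd p))))"
        using s01(1) \<tau>01 s1c
        by (intro continuous_map_compose_continuous_on[OF \<Theta>] continuous_on_Pair continuous_on_fst continuous_on_id) auto
      then show "continuous_map (top_of_set ?W) (XT J)
          (\<lambda>p. \<Theta> (fst p) (s1 (fst (snd p))) (\<tau> (fst p) (fst (snd p)) (snd (snd p))))" by simp
    qed
    then show "continuous_map (top_of_set ?W) (XT J) (\<lambda>(v, s, t). \<Psi> v s t)"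
      by (simp add: \<Psi>_def o_def case_prod_unfold)
    show "\<Psi> v 0 t = \<Phi> v t" if "v \<in> disc m" "t \<in> ?I" for v t
    proof -
      have "\<tau> v 0 t = t" "min (2 * t) (s2 0) = 0" "s1 0 = 0"
        using that by (auto simp: \<tau>_def s1_def s2_def s3_def)
      then show ?thesis using that \<Theta>s0 G0 \<Phi>J by (simp add: \<Psi>_def)
    qed
    have \<tau>00: "\<tau> v s t = 0" if "t \<le> s2 s / 2" "s \<in> ?I" for v s t
    proof -
      have "(t - s2 s / 2) / (1 - s2 s / 2) \<le> 0"
        using that s01(2)[OF that(2)] by (intro divide_nonpos_pos) auto
      then show ?thesis by (simp add: \<tau>_def)
    qed
    show "\<Psi> v s 0 = x" if "v \<in> disc m" "s \<in> ?I" for v s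
    proof -
      have "\<tau> v s 0 = 0" "min (2 * 0) (s2 s) = 0" using s01(2)[OF that(2)] \<tau>00[OF _ that(2)] by auto
      then show ?thesis
        using \<Theta>t0[OF that(1) s01(1)[OF that(2)]] G0[of x] x k(1) attach_carrier_mono[of "{k}" J X n]
        by (auto simp: \<Psi>_def)
    qed
    have \<Theta>J: "\<Theta> v s t \<in> carrier J" if "v \<in> disc m" "s \<in> ?I" "t \<in> ?I" for v s t
      using \<Theta>T[OF that order_refl] \<Phi>J that by blast
    \<comment> \<open>Before truncation, or if \<open>u v = 1\<close>, the end is that of the full
      path, and perturbation and blow-up preserve \<open>carrier (J - {k})\<close>. Otherwise the
      blow-up is complete and \<open>v\<close> is outside \<open>B\<close>, so wherever the path is
      cut, its end misses the ball in cell \<open>k\<close> and is blown off the open cell.\<close>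
    show "\<Psi> v s 1 \<in> carrier (J - {k})" if v: "v \<in> disc m" and s: "s \<in> ?I" for v s
    proof (cases "s3 s = 0 \<or> v \<in> B")
      case True
      then have "\<tau> v s 1 = 1" using uB s01(2)[OF s] by (auto simp: \<tau>_def)
      then show ?thesis
        using GT[of "J - {k}" "min 2 (s2 s)"] \<Theta>T[of v "s1 s" 1 "J - {k}"] \<Phi>1 v s01[OF s] by (simp add: \<Psi>_def)
    next
      case False
      then have "s1 s = 1" "s2 s = 1" by (auto simp: s1_def s2_def s3_def)
      moreover have "\<Theta> v 1 (\<tau> v s 1) \<notin> C k"
        using False v \<tau>01[OF v s, of 1] by (auto simp: B_def)
      ultimately show ?thesis
        using G1T \<Theta>J[OF v _ \<tau>01[OF v s]] by (simp add: \<Psi>_def)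
    qed
    show "\<Psi> v s t \<in> carrier T"
      if "v \<in> disc m" "s \<in> ?I" "t \<in> ?I" "k \<in> T" "T \<subseteq> J" "\<forall>t\<in>?I. \<Phi> v t \<in> carrier T" for v s t T
      unfolding \<Psi>_def using that s01(1) \<tau>01 by (intro GT min01 \<Theta>T) auto
    show "openin (top_of_set (disc m)) (V j)" if "j \<in> J - {k}" for j
    proof -
      have "continuous_map (top_of_set (disc m \<times> ?I)) (XT J) (\<lambda>p. (\<lambda>(v, t). \<Theta> v 1 t) (fst p, snd p * u (fst p)))"
      proof (rule continuous_map_compose_continuous_on[OF \<Theta>1])
        have "continuous_on (disc m \<times> ?I) (\<lambda>p. u (fst p))"
          by (rule continuous_on_compose2[OF u(1)]) (auto intro!: continuous_on_fst continuous_on_id)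
        then show "continuous_on (disc m \<times> ?I) (\<lambda>p. (fst p, snd p * u (fst p)))"
          by (intro continuous_on_Pair continuous_on_mult continuous_on_fst continuous_on_snd continuous_on_id)
        show "(\<lambda>p. (fst p, snd p * u (fst p))) ` (disc m \<times> ?I) \<subseteq> disc m \<times> ?I"
          using u(2) by (auto intro!: mult_le_one mult_nonneg_nonneg)
      qed
      then have "closedin (top_of_set (disc m)) {v \<in> disc m. \<exists>t\<in>?I. \<Theta> v 1 (t * u v) \<in> C j}"
        using that by (intro closedin_exists_unit_interval[OF _ C]) (auto simp: case_prod_unfold)
      moreover have "V j = disc m - {v \<in> disc m. \<exists>t\<in>?I. \<Theta> v 1 (t * u v) \<in> C j}"
        by (auto simp: V_def)
      ultimately show ?thesis by (simp add: openin_diff)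
    qed
    have tu: "t * u v \<in> ?I" if "v \<in> disc m" "t \<in> ?I" for v t
    proof -
      have "u v \<in> ?I" using u(2) that(1) by blast
      then show ?thesis using that(2) by (auto intro!: mult_le_one mult_nonneg_nonneg)
    qed
    show "disc m \<subseteq> (\<Union>j\<in>J - {k}. V j)"
    proof
      fix v assume v: "v \<in> disc m"
      show "v \<in> (\<Union>j\<in>J - {k}. V j)"
      proof (cases "v \<in> A")
        \<comment> \<open>Here \<open>u v = 0\<close> and only the start \<open>x\<close> is left of
          the path. It lies in \<open>carrier {k}\<close>, so any \<open>j\<close> other than
          \<open>k\<close> will do, and \<open>J \<noteq> {k}\<close> provides one.\<close>
        case True
        obtain j where j: "j \<in> J - {k}" using k by blast
        have "x \<in> carrier (J - {j})" using x j k attach_carrier_mono[of "{k}" "J - {j}" X n] by auto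
        then have "x \<notin> C j" by (rule CT)
        then have "v \<in> V j" using uA[OF True] \<Theta>t0[OF v, of 1] v by (simp add: V_def)
        then show ?thesis using j by blast
      next
        case False
        then obtain j where "j \<in> J - {k}" "\<forall>t\<in>?I. \<Theta> v 1 t \<notin> C j"
          using v unfolding A_def by blast
        then have "v \<in> V j" unfolding V_def using tu[OF v] v by blast
        then show ?thesis using \<open>j \<in> J - {k}\<close> by blast
      qed
    qed
    show "v \<in> V j" if "v \<in> disc m" "j \<in> J - {k}" "\<forall>t\<in>?I. \<Phi> v t \<in> carrier (J - {j})" for v j
    proof -
      have "\<Theta> v 1 (t * u v) \<notin> C j" if t: "t \<in> ?I" for t
        using \<Theta>T[of v 1 "t * u v" "J - {j}"] tu[OF \<open>v \<in> disc m\<close> t] that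
          \<open>v \<in> disc m\<close> \<open>\<forall>t\<in>?I. \<Phi> v t \<in> carrier (J - {j})\<close> by (intro CT) auto
      then show ?thesis using \<open>v \<in> disc m\<close> by (simp add: V_def)
    qed
    show "\<Psi> v 1 t \<in> carrier (J - {j})" if j: "j \<in> J - {k}" and "v \<in> V j" and t: "t \<in> ?I" for v j t
    proof -
      have v: "v \<in> disc m" and vV: "\<And>t. t \<in> ?I \<Longrightarrow> \<Theta> v 1 (t * u v) \<notin> C j"
        using \<open>v \<in> V j\<close> by (auto simp: V_def)
      have s1: "s1 1 = 1" "s2 1 = 1" "s3 1 = 1" by (auto simp: s1_def s2_def s3_def)
      show ?thesis
      proof (cases "t \<le> 1/2")
        \<comment> \<open>The prepended segment is the track of \<open>x\<close> under the blow-up;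
          it stays in \<open>carrier (J - {j})\<close> because \<open>x\<close> does.\<close>
        case True
        then have "\<tau> v 1 t = 0" using \<tau>00[of t 1 v] s1 by simp
        moreover have "x \<in> carrier (J - {j})" using x j k attach_carrier_mono[of "{k}" "J - {j}" X n] by auto
        ultimately show ?thesis
          using GT[of "J - {j}" "min (2 * t) 1" x] \<Theta>t0[OF v, of 1] t s1 by (simp add: \<Psi>_def)
      next
        case False
        then have "min (2 * t) (s2 1) = 1" using s1 by simp
        moreover have "\<tau> v 1 t = (2 * t - 1) * u v"
          using False s1 by (simp add: \<tau>_def field_simps)
        ultimately show ?thesis
          using G1T[OF \<Theta>J[OF v, of 1 "\<tau> v 1 t"]] vV[of "2 * t - 1"] \<tau>01[OF v, of 1 t] False t s1
          by (simp add: \<Psi>_def)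
      qed
    qed
  qed
qed

end

section \<open>Barycentric subdivision of a simplex\<close>

text \<open>
  For a nonnegative function \<open>\<alpha>\<close> on \<open>I\<close>, the weight of \<open>S\<close> in the unique decomposition of
  \<open>\<alpha>\<close> into multiples of indicator functions of a chain of nonempty sets.
\<close>
definition layer :: "'i set \<Rightarrow> ('i \<Rightarrow> real) \<Rightarrow> 'i set \<Rightarrow> real" where
  "layer I \<alpha> S = max 0 (Min (\<alpha> ` S) - Max (insert 0 (\<alpha> ` (I - S))))"

definition set_chain :: "('i set \<Rightarrow> real) \<Rightarrow> bool" where
  "set_chain s \<longleftrightarrow> (\<forall>S T. s S \<noteq> 0 \<longrightarrow> s T \<noteq> 0 \<longrightarrow> S \<subseteq> T \<or> T \<subseteq> S)"

text \<open>Let \<open>c\<close> be the total weight of the sets strictly containing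
  \<open>S\<close>. The minimum of \<open>\<alpha>\<close> on \<open>S\<close> is
  \<open>c + s S\<close>. Outside \<open>S\<close> the maximum is at least \<open>c\<close>, and it
  is exactly \<open>c\<close> if \<open>S\<close> has nonzero weight, since then every set of
  nonzero weight reaching outside \<open>S\<close> contains \<open>S\<close>.\<close>

lemma layer_unique:
  assumes I: "finite I" and S: "S \<subseteq> I" "S \<noteq> {}"
    and s: "\<And>T. 0 \<le> s T" "set_chain s"
    and \<alpha>: "\<And>i. i \<in> I \<Longrightarrow> \<alpha> i = (\<Sum>T\<in>{T\<in>Pow I. i \<in> T}. s T)"
  shows "layer I \<alpha> S = s S"
proof -
  have fin: "finite (Pow I)" "finite S" using I S finite_subset by auto
  define c where "c = (\<Sum>T\<in>{T\<in>Pow I. S \<subset> T}. s T)"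
  have cS: "(\<Sum>T\<in>{T\<in>Pow I. S \<subseteq> T}. s T) = c + s S"
  proof -
    have "{T\<in>Pow I. S \<subseteq> T} = insert S {T\<in>Pow I. S \<subset> T}" using S by auto
    then show ?thesis using fin by (simp add: c_def)
  qed
  have c0: "0 \<le> c" unfolding c_def using s(1) by (intro sum_nonneg) auto
  have min_le: "c + s S \<le> \<alpha> i" if "i \<in> S" for i
  proof -
    have "(\<Sum>T\<in>{T\<in>Pow I. S \<subseteq> T}. s T) \<le> (\<Sum>T\<in>{T\<in>Pow I. i \<in> T}. s T)"
      using that fin s(1) by (intro sum_mono2) auto
    then show ?thesis using cS \<alpha>[of i] that S by auto
  qed
  have min_eq: "\<exists>i\<in>S. \<alpha> i = c + s S"
  proof -
    \<comment> \<open>The largest chain member not containing \<open>S\<close> misses some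
      \<open>i \<in> S\<close>, and then so do all the smaller ones; at this \<open>i\<close> only
      sets containing \<open>S\<close> contribute.\<close>
    define N where "N = {T\<in>Pow I. s T \<noteq> 0 \<and> \<not> S \<subseteq> T}"
    have "\<exists>i\<in>S. \<forall>T\<in>N. i \<notin> T"
    proof (cases "N = {}")
      case False
      then obtain M where M: "M \<in> N" "\<And>T. T \<in> N \<Longrightarrow> M \<subseteq> T \<Longrightarrow> M = T"
        using finite_has_maximal[of N] fin by (auto simp: N_def)
      then have NM: "T \<subseteq> M" if "T \<in> N" for T
        using s(2) that unfolding set_chain_def N_def by blast
      obtain i where "i \<in> S" "i \<notin> M" using M(1) by (auto simp: N_def)
      then show ?thesis using NM by blast
    qed (use S in auto)
    then obtain i where i: "i \<in> S" "\<And>T. T \<in> N \<Longrightarrow> i \<notin> T" by blast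
    have "\<alpha> i = (\<Sum>T\<in>{T\<in>Pow I. i \<in> T}. s T)" using \<alpha> i S by auto
    also have "\<dots> = (\<Sum>T\<in>{T\<in>Pow I. S \<subseteq> T}. s T)"
      using fin i by (intro sum.mono_neutral_right) (auto simp: N_def)
    finally show ?thesis using i cS by auto
  qed
  have Min: "Min (\<alpha> ` S) = c + s S"
  proof (rule Min_eqI)
    show "c + s S \<in> \<alpha> ` S" using min_eq by force
  qed (use min_le fin in auto)
  let ?M = "insert 0 (\<alpha> ` (I - S))"
  have finM: "finite ?M" using I by auto
  have max_ge: "c \<le> Max ?M"
  proof (cases "\<exists>T\<in>Pow I. s T \<noteq> 0 \<and> S \<subset> T")
    case True
    define N where "N = {T\<in>Pow I. s T \<noteq> 0 \<and> S \<subset> T}"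
    have "N \<noteq> {}" "finite N" using True fin by (auto simp: N_def)
    then obtain M where M: "M \<in> N" "\<And>T. T \<in> N \<Longrightarrow> T \<subseteq> M \<Longrightarrow> M = T"
      using finite_has_minimal[of N] by auto
    then have NM: "M \<subseteq> T" if "T \<in> N" for T
      using s(2) that unfolding set_chain_def N_def by blast
    obtain i where i: "i \<in> M" "i \<notin> S" using M(1) by (auto simp: N_def)
    then have iI: "i \<in> I - S" using M(1) by (auto simp: N_def)
    have "c = (\<Sum>T\<in>N. s T)"
      unfolding c_def N_def using fin by (intro sum.mono_neutral_right) auto
    also have "\<dots> \<le> (\<Sum>T\<in>{T\<in>Pow I. i \<in> T}. s T)"
      using fin s(1) i(1) NM by (intro sum_mono2) (auto simp: N_def)
    also have "\<dots> = \<alpha> i" using \<alpha> iI by auto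
    also have "\<dots> \<le> Max ?M" using finM iI by (intro Max_ge) auto
    finally show ?thesis .
  next
    case False
    then have "c = 0" unfolding c_def by (intro sum.neutral) auto
    then show ?thesis using finM by simp
  qed
  have max_le: "Max ?M \<le> c" if "s S \<noteq> 0"
  proof -
    have "\<alpha> i \<le> c" if i: "i \<in> I - S" for i
    proof -
      have "\<alpha> i = (\<Sum>T\<in>{T\<in>Pow I. i \<in> T \<and> s T \<noteq> 0}. s T)"
        using \<alpha> i fin by (auto intro!: sum.mono_neutral_right)
      also have "\<dots> \<le> c"
        unfolding c_def
      proof (intro sum_mono2)
        show "{T\<in>Pow I. i \<in> T \<and> s T \<noteq> 0} \<subseteq> {T\<in>Pow I. S \<subset> T}"
          using s(2) \<open>s S \<noteq> 0\<close> i unfolding set_chain_def by blast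
      qed (use fin s(1) in auto)
      finally show ?thesis .
    qed
    then show ?thesis using finM c0 by (subst Max_le_iff) auto
  qed
  show ?thesis
  proof (cases "s S = 0")
    case True
    then show ?thesis using max_ge by (simp add: layer_def Min)
  next
    case False
    then have "Max ?M = c" using max_le max_ge by simp
    then show ?thesis using s(1)[of S] by (simp add: layer_def Min)
  qed
qed

text \<open>Greedy peeling: the smallest nonzero value is subtracted on the whole support
  \<open>D\<close>. The support shrinks properly, so \<open>D\<close> sits on top of the chain
  obtained for the remainder.\<close>

lemma layer_exists:
  assumes I: "finite I" and \<alpha>: "\<And>i. i \<in> I \<Longrightarrow> 0 \<le> \<alpha> i"
  shows "\<exists>s::'i set \<Rightarrow> real. (\<forall>T. 0 \<le> s T) \<and> set_chain s \<and>
     (\<forall>T. s T \<noteq> 0 \<longrightarrow> T \<noteq> {} \<and> T \<subseteq> {i\<in>I. \<alpha> i \<noteq> 0}) \<and>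
     (\<forall>i\<in>I. \<alpha> i = (\<Sum>T\<in>{T\<in>Pow I. i \<in> T}. s T))"
  using \<alpha>
proof (induction "card {i\<in>I. \<alpha> i \<noteq> 0}" arbitrary: \<alpha> rule: less_induct)
  case less
  define D where "D = {i\<in>I. \<alpha> i \<noteq> 0}"
  have fD: "finite D" "D \<subseteq> I" using I by (auto simp: D_def)
  show ?case
  proof (cases "D = {}")
    case True
    then show ?thesis by (intro exI[of _ "\<lambda>_. 0"]) (auto simp: set_chain_def D_def)
  next
    case False
    define c where "c = Min (\<alpha> ` D)"
    define \<beta> where "\<beta> = (\<lambda>i. if i \<in> D then \<alpha> i - c else 0)"
    have cD: "c \<in> \<alpha> ` D" unfolding c_def using False fD by (intro Min_in) auto
    then obtain d where d: "d \<in> D" "\<alpha> d = c" by auto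
    have c: "c > 0" using d less.prems[of d] by (auto simp: D_def less_le)
    have cle: "c \<le> \<alpha> i" if "i \<in> D" for i using that fD by (simp add: c_def)
    have sub: "{i\<in>I. \<beta> i \<noteq> 0} \<subset> D" using d by (auto simp: \<beta>_def)
    then have "card {i\<in>I. \<beta> i \<noteq> 0} < card {i\<in>I. \<alpha> i \<noteq> 0}"
      using psubset_card_mono[OF fD(1)] by (simp add: D_def)
    moreover have "0 \<le> \<beta> i" for i using cle by (simp add: \<beta>_def)
    ultimately obtain s where s: "\<And>T. 0 \<le> s T" "set_chain s"
      "\<And>T. s T \<noteq> 0 \<Longrightarrow> T \<noteq> {} \<and> T \<subseteq> {i\<in>I. \<beta> i \<noteq> 0}"
      "\<And>i. i \<in> I \<Longrightarrow> \<beta> i = (\<Sum>T\<in>{T\<in>Pow I. i \<in> T}. s T)"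
      using less.hyps[of \<beta>] by blast
    have sD: "s D = 0" using s(3)[of D] sub by blast
    define s' where "s' = s(D := c)"
    have "\<alpha> i = (\<Sum>T\<in>{T\<in>Pow I. i \<in> T}. s' T)" if i: "i \<in> I" for i
    proof -
      have "(\<Sum>T\<in>{T\<in>Pow I. i \<in> T}. s' T) = (\<Sum>T\<in>{T\<in>Pow I. i \<in> T}. s T + (if T = D then c else 0))"
        by (rule sum.cong) (auto simp: s'_def sD)
      also have "\<dots> = \<beta> i + (if i \<in> D then c else 0)"
        using s(4)[OF i] fD I by (simp add: sum.distrib)
      also have "\<dots> = \<alpha> i" using i by (auto simp: \<beta>_def D_def)
      finally show ?thesis by simp
    qed
    moreover have "set_chain s'"
      using s(2,3) sub unfolding set_chain_def s'_def by (auto split: if_splits)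
    moreover have "\<forall>T. 0 \<le> s' T" using s(1) c by (simp add: s'_def)
    moreover have "\<forall>T. s' T \<noteq> 0 \<longrightarrow> T \<noteq> {} \<and> T \<subseteq> {i\<in>I. \<alpha> i \<noteq> 0}"
      using s(3) sub False unfolding s'_def D_def by auto
    ultimately show ?thesis by blast
  qed
qed

text \<open>By uniqueness the layers are the weights of the chain decomposition, from which
  everything is read off; the sum formula is a double count of pairs
  \<open>i \<in> S\<close>.\<close>

lemma layer_properties:
  assumes I: "finite I" and \<alpha>: "\<And>i. i \<in> I \<Longrightarrow> 0 \<le> \<alpha> i"
  shows "\<And>S T. S \<subseteq> I \<Longrightarrow> S \<noteq> {} \<Longrightarrow> T \<subseteq> I \<Longrightarrow> T \<noteq> {} \<Longrightarrow>
      layer I \<alpha> S \<noteq> 0 \<Longrightarrow> layer I \<alpha> T \<noteq> 0 \<Longrightarrow> S \<subseteq> T \<or> T \<subseteq> S"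
    and "\<And>S. S \<subseteq> I \<Longrightarrow> S \<noteq> {} \<Longrightarrow> layer I \<alpha> S \<noteq> 0 \<Longrightarrow> S \<subseteq> {i\<in>I. \<alpha> i \<noteq> 0}"
    and "(\<Sum>S\<in>Pow I - {{}}. card S * layer I \<alpha> S) = (\<Sum>i\<in>I. \<alpha> i)"
proof -
  obtain s where s: "\<And>T. 0 \<le> s T" "set_chain s"
      "\<And>T. s T \<noteq> 0 \<Longrightarrow> T \<noteq> {} \<and> T \<subseteq> {i\<in>I. \<alpha> i \<noteq> 0}"
      "\<And>i. i \<in> I \<Longrightarrow> \<alpha> i = (\<Sum>T\<in>{T\<in>Pow I. i \<in> T}. s T)"
    using layer_exists[OF I, of \<alpha>] \<alpha> by blast
  have eq: "layer I \<alpha> S = s S" if "S \<subseteq> I" "S \<noteq> {}" for S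
    using layer_unique[OF I that s(1,2,4)] .
  show "\<And>S T. S \<subseteq> I \<Longrightarrow> S \<noteq> {} \<Longrightarrow> T \<subseteq> I \<Longrightarrow> T \<noteq> {} \<Longrightarrow>
      layer I \<alpha> S \<noteq> 0 \<Longrightarrow> layer I \<alpha> T \<noteq> 0 \<Longrightarrow> S \<subseteq> T \<or> T \<subseteq> S"
    using eq s(2) unfolding set_chain_def by metis
  show "\<And>S. S \<subseteq> I \<Longrightarrow> S \<noteq> {} \<Longrightarrow> layer I \<alpha> S \<noteq> 0 \<Longrightarrow> S \<subseteq> {i\<in>I. \<alpha> i \<noteq> 0}"
    using eq s(3) by metis
  have "(\<Sum>i\<in>I. \<alpha> i) = (\<Sum>i\<in>I. \<Sum>T\<in>{T\<in>Pow I. i \<in> T}. s T)"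
    using s(4) by simp
  also have "\<dots> = (\<Sum>T\<in>Pow I. \<Sum>i\<in>{i\<in>I. i \<in> T}. s T)"
    using I by (intro sum.swap_restrict) auto
  also have "\<dots> = (\<Sum>T\<in>Pow I. card T * s T)"
    by (intro sum.cong) (auto simp: Int_absorb1 Collect_conj_eq)
  also have "\<dots> = (\<Sum>T\<in>Pow I - {{}}. card T * s T)"
    using I by (intro sum.mono_neutral_right) auto
  also have "\<dots> = (\<Sum>T\<in>Pow I - {{}}. card T * layer I \<alpha> T)"
    using eq by (intro sum.cong) auto
  finally show "(\<Sum>S\<in>Pow I - {{}}. card S * layer I \<alpha> S) = (\<Sum>i\<in>I. \<alpha> i)" by simp
qed

section \<open>Continuity of the layers\<close>

lemma continuous_map_Min:
  assumes "finite S" "S \<noteq> {}" "\<And>i. i \<in> S \<Longrightarrow> continuous_map X euclideanreal (\<lambda>x. f x i)"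
  shows "continuous_map X euclideanreal (\<lambda>x. Min (f x ` S))"
  using assms by (induction S rule: finite_ne_induct) (auto intro!: continuous_map_real_min)

lemma continuous_map_Max:
  assumes "finite S" "\<And>i. i \<in> S \<Longrightarrow> continuous_map X euclideanreal (\<lambda>x. f x i)"
  shows "continuous_map X euclideanreal (\<lambda>x. Max (insert 0 (f x ` S)))"
  using assms
proof (induction S rule: finite_induct)
  case (insert i S)
  have "Max (insert 0 (f x ` insert i S)) = max (f x i) (Max (insert 0 (f x ` S)))" for x
    using insert(1) by (simp add: insert_commute[of 0 "f x i"] Max_insert)
  then show ?case using insert by (auto intro!: continuous_map_real_max)
qed simp

text \<open>This is the purpose of the closed formula for \<open>layer\<close>; from the recursive
  peeling, whose supports jump, continuity is not visible.\<close>

lemma continuous_map_layer: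
  assumes "finite I" "S \<subseteq> I" "S \<noteq> {}" "\<And>i. i \<in> I \<Longrightarrow> continuous_map X euclideanreal (\<lambda>x. f x i)"
  shows "continuous_map X euclideanreal (\<lambda>x. layer I (f x) S)"
  unfolding layer_def using assms finite_subset[OF assms(2,1)]
  by (intro continuous_map_real_max continuous_map_diff continuous_map_Min continuous_map_Max) auto

section \<open>Homotopy colimits of cubes of closed subspaces\<close>

lemma sum_one_obtains_nonzero:
  assumes "(\<Sum>i\<in>I. \<alpha> i) = (1::real)"
  obtains i where "i \<in> I" "\<alpha> i \<noteq> 0"
proof -
  have "\<exists>i\<in>I. \<alpha> i \<noteq> 0"
  proof (rule ccontr)
    assume "\<not> ?thesis"
    then have "(\<Sum>i\<in>I. \<alpha> i) = 0" by (intro sum.neutral) auto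
    then show False using assms by simp
  qed
  then show ?thesis using that by blast
qed

text \<open>Intersections make the class of \<open>(T, y, t)\<close> in the homotopy colimit
  independent of \<open>T\<close>; closedness allows maps out of the simplicial model to be
  pasted.\<close>

locale closed_cube =
  fixes I :: "'i set" and X :: "'i set \<Rightarrow> 'b topology"
  assumes finite_I: "finite I"
    and X_eq: "T \<subseteq> I \<Longrightarrow> X T = subtopology (X I) (topspace (X T))"
    and closed: "T \<subseteq> I \<Longrightarrow> closedin (X I) (topspace (X T))"
    and mono: "S \<subseteq> T \<Longrightarrow> T \<subseteq> I \<Longrightarrow> topspace (X S) \<subseteq> topspace (X T)"
    and inter: "S \<subseteq> I \<Longrightarrow> T \<subseteq> I \<Longrightarrow> topspace (X S) \<inter> topspace (X T) \<subseteq> topspace (X (S \<inter> T))"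
begin

abbreviation P :: "'i set set" where "P \<equiv> {T. T \<subset> I}"
abbreviation A :: "'i set \<Rightarrow> 'b set" where "A T \<equiv> topspace (X T)"
abbreviation H where "H \<equiv> hocolim P X (\<lambda>S T. id)"
abbreviation N where "N T \<equiv> nerve (above P T)"

definition cls :: "'i set \<times> 'b \<times> ('i set \<Rightarrow> real) \<Rightarrow> ('i set \<times> 'b \<times> ('i set \<Rightarrow> real)) set" where
  "cls z = {w. equivclp (hocolim_rel P X (\<lambda>S T. id)) z w}"

text \<open>
  A model of the homotopy colimit in which the nerve of the poset of proper subsets is replaced by
  the simplex on \<open>I\<close>, whose barycentric subdivision it is: \<open>S\<close> corresponds to the barycentre of
  the face \<open>I - S\<close>.
\<close>
definition model :: "('b \<times> ('i \<Rightarrow> real)) topology" where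
  "model = subtopology (prod_topology (X I) (powertop_real UNIV))
     {(y, \<alpha>). (\<forall>i. 0 \<le> \<alpha> i) \<and> (\<forall>i. i \<notin> I \<longrightarrow> \<alpha> i = 0) \<and> (\<Sum>i\<in>I. \<alpha> i) = 1 \<and>
        (\<forall>i. \<alpha> i \<noteq> 0 \<longrightarrow> y \<in> A (I - {i}))}"

text \<open>The affine extension of sending \<open>S\<close> to the barycentre of
  \<open>I - S\<close>: its weight is spread evenly over that face.\<close>

definition bary :: "('i set \<Rightarrow> real) \<Rightarrow> 'i \<Rightarrow> real" where
  "bary t i = (if i \<in> I then \<Sum>S\<in>{S\<in>P. i \<notin> S}. t S / card (I - S) else 0)"

text \<open>The inverse of \<open>bary\<close>. A layer of height \<open>h\<close> on a face is the
  barycentre of the face with weight \<open>h\<close> times the number of its vertices.\<close>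

definition subdiv :: "('i \<Rightarrow> real) \<Rightarrow> 'i set \<Rightarrow> real" where
  "subdiv \<alpha> S = (if S \<subset> I then card (I - S) * layer I \<alpha> (I - S) else 0)"

lemma finite_P: "finite P"
  using finite_I by (intro finite_subset[of P "Pow I"]) auto

lemma X_mono: "T \<subseteq> I \<Longrightarrow> A T \<subseteq> A I"
  using mono[of T I] by simp

lemma topspace_nerve:
  "topspace (nerve Q) = {t. (\<forall>S. 0 \<le> t S) \<and> subset.chain Q {S. t S \<noteq> 0} \<and> (\<Sum>S\<in>Q. t S) = 1}"
  by (simp add: nerve_def)

lemma nerve_above_iff:
  "t \<in> topspace (N T) \<longleftrightarrow> (\<forall>S. 0 \<le> t S) \<and> set_chain t \<and> (\<forall>S. t S \<noteq> 0 \<longrightarrow> S \<in> P \<and> T \<subseteq> S) \<and> (\<Sum>S\<in>P. t S) = 1"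
proof -
  have "(\<Sum>S\<in>above P T. t S) = (\<Sum>S\<in>P. t S)" if "\<forall>S. t S \<noteq> 0 \<longrightarrow> S \<in> P \<and> T \<subseteq> S"
    using that finite_P by (intro sum.mono_neutral_left) auto
  moreover have "subset.chain (above P T) {S. t S \<noteq> 0} \<longleftrightarrow> set_chain t \<and> (\<forall>S. t S \<noteq> 0 \<longrightarrow> S \<in> P \<and> T \<subseteq> S)"
    by (auto simp: subset_chain_def set_chain_def)
  ultimately show ?thesis by (auto simp: topspace_nerve)
qed

lemma cls_refl: "z \<in> cls z"
  by (simp add: cls_def)

text \<open>All structure maps being \<open>id\<close>, one step of the relation changes only the
  index \<open>T\<close>; hence functions of \<open>(y, t)\<close> descend to classes.\<close>

lemma cls_snd: "w \<in> cls z \<Longrightarrow> snd w = snd z"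
proof -
  assume "w \<in> cls z"
  then have "equivclp (hocolim_rel P X (\<lambda>S T. id)) z w" by (simp add: cls_def)
  then show ?thesis
    by (induction rule: equivclp_induct) (auto simp: hocolim_rel_def)
qed

lemma the_elem_cls: "the_elem ((\<lambda>z. g (snd z)) ` cls z) = g (snd z)"
proof -
  have "(\<lambda>w. g (snd w)) ` cls z = (\<lambda>w. g (snd z)) ` cls z"
    by (intro image_cong refl arg_cong[of _ _ g] cls_snd)
  also have "\<dots> = {g (snd z)}"
    using cls_refl by (rule image_constant)
  finally have "(\<lambda>w. g (snd w)) ` cls z = {g (snd z)}" .
  then show ?thesis by simp
qed

lemma cls_eqI: "equivclp (hocolim_rel P X (\<lambda>S T. id)) z w \<Longrightarrow> cls z = cls w"
  unfolding cls_def by (blast intro: equivclp_trans equivclp_sym)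

text \<open>Both triples are images of the one over \<open>T \<inter> T'\<close>, where
  \<open>y\<close> also lives.\<close>

lemma cls_eq:
  assumes "T \<in> P" "T' \<in> P" "y \<in> A T" "y \<in> A T'" "t \<in> topspace (N T)" "t \<in> topspace (N T')"
  shows "cls (T, y, t) = cls (T', y, t)"
proof -
  have "T \<inter> T' \<in> P" "y \<in> A (T \<inter> T')" using assms inter[of T T'] by auto
  then have "hocolim_rel P X (\<lambda>S T. id) (T \<inter> T', y, t) (T, y, t)"
    "hocolim_rel P X (\<lambda>S T. id) (T \<inter> T', y, t) (T', y, t)"
    using assms unfolding hocolim_rel_def by auto
  then have "cls (T \<inter> T', y, t) = cls (T, y, t)" "cls (T \<inter> T', y, t) = cls (T', y, t)"
    using cls_eqI r_into_equivclp by metis+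
  then show ?thesis by simp
qed

lemma quotient_map_cls:
  "quotient_map (sum_topology (\<lambda>T. prod_topology (X T) (N T)) P) H cls"
  unfolding hocolim_def cls_def[abs_def] by (rule quotient_map_quotient_topology)

lemma continuous_map_from_hocolim:
  assumes "\<And>T. T \<in> P \<Longrightarrow> continuous_map (prod_topology (X T) (N T)) Y (\<lambda>p. g (cls (T, p)))"
  shows "continuous_map H Y g"
proof (rule continuous_compose_quotient_map[OF quotient_map_cls])
  show "continuous_map (sum_topology (\<lambda>T. prod_topology (X T) (N T)) P) Y (g \<circ> cls)"
    unfolding continuous_map_def
  proof (intro conjI allI impI)
    show "g \<circ> cls \<in> topspace (sum_topology (\<lambda>T. prod_topology (X T) (N T)) P) \<rightarrow> topspace Y"
      using continuous_map_image_subset_topspace[OF assms] by (fastforce simp: image_subset_iff)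
    fix U assume U: "openin Y U"
    have "{p. (T, p) \<in> {z \<in> topspace (sum_topology (\<lambda>T. prod_topology (X T) (N T)) P). (g \<circ> cls) z \<in> U}}
       = {p \<in> topspace (prod_topology (X T) (N T)). g (cls (T, p)) \<in> U}" if "T \<in> P" for T
      using that by auto
    then show "openin (sum_topology (\<lambda>T. prod_topology (X T) (N T)) P)
       {z \<in> topspace (sum_topology (\<lambda>T. prod_topology (X T) (N T)) P). (g \<circ> cls) z \<in> U}"
      unfolding openin_sum_topology using openin_continuous_map_preimage[OF assms U] by auto
  qed
qed

lemma continuous_map_cls:
  assumes "T \<in> P"
  shows "continuous_map (prod_topology (X T) (N T)) H (\<lambda>p. cls (T, p))"
proof -
  have "continuous_map (prod_topology (X T) (N T)) (sum_topology (\<lambda>T. prod_topology (X T) (N T)) P) (\<lambda>p. (T, p))"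
    using assms by (rule continuous_map_component_injection)
  from continuous_map_compose[OF this quotient_imp_continuous_map[OF quotient_map_cls]] show ?thesis
    by (simp add: o_def)
qed

lemma topspace_hocolim: "topspace H = cls ` (SIGMA T:P. A T \<times> topspace (N T))"
  using quotient_imp_surjective_map[OF quotient_map_cls]
  by (simp only: topspace_sum_topology o_def topspace_prod_topology)

lemma hocolim_map_cls: "hocolim_map (\<lambda>S T. id) V (cls (T, y, t)) = y"
proof -
  have "hocolim_map (\<lambda>S T. id) V (cls (T, y, t)) = the_elem ((\<lambda>z. fst (snd z)) ` cls (T, y, t))"
    unfolding hocolim_map_def by (rule arg_cong[of _ _ the_elem]) (auto simp: case_prod_unfold)
  then show ?thesis using the_elem_cls[of fst "(T, y, t)"] by simp
qed

lemma continuous_map_hocolim_map: "continuous_map H (X I) (hocolim_map (\<lambda>S T. id) V)"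
proof (rule continuous_map_from_hocolim)
  fix T assume "T \<in> P"
  then have "continuous_map (X T) (X I) id"
    using X_eq[of T] continuous_map_from_subtopology[OF continuous_map_id] by (metis mem_Collect_eq psubsetE)
  then have "continuous_map (prod_topology (X T) (N T)) (X I) (id \<circ> fst)"
    by (rule continuous_map_compose[OF continuous_map_fst])
  then show "continuous_map (prod_topology (X T) (N T)) (X I) (\<lambda>p. hocolim_map (\<lambda>S T. id) V (cls (T, p)))"
    by (rule continuous_map_eq) (auto simp: hocolim_map_cls)
qed

lemma sum_complements: "(\<Sum>S\<in>P. f (I - S)) = (\<Sum>S\<in>Pow I - {{}}. f S)"
  by (rule sum.reindex_bij_witness[of _ "\<lambda>S. I - S" "\<lambda>S. I - S"]) (auto simp: double_diff)

lemma bary_nonneg: "(\<And>S. 0 \<le> t S) \<Longrightarrow> 0 \<le> bary t i"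
  by (auto simp: bary_def intro!: sum_nonneg divide_nonneg_nonneg)

lemma sum_bary:
  assumes "(\<Sum>S\<in>P. t S) = 1"
  shows "(\<Sum>i\<in>I. bary t i) = 1"
proof -
  have "(\<Sum>i\<in>I. bary t i) = (\<Sum>i\<in>I. \<Sum>S\<in>{S\<in>P. i \<notin> S}. t S / card (I - S))"
    by (simp add: bary_def)
  also have "\<dots> = (\<Sum>S\<in>P. \<Sum>i\<in>{i\<in>I. i \<notin> S}. t S / card (I - S))"
    using finite_I finite_P by (rule sum.swap_restrict)
  also have "\<dots> = (\<Sum>S\<in>P. t S)"
  proof (rule sum.cong)
    fix S assume "S \<in> P"
    then have "card (I - S) \<noteq> 0" using finite_I by auto
    moreover have "{i\<in>I. i \<notin> S} = I - S" by auto
    ultimately show "(\<Sum>i\<in>{i\<in>I. i \<notin> S}. t S / card (I - S)) = t S" by simp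
  qed simp
  finally show ?thesis using assms by simp
qed

lemma bary_in_model:
  assumes "T \<in> P" "y \<in> A T" "t \<in> topspace (N T)"
  shows "(y, bary t) \<in> topspace model"
proof -
  have t: "\<And>S. 0 \<le> t S" "\<And>S. t S \<noteq> 0 \<Longrightarrow> S \<in> P \<and> T \<subseteq> S" "(\<Sum>S\<in>P. t S) = 1"
    using nerve_above_iff[THEN iffD1, OF assms(3)] by auto
  have "y \<in> A (I - {i})" if "bary t i \<noteq> 0" for i
  proof -
    have "i \<in> I" "(\<Sum>S\<in>{S\<in>P. i \<notin> S}. t S / card (I - S)) \<noteq> 0"
      using that by (auto simp: bary_def split: if_splits)
    then obtain S where "S \<in> P" "i \<notin> S" "t S \<noteq> 0"
      using sum.neutral[of "{S\<in>P. i \<notin> S}" "\<lambda>S. t S / card (I - S)"] by auto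
    then have "T \<subseteq> I - {i}" using t(2)[of S] by auto
    then show ?thesis using mono[of T "I - {i}"] assms(2) by auto
  qed
  moreover have "y \<in> A I" using X_mono[of T] assms by auto
  moreover have "\<forall>i. 0 \<le> bary t i" "(\<Sum>i\<in>I. bary t i) = 1"
    using bary_nonneg t(1) sum_bary[OF t(3)] by auto
  moreover have "bary t i = 0" if "i \<notin> I" for i using that by (simp add: bary_def)
  ultimately show ?thesis by (simp add: model_def)
qed

text \<open>The numbers \<open>t (I - J) / card J\<close> already are a chain decomposition of
  \<open>bary t\<close>, so they are its layers by uniqueness.\<close>

lemma subdiv_bary:
  assumes "t \<in> topspace (N T)"
  shows "subdiv (bary t) = t"
proof -
  have t: "\<And>S. 0 \<le> t S" "\<And>S. t S \<noteq> 0 \<Longrightarrow> S \<in> P \<and> T \<subseteq> S" "set_chain t"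
    using nerve_above_iff[THEN iffD1, OF assms] by auto
  define s where "s = (\<lambda>J. if J \<subseteq> I \<and> J \<noteq> {} then t (I - J) / card J else 0)"
  have sI: "layer I (bary t) J = s J" if J: "J \<subseteq> I" "J \<noteq> {}" for J
  proof (rule layer_unique[OF finite_I J])
    show "0 \<le> s T" for T using t(1) by (simp add: s_def)
    show "set_chain s"
      unfolding set_chain_def
    proof (intro allI impI)
      fix J K assume "s J \<noteq> 0" "s K \<noteq> 0"
      then have JK: "J \<subseteq> I" "K \<subseteq> I" "t (I - J) \<noteq> 0" "t (I - K) \<noteq> 0" by (auto simp: s_def split: if_splits)
      then have "I - J \<subseteq> I - K \<or> I - K \<subseteq> I - J" using t(3) unfolding set_chain_def by blast
      then show "J \<subseteq> K \<or> K \<subseteq> J" using JK by auto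
    qed
    fix i assume i: "i \<in> I"
    have "bary t i = (\<Sum>S\<in>{S\<in>P. i \<notin> S}. t S / card (I - S))" using i by (simp add: bary_def)
    also have "\<dots> = (\<Sum>J\<in>{J\<in>Pow I. i \<in> J}. s J)"
    proof (rule sum.reindex_bij_witness[of _ "\<lambda>S. I - S" "\<lambda>S. I - S"])
      fix S assume "S \<in> {S\<in>P. i \<notin> S}"
      then show "I - (I - S) = S" "I - S \<in> {J\<in>Pow I. i \<in> J}" "s (I - S) = t S / card (I - S)"
        using i by (auto simp: s_def double_diff)
    qed (use i in \<open>auto simp: double_diff\<close>)
    finally show "bary t i = (\<Sum>J\<in>{J\<in>Pow I. i \<in> J}. s J)" .
  qed
  show ?thesis
  proof
    fix S
    show "subdiv (bary t) S = t S"
    proof (cases "S \<subset> I")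
      case True
      then have "card (I - S) \<noteq> 0" "I - S \<subseteq> I" "I - S \<noteq> {}" "I - (I - S) = S"
        using finite_I by auto
      then show ?thesis using True sI[of "I - S"] by (simp add: subdiv_def s_def)
    next
      case False
      then show ?thesis using t(2)[of S] by (auto simp: subdiv_def)
    qed
  qed
qed

text \<open>A nonzero layer lies inside the support of \<open>\<alpha>\<close>; its complement
  therefore contains \<open>T\<close>, on which \<open>\<alpha>\<close> vanishes.\<close>

lemma subdiv_in_nerve:
  assumes \<alpha>: "\<And>i. i \<in> I \<Longrightarrow> 0 \<le> \<alpha> i" "(\<Sum>i\<in>I. \<alpha> i) = 1" and T: "\<And>i. i \<in> T \<Longrightarrow> \<alpha> i = 0" "T \<subseteq> I"
  shows "subdiv \<alpha> \<in> topspace (N T)"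
  unfolding nerve_above_iff
proof (intro conjI allI impI)
  note L = layer_properties[where I = I and \<alpha> = \<alpha>, OF finite_I \<alpha>(1)]
  show "0 \<le> subdiv \<alpha> S" for S by (simp add: subdiv_def layer_def)
  show "set_chain (subdiv \<alpha>)"
    unfolding set_chain_def
  proof (intro allI impI)
    fix S S' assume "subdiv \<alpha> S \<noteq> 0" "subdiv \<alpha> S' \<noteq> 0"
    then have S: "S \<subset> I" "S' \<subset> I" "layer I \<alpha> (I - S) \<noteq> 0" "layer I \<alpha> (I - S') \<noteq> 0"
      by (auto simp: subdiv_def split: if_splits)
    then have "I - S \<subseteq> I - S' \<or> I - S' \<subseteq> I - S" by (intro L(1)) auto
    then show "S \<subseteq> S' \<or> S' \<subseteq> S" using S by auto
  qed
  fix S assume "subdiv \<alpha> S \<noteq> 0"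
  then have S: "S \<subset> I" "layer I \<alpha> (I - S) \<noteq> 0" by (auto simp: subdiv_def split: if_splits)
  show "S \<in> P" using S by simp
  have "I - S \<subseteq> {i\<in>I. \<alpha> i \<noteq> 0}" using S by (intro L(2)) auto
  then show "T \<subseteq> S" using T by auto
next
  have "(\<Sum>S\<in>P. subdiv \<alpha> S) = (\<Sum>S\<in>P. card (I - S) * layer I \<alpha> (I - S))"
    by (intro sum.cong) (auto simp: subdiv_def)
  also have "\<dots> = 1"
    using sum_complements[of "\<lambda>S. card S * layer I \<alpha> S"]
      layer_properties(3)[OF finite_I, of \<alpha>] \<alpha> by simp
  finally show "(\<Sum>S\<in>P. subdiv \<alpha> S) = 1" .
qed

lemma A_Inter:
  assumes "finite D" "D \<noteq> {}" "D \<subseteq> I" "\<And>i. i \<in> D \<Longrightarrow> y \<in> A (I - {i})"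
  shows "y \<in> A (I - D)"
  using assms
proof (induction D rule: finite_ne_induct)
  case (insert i D)
  then have "y \<in> A ((I - {i}) \<inter> (I - D))" using inter[of "I - {i}" "I - D"] by auto
  moreover have "(I - {i}) \<inter> (I - D) = I - insert i D" by auto
  ultimately show ?case by simp
qed auto

text \<open>\<open>\<sigma>\<close> records \<open>y\<close> and the barycentric coordinates;
  \<open>\<rho>\<close> places \<open>y\<close> at the index where all weights vanish, which is
  legitimate because \<open>y\<close> lies in the intersection of the members with nonzero weight.
  The identity in one direction suffices to transport lifting problems.\<close>

lemma hocolim_retract_of_model:
  obtains \<sigma> :: "('i set \<times> 'b \<times> ('i set \<Rightarrow> real)) set \<Rightarrow> 'b \<times> ('i \<Rightarrow> real)" and \<rho> where
    "continuous_map H model \<sigma>" "continuous_map model H \<rho>"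
    "\<And>c. c \<in> topspace H \<Longrightarrow> \<rho> (\<sigma> c) = c"
    "\<And>c. c \<in> topspace H \<Longrightarrow> fst (\<sigma> c) = hocolim_map (\<lambda>S T. id) V c"
    "\<And>p. p \<in> topspace model \<Longrightarrow> hocolim_map (\<lambda>S T. id) V (\<rho> p) = fst p"
proof -
  define \<sigma> :: "('i set \<times> 'b \<times> ('i set \<Rightarrow> real)) set \<Rightarrow> 'b \<times> ('i \<Rightarrow> real)"
    where "\<sigma> = (\<lambda>c. the_elem ((\<lambda>z. (fst (snd z), bary (snd (snd z)))) ` c))"
  have \<sigma>: "\<sigma> (cls (T, y, t)) = (y, bary t)" for T y t
    using the_elem_cls[of "\<lambda>p. (fst p, bary (snd p))" "(T, y, t)"] by (simp add: \<sigma>_def)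
  define Z where "Z = (\<lambda>\<alpha>::'i \<Rightarrow> real. {i\<in>I. \<alpha> i = 0})"
  define \<rho> where "\<rho> = (\<lambda>(y, \<alpha>). cls (Z \<alpha>, y, subdiv \<alpha>))"
  have model: "y \<in> A I" "\<And>i. 0 \<le> \<alpha> i" "\<And>i. i \<notin> I \<Longrightarrow> \<alpha> i = 0" "(\<Sum>i\<in>I. \<alpha> i) = 1"
    "\<And>i. \<alpha> i \<noteq> 0 \<Longrightarrow> y \<in> A (I - {i})"
    if "(y, \<alpha>) \<in> topspace model" for y \<alpha>
    using that by (auto simp: model_def)
  have Z: "Z \<alpha> \<in> P" "y \<in> A (Z \<alpha>)" if p: "(y, \<alpha>) \<in> topspace model" for y \<alpha>
  proof -
    obtain i where i: "i \<in> I" "\<alpha> i \<noteq> 0" by (rule sum_one_obtains_nonzero[OF model(4)[OF p]])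
    then show "Z \<alpha> \<in> P" by (auto simp: Z_def)
    have "y \<in> A (I - {i\<in>I. \<alpha> i \<noteq> 0})"
      by (rule A_Inter) (use finite_I i model(5)[OF p] in auto)
    moreover have "I - {i\<in>I. \<alpha> i \<noteq> 0} = Z \<alpha>" by (auto simp: Z_def)
    ultimately show "y \<in> A (Z \<alpha>)" by simp
  qed
  have N: "subdiv \<alpha> \<in> topspace (N T)" if "(y, \<alpha>) \<in> topspace model" "T \<in> P" "\<forall>i\<in>T. \<alpha> i = 0" for y \<alpha> T
    using that model[OF that(1)] by (intro subdiv_in_nerve) auto
  have NZ: "subdiv \<alpha> \<in> topspace (N (Z \<alpha>))" if "(y, \<alpha>) \<in> topspace model" for y \<alpha>
    by (rule N[OF that Z(1)[OF that]]) (simp add: Z_def)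
  have \<sigma>cont: "continuous_map H model \<sigma>"
  proof (rule continuous_map_from_hocolim)
    fix T assume T: "T \<in> P"
    have "continuous_map (X T) (X I) id"
      using X_eq[of T] continuous_map_from_subtopology[OF continuous_map_id] T by (metis mem_Collect_eq psubsetE)
    then have "continuous_map (prod_topology (X T) (N T)) (X I) (id \<circ> fst)"
      by (rule continuous_map_compose[OF continuous_map_fst])
    then have 1: "continuous_map (prod_topology (X T) (N T)) (X I) (\<lambda>p. fst p)"
      by (simp add: o_def)
    have coord: "continuous_map (prod_topology (X T) (N T)) euclideanreal (\<lambda>p. snd p S)" for S
    proof -
      have "continuous_map (N T) euclideanreal (\<lambda>t. t S)"
        unfolding nerve_def by (intro continuous_map_from_subtopology continuous_map_product_projection) simp
      then have "continuous_map (prod_topology (X T) (N T)) euclideanreal ((\<lambda>t. t S) \<circ> snd)"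
        by (rule continuous_map_compose[OF continuous_map_snd])
      then show ?thesis by (simp add: o_def)
    qed
    have 2: "continuous_map (prod_topology (X T) (N T)) (powertop_real UNIV) (\<lambda>p. bary (snd p))"
      unfolding continuous_map_componentwise_UNIV
    proof
      fix i
      show "continuous_map (prod_topology (X T) (N T)) euclideanreal (\<lambda>p. bary (snd p) i)"
      proof (cases "i \<in> I")
        case True
        have "continuous_map (prod_topology (X T) (N T)) euclideanreal
            (\<lambda>p. \<Sum>S\<in>{S\<in>P. i \<notin> S}. snd p S * inverse (card (I - S)))"
          by (intro continuous_map_sum continuous_map_real_mult coord) (use finite_P in auto)
        then show ?thesis by (simp add: bary_def divide_inverse True)
      qed (simp add: bary_def)
    qed
    have "continuous_map (prod_topology (X T) (N T)) model (\<lambda>p. (fst p, bary (snd p)))"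
      unfolding model_def
    proof (intro continuous_map_into_subtopology continuous_map_pairedI 1 2)
      show "(\<lambda>p. (fst p, bary (snd p))) \<in> topspace (prod_topology (X T) (N T)) \<rightarrow>
        {(y, \<alpha>). (\<forall>i. 0 \<le> \<alpha> i) \<and> (\<forall>i. i \<notin> I \<longrightarrow> \<alpha> i = 0) \<and> (\<Sum>i\<in>I. \<alpha> i) = 1 \<and>
          (\<forall>i. \<alpha> i \<noteq> 0 \<longrightarrow> y \<in> A (I - {i}))}"
      proof (rule funcsetI)
        fix p assume "p \<in> topspace (prod_topology (X T) (N T))"
        then have "(fst p, bary (snd p)) \<in> topspace model"
          by (intro bary_in_model[OF T]) auto
        then show "(fst p, bary (snd p)) \<in>
          {(y, \<alpha>). (\<forall>i. 0 \<le> \<alpha> i) \<and> (\<forall>i. i \<notin> I \<longrightarrow> \<alpha> i = 0) \<and> (\<Sum>i\<in>I. \<alpha> i) = 1 \<and>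
            (\<forall>i. \<alpha> i \<noteq> 0 \<longrightarrow> y \<in> A (I - {i}))}"
          by (simp add: model_def)
      qed
    qed
    then show "continuous_map (prod_topology (X T) (N T)) model (\<lambda>p. \<sigma> (cls (T, p)))"
      by (rule continuous_map_eq) (auto simp: \<sigma>)
  qed
  have \<rho>cont: "continuous_map model H \<rho>"
  \<comment> \<open>The index used by \<open>\<rho>\<close> jumps, so \<open>\<rho>\<close> is
    pasted from finitely many closed sets, on each of which one fixed index \<open>T\<close> is
    admissible; \<open>cls_eq\<close> gives agreement on overlaps.\<close>
  proof (rule pasting_lemma_closed[OF finite_P])
    let ?E = "\<lambda>T. {p \<in> topspace model. fst p \<in> A T} \<inter> (\<Inter>i\<in>T. {p \<in> topspace model. snd p i \<in> {0}})"
    let ?E' = "\<lambda>T. {p \<in> topspace model. fst p \<in> A T \<and> (\<forall>i\<in>T. snd p i = 0)}"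
    have fst: "continuous_map model (X I) fst"
      unfolding model_def by (intro continuous_map_from_subtopology continuous_map_fst)
    have snd: "continuous_map model euclideanreal (\<lambda>p. snd p i)" for i
    proof -
      have "continuous_map model (powertop_real UNIV) snd"
        unfolding model_def by (intro continuous_map_from_subtopology continuous_map_snd)
      then show ?thesis unfolding continuous_map_componentwise_UNIV by blast
    qed
    fix T assume T: "T \<in> P"
    have EE: "?E' T = ?E T" by auto
    have "closedin model {p \<in> topspace model. fst p \<in> A T}"
      using T by (intro closedin_continuous_map_preimage[OF fst] closed) auto
    moreover have "closedin model {p \<in> topspace model. snd p i \<in> {0}}" for i
      by (intro closedin_continuous_map_preimage[OF snd]) simp
    ultimately show "closedin model (?E' T)"
      unfolding EE by (cases "T = {}") (auto intro!: closedin_Int closedin_INT)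
    show "continuous_map (subtopology model (?E' T)) H ((\<lambda>T p. cls (T, fst p, subdiv (snd p))) T)"
    proof -
      have 1: "continuous_map (subtopology model (?E' T)) (X T) fst"
      proof -
        have "X T = subtopology (X I) (A T)" using X_eq T by blast
        moreover have "continuous_map (subtopology model (?E' T)) (subtopology (X I) (A T)) fst"
          by (intro continuous_map_into_subtopology continuous_map_from_subtopology[OF fst]) auto
        ultimately show ?thesis by simp
      qed
      have 2: "continuous_map (subtopology model (?E' T)) (N T) (\<lambda>p. subdiv (snd p))"
        unfolding nerve_def
      proof (rule continuous_map_into_subtopology)
        show "continuous_map (subtopology model (?E' T)) (powertop_real UNIV) (\<lambda>p. subdiv (snd p))"
          unfolding continuous_map_componentwise_UNIV
        proof
          fix S
          show "continuous_map (subtopology model (?E' T)) euclideanreal (\<lambda>p. subdiv (snd p) S)"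
          proof (cases "S \<subset> I")
            case True
            then have "continuous_map model euclideanreal (\<lambda>p. layer I (snd p) (I - S))"
              using snd finite_I by (intro continuous_map_layer) auto
            then show ?thesis
              using True by (auto simp: subdiv_def intro!: continuous_map_real_mult continuous_map_from_subtopology)
          qed (auto simp: subdiv_def)
        qed
        show "(\<lambda>p. subdiv (snd p)) \<in> topspace (subtopology model (?E' T)) \<rightarrow>
          {t. (\<forall>S. 0 \<le> t S) \<and> subset.chain (above P T) {S. t S \<noteq> 0} \<and> (\<Sum>S\<in>above P T. t S) = 1}"
        proof (rule funcsetI)
          fix p assume "p \<in> topspace (subtopology model (?E' T))"
          then have "subdiv (snd p) \<in> topspace (N T)"
            by (intro N[of "fst p", OF _ T]) auto
          then show "subdiv (snd p) \<in>
              {t. (\<forall>S. 0 \<le> t S) \<and> subset.chain (above P T) {S. t S \<noteq> 0} \<and> (\<Sum>S\<in>above P T. t S) = 1}"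
            unfolding topspace_nerve .
        qed
      qed
      have "continuous_map (subtopology model (?E' T)) (prod_topology (X T) (N T)) (\<lambda>p. (fst p, subdiv (snd p)))"
        using 1 2 by (rule continuous_map_pairedI)
      from continuous_map_compose[OF this continuous_map_cls[OF T]] show ?thesis
        by (simp add: o_def)
    qed
    fix T' p assume "T' \<in> P" "p \<in> topspace model \<inter> ?E' T \<inter> ?E' T'"
    then show "cls (T, fst p, subdiv (snd p)) = cls (T', fst p, subdiv (snd p))"
      using T N[of "fst p" "snd p"] by (intro cls_eq) auto
  next
    fix p assume "p \<in> topspace model"
    then show "\<exists>T. T \<in> P \<and> p \<in> {p \<in> topspace model. fst p \<in> A T \<and> (\<forall>i\<in>T. snd p i = 0)} \<and>
        \<rho> p = cls (T, fst p, subdiv (snd p))"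
      using Z[of "fst p" "snd p"] by (intro exI[of _ "Z (snd p)"]) (auto simp: \<rho>_def Z_def case_prod_unfold)
  qed
  show ?thesis
  proof (rule that[OF \<sigma>cont \<rho>cont])
    fix c assume "c \<in> topspace H"
    then obtain T y t where c: "c = cls (T, y, t)" and T: "T \<in> P" "y \<in> A T" "t \<in> topspace (N T)"
      unfolding topspace_hocolim by auto
    note m = bary_in_model[OF T]
    have "cls (Z (bary t), y, t) = cls (T, y, t)"
      using Z[OF m] NZ[OF m] T subdiv_bary[OF T(3)] by (intro cls_eq) auto
    then show "\<rho> (\<sigma> c) = c" using subdiv_bary[OF T(3)] by (simp add: c \<sigma> \<rho>_def)
    show "fst (\<sigma> c) = hocolim_map (\<lambda>S T. id) V c" by (simp add: c \<sigma> hocolim_map_cls)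
  next
    show "hocolim_map (\<lambda>S T. id) V (\<rho> p) = fst p" for p
      by (simp add: \<rho>_def case_prod_unfold hocolim_map_cls)
  qed
qed

text \<open>\<open>\<sigma>\<close> carries the problem to the model and \<open>\<rho>\<close>
  carries the solution back; \<open>\<rho> (\<sigma> c) = c\<close> restores the given lift at time
  0.\<close>

lemma hocolim_lifts:
  assumes lift: "\<And>a. continuous_map (top_of_set (sph m)) model a \<Longrightarrow> (\<forall>v\<in>sph m. fst (a v) = y v) \<Longrightarrow>
      lifts_up_to_homotopy m model (X I) fst y a"
    and b: "continuous_map (top_of_set (sph m)) H b" and b\<pi>: "\<forall>v\<in>sph m. hocolim_map (\<lambda>S T. id) V (b v) = y v"
  shows "lifts_up_to_homotopy m H (X I) (hocolim_map (\<lambda>S T. id) V) y b"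
proof -
  obtain \<sigma> \<rho> where \<sigma>: "continuous_map H model \<sigma>" and \<rho>: "continuous_map model H \<rho>"
    and \<rho>\<sigma>: "\<And>c. c \<in> topspace H \<Longrightarrow> \<rho> (\<sigma> c) = c"
    and f\<sigma>: "\<And>c. c \<in> topspace H \<Longrightarrow> fst (\<sigma> c) = hocolim_map (\<lambda>S T. id) V c"
    and h\<rho>: "\<And>p. p \<in> topspace model \<Longrightarrow> hocolim_map (\<lambda>S T. id) V (\<rho> p) = fst p"
    by (rule hocolim_retract_of_model[of V]) (rule that)
  have bH: "b v \<in> topspace H" if "v \<in> sph m" for v
    using continuous_map_image_subset_topspace[OF b] that by auto
  have "continuous_map (top_of_set (sph m)) model (\<lambda>v. \<sigma> (b v))"
    using continuous_map_compose[OF b \<sigma>] by (simp add: o_def)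
  moreover have "\<forall>v\<in>sph m. fst (\<sigma> (b v)) = y v"
    using f\<sigma>[OF bH] b\<pi> by simp
  ultimately have "lifts_up_to_homotopy m model (X I) fst y (\<lambda>v. \<sigma> (b v))"
    by (rule lift)
  then obtain Y B C where Y: "continuous_map (top_of_set (disc m \<times> {0..1::real})) (X I) (\<lambda>(v, s). Y v s)"
    and B: "continuous_map (top_of_set (sph m \<times> {0..1::real})) model (\<lambda>(v, s). B v s)"
    and C: "continuous_map (top_of_set (disc m)) model C"
    and Y0: "\<And>v. v \<in> disc m \<Longrightarrow> Y v 0 = y v" and Y1: "\<And>v. v \<in> disc m \<Longrightarrow> fst (C v) = Y v 1"
    and B0: "\<And>v. v \<in> sph m \<Longrightarrow> B v 0 = \<sigma> (b v)" and B1: "\<And>v. v \<in> sph m \<Longrightarrow> C v = B v 1"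
    and BY: "\<And>v s. v \<in> sph m \<Longrightarrow> s \<in> {0..1} \<Longrightarrow> fst (B v s) = Y v s"
    by (rule lifts_up_to_homotopyE) (rule that)
  have BM: "B v s \<in> topspace model" if "v \<in> sph m" "s \<in> {0..1}" for v s
    using continuous_map_image_subset_topspace[OF B] that by (auto simp: image_subset_iff)
  have CM: "C v \<in> topspace model" if "v \<in> disc m" for v
    using continuous_map_image_subset_topspace[OF C] that by (auto simp: image_subset_iff)
  have B': "continuous_map (top_of_set (sph m \<times> {0..1::real})) H (\<lambda>(v, s). \<rho> (B v s))"
    using continuous_map_compose[OF B \<rho>] by (simp add: o_def case_prod_unfold)
  have C': "continuous_map (top_of_set (disc m)) H (\<lambda>v. \<rho> (C v))"
    using continuous_map_compose[OF C \<rho>] by (simp add: o_def)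
  show ?thesis
    by (rule lifts_up_to_homotopyI[OF Y B' C' Y0])
      (use Y1 B0 B1 BY h\<rho> BM CM \<rho>\<sigma> bH in simp_all)
qed

end

section \<open>The cube of homotopy fibers\<close>

lemma topology_eqI_id:
  assumes "continuous_map X Y id" "continuous_map Y X id"
  shows "X = Y"
proof -
  have "openin Y U" if "continuous_map Y X id" "topspace X = topspace Y" "openin X U" for U and X Y :: "'c topology"
  proof -
    have "{x \<in> topspace Y. id x \<in> U} = U" using that openin_subset[of X U] by auto
    then show ?thesis using openin_continuous_map_preimage[OF that(1,3)] by simp
  qed
  moreover have "topspace X = topspace Y"
    using assms continuous_map_image_subset_topspace by fastforce
  ultimately show ?thesis
    using assms by (auto simp: topology_eq)
qed

lemma paths_subtopology: "\<gamma> \<in> paths (subtopology X S) \<longleftrightarrow> \<gamma> \<in> paths X \<and> (\<forall>t\<in>{0..1}. \<gamma> t \<in> S)"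
  by (auto simp: paths_def continuous_map_in_subtopology)

lemma paths_restrict: "\<gamma> \<in> paths X \<Longrightarrow> restrict \<gamma> {0..1} = \<gamma>"
  by (auto simp: paths_def extensional_restrict)

context closed_cube
begin

lemma continuous_map_incl: "S \<subseteq> T \<Longrightarrow> T \<subseteq> I \<Longrightarrow> continuous_map (X S) (X T) id"
proof -
  assume ST: "S \<subseteq> T" "T \<subseteq> I"
  have "continuous_map (subtopology (X I) (A S)) (subtopology (X I) (A T)) id"
    using mono[OF ST] by (auto simp: continuous_map_in_subtopology intro: continuous_map_from_subtopology)
  then show ?thesis using X_eq[of S] X_eq[of T] ST by simp
qed

end

lemma partition_of_unity_finite:
  fixes D :: "'v::metric_space set"
  assumes L: "finite L" and D: "closed D" and V: "\<And>j. j \<in> L \<Longrightarrow> openin (top_of_set D) (V j)"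
    and cover: "D \<subseteq> (\<Union>j\<in>L. V j)"
  obtains \<beta> :: "'l \<Rightarrow> 'v \<Rightarrow> real" where "\<And>j. continuous_on D (\<beta> j)" "\<And>j v. 0 \<le> \<beta> j v"
    "\<And>j v. v \<in> D \<Longrightarrow> \<beta> j v \<noteq> 0 \<Longrightarrow> j \<in> L \<and> v \<in> V j" "\<And>v. v \<in> D \<Longrightarrow> (\<Sum>j\<in>L. \<beta> j v) = 1"
proof -
  \<comment> \<open>The distance to an empty set is 0 by convention, so a \<open>V j\<close>
    covering all of \<open>D\<close> is treated apart.\<close>
  define d where "d = (\<lambda>j v. if D \<subseteq> V j then 1 else infdist v (D - V j))"
  have cl: "closed (D - V j)" if "j \<in> L" for j
    using V[OF that] D by (metis closedin_closed_trans closedin_diff closedin_topspace topspace_euclidean_subtopology)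
  have d0: "d j v \<noteq> 0 \<longleftrightarrow> v \<in> V j" if "j \<in> L" "v \<in> D" for j v
    using in_closed_iff_infdist_zero[OF cl[OF that(1)], of v] that by (auto simp: d_def)
  have dn: "0 \<le> d j v" for j v by (simp add: d_def infdist_nonneg)
  have dc: "continuous_on D (d j)" for j
    by (cases "D \<subseteq> V j") (auto simp: d_def intro!: continuous_intros)
  define s where "s = (\<lambda>v. \<Sum>j\<in>L. d j v)"
  have s: "s v \<noteq> 0" if v: "v \<in> D" for v
  proof -
    obtain j where "j \<in> L" "v \<in> V j" using cover v by blast
    then have "d j v \<noteq> 0" using d0 v by blast
    then show ?thesis using sum_nonneg_eq_0_iff[OF L, of "\<lambda>j. d j v"] dn \<open>j \<in> L\<close> by (auto simp: s_def)
  qed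
  show ?thesis
  proof (rule that[of "\<lambda>j v. if j \<in> L then d j v / s v else 0"])
    show "continuous_on D (\<lambda>v. if j \<in> L then d j v / s v else 0)" for j
      using s by (cases "j \<in> L") (auto simp: s_def intro!: continuous_intros dc)
    show "0 \<le> (if j \<in> L then d j v / s v else 0)" for j v
      using dn by (simp add: s_def sum_nonneg)
    show "j \<in> L \<and> v \<in> V j" if "v \<in> D" "(if j \<in> L then d j v / s v else 0) \<noteq> 0" for j v
      using that d0[of j v] by (auto split: if_splits)
    show "(\<Sum>j\<in>L. if j \<in> L then d j v / s v else 0) = 1" if "v \<in> D" for v
      using s[OF that] by (simp add: s_def flip: sum_divide_distrib)
  qed
qed

context cell_attachment
begin

context
  fixes k :: nat and x :: "'a + nat \<times> (nat \<Rightarrow> real)"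
  assumes finite_J: "finite J" and k: "k \<in> J"
begin

abbreviation "FB \<equiv> fiber_cube X n \<phi> k x"
abbreviation "L \<equiv> J - {k}"

text \<open>All homotopy fibers are viewed inside the path space of the single space
  \<open>XT J\<close>, as conditions on the points of a path.\<close>

lemma fiber_cube_iff:
  assumes "T \<subseteq> L"
  shows "z \<in> topspace (FB T) \<longleftrightarrow> fst z \<in> carrier T \<and> snd z \<in> paths (XT J) \<and>
    (\<forall>t\<in>{0..1}. snd z t \<in> carrier (insert k T)) \<and> snd z 1 = fst z \<and> snd z 0 = x"
proof -
  have "insert k T \<subseteq> J" "T \<subseteq> J" using assms k by auto
  then show ?thesis
    unfolding fiber_cube_def topspace_hofiber
    by (auto simp: subtopology_XT[of "insert k T" J] paths_subtopology topspace_XT)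
qed

lemma continuous_map_from_fiber_cube:
  assumes "T \<subseteq> L"
  shows "continuous_map (FB T) (XT T) fst"
    and "continuous_map (prod_topology (FB T) unit_interval) (XT (insert k T)) (\<lambda>(z, t). snd z t)"
  using continuous_map_from_hofiber(1,2)[of "FB T" "XT T" "XT (T \<union> {k})" id x "\<lambda>z. z"]
  by (simp_all add: fiber_cube_def)

lemma continuous_map_into_fiber_cube:
  assumes T: "T \<subseteq> L" and \<Phi>: "continuous_map (prod_topology Z unit_interval) (XT J) (\<lambda>(z, t). \<Phi> z t)"
    and T': "\<And>z t. z \<in> topspace Z \<Longrightarrow> t \<in> {0..1} \<Longrightarrow> \<Phi> z t \<in> carrier (insert k T)"
    and 0: "\<And>z. z \<in> topspace Z \<Longrightarrow> \<Phi> z 0 = x" and 1: "\<And>z. z \<in> topspace Z \<Longrightarrow> \<Phi> z 1 \<in> carrier T"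
  shows "continuous_map Z (FB T) (\<lambda>z. (\<Phi> z 1, restrict (\<Phi> z) {0..1}))"
proof -
  have TJ: "insert k T \<subseteq> J" "T \<subseteq> J" using T k by auto
  show ?thesis
    unfolding fiber_cube_def
  proof (rule continuous_map_into_hofiber)
    have "continuous_map Z (XT J) ((\<lambda>(z, t). \<Phi> z t) \<circ> (\<lambda>z. (z, 1)))"
      by (intro continuous_map_compose[OF _ \<Phi>] continuous_map_pairedI) auto
    then show "continuous_map Z (XT T) (\<lambda>z. \<Phi> z 1)"
      unfolding subtopology_XT[OF TJ(2) order_refl]
      using 1 by (intro continuous_map_into_subtopology) (auto simp: o_def)
    show "continuous_map (prod_topology Z unit_interval) (XT (T \<union> {k})) (\<lambda>(z, t). \<Phi> z t)"
      using subtopology_XT[OF TJ(1) order_refl] \<Phi> T'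
      by (auto intro!: continuous_map_into_subtopology)
  qed (use 0 in auto)
qed

lemma continuous_map_fiber_cube_path:
  assumes "T \<subseteq> L"
  shows "continuous_map (prod_topology (FB T) unit_interval) (XT J) (\<lambda>(z, t). snd z t)"
proof -
  have "insert k T \<subseteq> J" using assms k by auto
  then show ?thesis
    using continuous_map_from_fiber_cube(2)[OF assms] subtopology_XT[of "insert k T" J]
    by (metis continuous_map_in_subtopology order_refl)
qed

text \<open>Membership in a smaller fiber is a family of closed conditions on the end and on the
  values at all times. The topologies agree because the identity, written as end and path, is
  continuous both ways by the exponential law.\<close>

lemma closed_cube_fiber_cube: "closed_cube L FB"
proof
  show "finite L" using finite_J by simp
  have eta: "(snd z 1, restrict (snd z) {0..1}) = z" if "z \<in> topspace (FB T)" "T \<subseteq> L" for z T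
    using that fiber_cube_iff[of T z] by (cases z) (auto simp: paths_restrict)
  have LJ: "insert k L = J" using k by auto
  have car: "carrier S \<subseteq> carrier T" if "S \<subseteq> T" for S T using that by (rule attach_carrier_mono)
  show mono: "topspace (FB S) \<subseteq> topspace (FB T)" if "S \<subseteq> T" "T \<subseteq> L" for S T
  proof
    fix z assume "z \<in> topspace (FB S)"
    then have "fst z \<in> carrier S \<and> snd z \<in> paths (XT J) \<and>
       (\<forall>t\<in>{0..1}. snd z t \<in> carrier (insert k S)) \<and> snd z 1 = fst z \<and> snd z 0 = x"
      using fiber_cube_iff[OF order_trans[OF that]] by blast
    then show "z \<in> topspace (FB T)"
      unfolding fiber_cube_iff[OF that(2)]
      using car[OF that(1)] car[OF insert_mono[OF that(1), of k]] by blast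
  qed
  show "topspace (FB S) \<inter> topspace (FB T) \<subseteq> topspace (FB (S \<inter> T))" if "S \<subseteq> L" "T \<subseteq> L" for S T
  proof
    fix z assume "z \<in> topspace (FB S) \<inter> topspace (FB T)"
    then have "fst z \<in> carrier S \<inter> carrier T \<and> snd z \<in> paths (XT J) \<and>
       (\<forall>t\<in>{0..1}. snd z t \<in> carrier (insert k S) \<inter> carrier (insert k T)) \<and> snd z 1 = fst z \<and> snd z 0 = x"
      using fiber_cube_iff[OF that(1), of z] fiber_cube_iff[OF that(2), of z] by blast
    moreover have "S \<inter> T \<subseteq> L" using that by auto
    ultimately show "z \<in> topspace (FB (S \<inter> T))"
      unfolding attach_carrier_Int insert_inter_insert by (simp add: fiber_cube_iff)
  qed
  fix T assume T: "T \<subseteq> L"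
  have iff: "z \<in> topspace (FB T) \<longleftrightarrow> z \<in> topspace (FB L) \<and> fst z \<in> carrier T \<and>
      (\<forall>t\<in>{0..1}. snd z t \<in> carrier (insert k T))" for z
  proof -
    have "carrier (insert k T) \<subseteq> carrier J" using T k by (intro car) auto
    then show ?thesis
      unfolding fiber_cube_iff[OF T] fiber_cube_iff[OF order_refl] LJ using car[OF T] by blast
  qed
  show "FB T = subtopology (FB L) (topspace (FB T))"
  proof (rule topology_eqI_id)
    have "continuous_map (FB T) (FB L) (\<lambda>z. (snd z 1, restrict (snd z) {0..1}))"
      using iff fiber_cube_iff[of L]
      by (intro continuous_map_into_fiber_cube continuous_map_fiber_cube_path T) auto
    then have "continuous_map (FB T) (FB L) id"
      by (rule continuous_map_eq) (use eta[OF _ T] in auto)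
    then show "continuous_map (FB T) (subtopology (FB L) (topspace (FB T))) id"
      by (rule continuous_map_into_subtopology) auto
    let ?Z = "subtopology (FB L) (topspace (FB T))"
    have Z: "topspace ?Z = topspace (FB T)" using mono[OF T order_refl] by auto
    have "continuous_map ?Z (FB T) (\<lambda>z. (snd z 1, restrict (snd z) {0..1}))"
    proof (rule continuous_map_into_fiber_cube[OF T])
      show "continuous_map (prod_topology ?Z unit_interval) (XT J) (\<lambda>(z, t). snd z t)"
        unfolding prod_topology_subtopology(1)
        by (intro continuous_map_from_subtopology continuous_map_fiber_cube_path order_refl)
    qed (use fiber_cube_iff[OF T] Z in auto)
    then show "continuous_map ?Z (FB T) id"
      by (rule continuous_map_eq) (use eta[OF _ T] Z in auto)
  qed
  show "closedin (FB L) (topspace (FB T))"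
  proof -
    have ev: "continuous_map (FB L) (XT J) (\<lambda>z. snd z t)" if "t \<in> {0..1}" for t
    proof -
      have "continuous_map (FB L) (XT J) ((\<lambda>(z, t). snd z t) \<circ> (\<lambda>z. (z, t)))"
        using that by (intro continuous_map_compose[OF _ continuous_map_fiber_cube_path[OF order_refl]]
            continuous_map_pairedI) auto
      then show ?thesis by (simp add: o_def)
    qed
    have "closedin (XT L) (carrier T)" "closedin (XT J) (carrier (insert k T))"
      using T k by (auto intro!: closedin_carrier)
    then have "closedin (FB L) ({z \<in> topspace (FB L). fst z \<in> carrier T} \<inter>
       (\<Inter>t\<in>{0..1}. {z \<in> topspace (FB L). snd z t \<in> carrier (insert k T)}))"
      by (intro closedin_Int closedin_INT closedin_continuous_map_preimage[OF continuous_map_from_fiber_cube(1)]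
          closedin_continuous_map_preimage[OF ev]) auto
    moreover have "topspace (FB T) = {z \<in> topspace (FB L). fst z \<in> carrier T} \<inter>
       (\<Inter>t\<in>{0..1}. {z \<in> topspace (FB L). snd z t \<in> carrier (insert k T)})"
      using iff by auto
    ultimately show ?thesis by simp
  qed
qed

text \<open>The deformation of paths read as a homotopy in \<open>FB L\<close>. A deformed path
  missing the open cell \<open>j\<close> lies in \<open>FB (L - {j})\<close>, as its end is then in
  \<open>carrier L\<close> and \<open>carrier (J - {j})\<close>, hence in
  \<open>carrier (L - {j})\<close>.\<close>

lemma fiber_family_deformation:
  assumes L: "L \<noteq> {}" and x: "x \<in> carrier {k}" and dim: "m + card J < (\<Sum>j\<in>J. n j)"
    and y: "continuous_map (top_of_set (disc m)) (FB L) y"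
  obtains Y V where "continuous_map (top_of_set (disc m \<times> {0..1::real})) (FB L) (\<lambda>(v, s). Y v s)"
    "\<And>v. v \<in> disc m \<Longrightarrow> Y v 0 = y v"
    "\<And>j v s. j \<in> L \<Longrightarrow> v \<in> disc m \<Longrightarrow> s \<in> {0..1} \<Longrightarrow> y v \<in> topspace (FB (L - {j})) \<Longrightarrow>
       Y v s \<in> topspace (FB (L - {j}))"
    "\<And>j v. j \<in> L \<Longrightarrow> v \<in> disc m \<Longrightarrow> y v \<in> topspace (FB (L - {j})) \<Longrightarrow> v \<in> V j"
    "\<And>j. j \<in> L \<Longrightarrow> openin (top_of_set (disc m)) (V j)" "disc m \<subseteq> (\<Union>j\<in>L. V j)"
    "\<And>j v. j \<in> L \<Longrightarrow> v \<in> V j \<Longrightarrow> Y v 1 \<in> topspace (FB (L - {j}))"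
proof -
  let ?I = "{0..1::real}"
  have LJ: "insert k L = J" using k by auto
  have Lj: "insert k (L - {j}) = J - {j}" if "j \<in> L" for j using that k by auto
  have yL: "y v \<in> topspace (FB L)" if "v \<in> disc m" for v
    using continuous_map_image_subset_topspace[OF y] that by auto
  note yiff = yL[unfolded fiber_cube_iff[OF order_refl] LJ]
  have "continuous_map (prod_topology (top_of_set (disc m)) unit_interval) (XT J)
     ((\<lambda>(z, t). snd z t) \<circ> (\<lambda>p. (y (fst p), snd p)))"
    by (intro continuous_map_compose[OF _ continuous_map_fiber_cube_path[OF order_refl]]
        continuous_map_pairedI continuous_map_snd
        continuous_map_compose[OF continuous_map_fst y, unfolded o_def])
  then have \<Phi>: "continuous_map (top_of_set (disc m \<times> ?I)) (XT J) (\<lambda>(v, t). snd (y v) t)"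
    by (simp add: o_def case_prod_unfold)
  have \<Phi>0: "snd (y v) 0 = x" and \<Phi>1: "snd (y v) 1 \<in> carrier L" if "v \<in> disc m" for v
    using yiff[OF that] by auto
  have Lk: "J \<noteq> {k}" using L by auto
  obtain \<Psi> V where
    \<Psi>: "continuous_map (top_of_set (disc m \<times> ?I \<times> ?I)) (XT J) (\<lambda>(v, s, t). \<Psi> v s t)"
    and \<Psi>s: "\<And>v t. v \<in> disc m \<Longrightarrow> t \<in> ?I \<Longrightarrow> \<Psi> v 0 t = snd (y v) t"
    and \<Psi>0: "\<And>v s. v \<in> disc m \<Longrightarrow> s \<in> ?I \<Longrightarrow> \<Psi> v s 0 = x"
    and \<Psi>1: "\<And>v s. v \<in> disc m \<Longrightarrow> s \<in> ?I \<Longrightarrow> \<Psi> v s 1 \<in> carrier L"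
    and \<Psi>T: "\<And>v s t T. v \<in> disc m \<Longrightarrow> s \<in> ?I \<Longrightarrow> t \<in> ?I \<Longrightarrow> k \<in> T \<Longrightarrow> T \<subseteq> J \<Longrightarrow>
       (\<forall>t\<in>?I. snd (y v) t \<in> carrier T) \<Longrightarrow> \<Psi> v s t \<in> carrier T"
    and V: "\<And>j. j \<in> L \<Longrightarrow> openin (top_of_set (disc m)) (V j)" "disc m \<subseteq> (\<Union>j\<in>L. V j)"
    and VI: "\<And>v j. v \<in> disc m \<Longrightarrow> j \<in> L \<Longrightarrow> (\<forall>t\<in>?I. snd (y v) t \<in> carrier (J - {j})) \<Longrightarrow> v \<in> V j"
    and VD: "\<And>v j t. j \<in> L \<Longrightarrow> v \<in> V j \<Longrightarrow> t \<in> ?I \<Longrightarrow> \<Psi> v 1 t \<in> carrier (J - {j})"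
    by (rule path_family_deformation[OF finite_J k Lk x dim \<Phi> \<Phi>0 \<Phi>1]) (simp, simp, rule that)
  define Y where "Y = (\<lambda>v s. (\<Psi> v s 1, restrict (\<Psi> v s) ?I))"
  have "continuous_map (prod_topology (top_of_set (disc m \<times> ?I)) unit_interval) (XT J)
      (\<lambda>p. (\<lambda>(v, s, t). \<Psi> v s t) (fst (fst p), snd (fst p), snd p))"
  proof -
    have "continuous_map (top_of_set ((disc m \<times> ?I) \<times> ?I)) (XT J)
      (\<lambda>p. (\<lambda>(v, s, t). \<Psi> v s t) (fst (fst p), snd (fst p), snd p))"
      by (rule continuous_map_compose_continuous_on[OF \<Psi>])
        (auto intro!: continuous_on_Pair continuous_on_fst continuous_on_snd continuous_on_id)
    then show ?thesis by simp
  qed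
  then have \<Psi>c: "continuous_map (prod_topology (top_of_set (disc m \<times> ?I)) unit_interval) (XT J)
      (\<lambda>(p, t). \<Psi> (fst p) (snd p) t)"
    by (simp add: case_prod_unfold)
  have \<Psi>J: "\<Psi> v s t \<in> carrier J" if "v \<in> disc m" "s \<in> ?I" "t \<in> ?I" for v s t
    using \<Psi>T[OF that k order_refl] yiff[OF that(1)] by blast
  have "continuous_map (top_of_set (disc m \<times> ?I)) (FB L)
      (\<lambda>p. (\<Psi> (fst p) (snd p) 1, restrict (\<Psi> (fst p) (snd p)) ?I))"
    by (rule continuous_map_into_fiber_cube[OF order_refl \<Psi>c, unfolded LJ]) (use \<Psi>J \<Psi>0 \<Psi>1 in auto)
  then have Yc: "continuous_map (top_of_set (disc m \<times> ?I)) (FB L) (\<lambda>(v, s). Y v s)"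
    by (simp add: Y_def case_prod_unfold)
  have YL: "Y v s \<in> topspace (FB L)" if "v \<in> disc m" "s \<in> ?I" for v s
    using continuous_map_image_subset_topspace[OF Yc] that by (auto simp: image_subset_iff)
  have YI: "Y v s \<in> topspace (FB (L - {j}))"
    if j: "j \<in> L" and v: "v \<in> disc m" and s: "s \<in> ?I" and c: "\<And>t. t \<in> ?I \<Longrightarrow> \<Psi> v s t \<in> carrier (J - {j})" for v s j
  proof -
    have "\<Psi> v s 1 \<in> carrier (L \<inter> (J - {j}))"
      using c[of 1] \<Psi>1[OF v s] attach_carrier_Int[of X n L "J - {j}"] by auto
    moreover have "L \<inter> (J - {j}) = L - {j}" by auto
    ultimately show ?thesis
      using YL[OF v s] c Lj[OF j] unfolding fiber_cube_iff[OF order_refl] fiber_cube_iff[of "L - {j}", OF Diff_subset]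
      by (simp add: Y_def)
  qed
  show ?thesis
  proof (rule that[OF Yc _ _ _ V])
    show "Y v 0 = y v" if "v \<in> disc m" for v
    proof -
      have "restrict (\<Psi> v 0) ?I = snd (y v)"
        using \<Psi>s[OF that] yiff[OF that] by (metis (no_types, lifting) paths_restrict restrict_ext)
      then show ?thesis using \<Psi>s[OF that, of 1] yiff[OF that] by (simp add: Y_def prod_eq_iff)
    qed
    have *: "snd (y v) t \<in> carrier (J - {j})" if "j \<in> L" "y v \<in> topspace (FB (L - {j}))" "t \<in> ?I" for j v t
      using that Lj[OF that(1)] fiber_cube_iff[of "L - {j}", OF Diff_subset] by auto
    show "Y v s \<in> topspace (FB (L - {j}))"
      if "j \<in> L" "v \<in> disc m" "s \<in> ?I" "y v \<in> topspace (FB (L - {j}))" for j v s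
      using that * k by (intro YI \<Psi>T) auto
    show "v \<in> V j" if "j \<in> L" "v \<in> disc m" "y v \<in> topspace (FB (L - {j}))" for j v
      using that * by (intro VI) auto
    show "Y v 1 \<in> topspace (FB (L - {j}))" if "j \<in> L" "v \<in> V j" for j v
      using that VD openin_subset[OF V(1)[OF that(1)]] by (intro YI) auto
  qed
qed

text \<open>\<open>Y\<close> lifts itself: over the sphere a path never leaves the member of the
  union in which it started, and at time 1 the cover by the \<open>V j\<close> puts every path into
  some member.\<close>

lemma lifts_to_union:
  assumes L: "L \<noteq> {}" and x: "x \<in> carrier {k}" and dim: "m + card J < (\<Sum>j\<in>J. n j)"
    and y: "continuous_map (top_of_set (disc m)) (FB L) y"
    and b: "continuous_map (top_of_set (sph m)) (subtopology (FB L) (\<Union>j\<in>L. topspace (FB (L - {j})))) b"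
    and by': "\<forall>v\<in>sph m. id (b v) = y v"
  shows "lifts_up_to_homotopy m (subtopology (FB L) (\<Union>j\<in>L. topspace (FB (L - {j})))) (FB L) id y b"
proof -
  let ?U = "\<Union>j\<in>L. topspace (FB (L - {j}))"
  obtain Y V where Y: "continuous_map (top_of_set (disc m \<times> {0..1::real})) (FB L) (\<lambda>(v, s). Y v s)"
    and Y0: "\<And>v. v \<in> disc m \<Longrightarrow> Y v 0 = y v"
    and Yj: "\<And>j v s. j \<in> L \<Longrightarrow> v \<in> disc m \<Longrightarrow> s \<in> {0..1} \<Longrightarrow> y v \<in> topspace (FB (L - {j})) \<Longrightarrow>
       Y v s \<in> topspace (FB (L - {j}))"
    and VI: "\<And>j v. j \<in> L \<Longrightarrow> v \<in> disc m \<Longrightarrow> y v \<in> topspace (FB (L - {j})) \<Longrightarrow> v \<in> V j"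
    and V: "\<And>j. j \<in> L \<Longrightarrow> openin (top_of_set (disc m)) (V j)" "disc m \<subseteq> (\<Union>j\<in>L. V j)"
    and V1: "\<And>j v. j \<in> L \<Longrightarrow> v \<in> V j \<Longrightarrow> Y v 1 \<in> topspace (FB (L - {j}))"
    by (rule fiber_family_deformation[OF L x dim y]) (rule that)
  have bU: "b v \<in> ?U" if "v \<in> sph m" for v
    using continuous_map_image_subset_topspace[OF b] that by auto
  have YU: "Y v s \<in> ?U" if v: "v \<in> sph m" and s: "s \<in> {0..1}" for v s
  proof -
    obtain j where "j \<in> L" "y v \<in> topspace (FB (L - {j}))"
      using bU[OF v] by' v by auto
    then show ?thesis using Yj v s sph_subset_disc by blast
  qed
  show ?thesis
  proof (rule lifts_up_to_homotopyI[OF Y _ _ Y0])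
    have "top_of_set (sph m \<times> {0..1::real}) = subtopology (top_of_set (disc m \<times> {0..1})) (sph m \<times> {0..1})"
      using sph_subset_disc[of m] by (simp add: subtopology_subtopology Times_Int_Times inf.absorb2)
    then have "continuous_map (top_of_set (sph m \<times> {0..1::real})) (FB L) (\<lambda>(v, s). Y v s)"
      using Y by (simp add: continuous_map_from_subtopology)
    then show "continuous_map (top_of_set (sph m \<times> {0..1::real})) (subtopology (FB L) ?U) (\<lambda>(v, s). Y v s)"
      by (rule continuous_map_into_subtopology) (use YU in auto)
    have "continuous_map (top_of_set (disc m)) (FB L) (\<lambda>v. (\<lambda>(v, s). Y v s) (v, 1))"
      by (rule continuous_map_compose_continuous_on[OF Y]) (auto intro!: continuous_intros)
    then have "continuous_map (top_of_set (disc m)) (FB L) (\<lambda>v. Y v 1)" by simp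
    moreover have "Y v 1 \<in> ?U" if v: "v \<in> disc m" for v
    proof -
      obtain j where "j \<in> L" "v \<in> V j" using V(2) v by blast
      then show ?thesis using V1 by blast
    qed
    ultimately show "continuous_map (top_of_set (disc m)) (subtopology (FB L) ?U) (\<lambda>v. Y v 1)"
      by (intro continuous_map_into_subtopology) auto
  qed (use Y0 by' sph_subset_disc in auto)
qed

text \<open>The weights \<open>\<alpha>\<close> are admissible throughout \<open>Y\<close>, but the
  partition of unity \<open>\<beta>\<close> only at its end. So the path moves first with
  \<open>\<alpha>\<close> fixed, and then \<open>\<alpha>\<close> is deformed linearly to
  \<open>\<beta>\<close> while the path rests.\<close>

lemma lifts_to_model:
  assumes L: "L \<noteq> {}" and x: "x \<in> carrier {k}" and dim: "m + card J < (\<Sum>j\<in>J. n j)"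
    and y: "continuous_map (top_of_set (disc m)) (FB L) y"
    and a: "continuous_map (top_of_set (sph m)) (closed_cube.model L FB) a"
    and ay: "\<forall>v\<in>sph m. fst (a v) = y v"
  shows "lifts_up_to_homotopy m (closed_cube.model L FB) (FB L) fst y a"
proof -
  interpret closed_cube L FB by (rule closed_cube_fiber_cube)
  obtain Y V where Y: "continuous_map (top_of_set (disc m \<times> {0..1::real})) (FB L) (\<lambda>(v, s). Y v s)"
    and Y0: "\<And>v. v \<in> disc m \<Longrightarrow> Y v 0 = y v"
    and Yj: "\<And>j v s. j \<in> L \<Longrightarrow> v \<in> disc m \<Longrightarrow> s \<in> {0..1} \<Longrightarrow> y v \<in> topspace (FB (L - {j})) \<Longrightarrow>
       Y v s \<in> topspace (FB (L - {j}))"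
    and VI: "\<And>j v. j \<in> L \<Longrightarrow> v \<in> disc m \<Longrightarrow> y v \<in> topspace (FB (L - {j})) \<Longrightarrow> v \<in> V j"
    and V: "\<And>j. j \<in> L \<Longrightarrow> openin (top_of_set (disc m)) (V j)" "disc m \<subseteq> (\<Union>j\<in>L. V j)"
    and V1: "\<And>j v. j \<in> L \<Longrightarrow> v \<in> V j \<Longrightarrow> Y v 1 \<in> topspace (FB (L - {j}))"
    by (rule fiber_family_deformation[OF L x dim y]) (rule that)
  have cld: "closed (disc m)" using compact_disc compact_imp_closed by blast
  obtain \<beta> :: "nat \<Rightarrow> (nat \<Rightarrow> real) \<Rightarrow> real" where \<beta>: "\<And>j. continuous_on (disc m) (\<beta> j)" "\<And>j v. 0 \<le> \<beta> j v"
    and \<beta>V: "\<And>j v. v \<in> disc m \<Longrightarrow> \<beta> j v \<noteq> 0 \<Longrightarrow> j \<in> L \<and> v \<in> V j"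
    and \<beta>1: "\<And>v. v \<in> disc m \<Longrightarrow> (\<Sum>j\<in>L. \<beta> j v) = 1"
    by (rule partition_of_unity_finite[OF finite_I cld V]) (simp, rule that)
  define \<alpha> where "\<alpha> = (\<lambda>v. snd (a v))"
  have aM: "(y v, \<alpha> v) \<in> topspace model" if "v \<in> sph m" for v
    using continuous_map_image_subset_topspace[OF a] that ay by (auto simp: \<alpha>_def) (metis image_subset_iff prod.collapse)
  have \<alpha>: "0 \<le> \<alpha> v i" "i \<notin> L \<Longrightarrow> \<alpha> v i = 0" "(\<Sum>i\<in>L. \<alpha> v i) = 1"
    "\<alpha> v i \<noteq> 0 \<Longrightarrow> y v \<in> topspace (FB (L - {i}))" if "v \<in> sph m" for v i
    using aM[OF that] by (auto simp: model_def)
  have \<beta>L: "\<beta> j v = 0" if "v \<in> disc m" "j \<notin> L" for j v using \<beta>V[OF that(1)] that(2) by blast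
  define p where "p = (\<lambda>s::real. min 1 (2 * s))"
  define q where "q = (\<lambda>s::real. max 0 (2 * s - 1))"
  have pq: "p s \<in> {0..1}" "q s \<in> {0..1}" if "s \<in> {0..1}" for s using that by (auto simp: p_def q_def)
  define B where "B = (\<lambda>v s. (Y v (p s), \<lambda>j. (1 - q s) * \<alpha> v j + q s * \<beta> j v))"
  define C where "C = (\<lambda>v. (Y v 1, \<lambda>j. \<beta> j v))"
  have YFB: "Y v s \<in> topspace (FB L)" if "v \<in> disc m" "s \<in> {0..1}" for v s
    using continuous_map_image_subset_topspace[OF Y] that by (auto simp: image_subset_iff)
  have Yp: "continuous_map (top_of_set (D \<times> {0..1})) (FB L) (\<lambda>(v, s). Y v (p s))" if "D \<subseteq> disc m" for D
  proof -
    have "continuous_map (top_of_set (D \<times> {0..1})) (FB L) (\<lambda>w. (\<lambda>(v, s). Y v s) (fst w, p (snd w)))"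
    proof (rule continuous_map_compose_continuous_on[OF Y])
      show "continuous_on (D \<times> {0..1}) (\<lambda>w. (fst w, p (snd w)))"
        unfolding p_def by (intro continuous_intros)
    qed (use that pq in auto)
    then show ?thesis by (simp add: case_prod_unfold)
  qed
  have Y1c: "continuous_map (top_of_set (disc m)) (FB L) (\<lambda>v. Y v 1)"
  proof -
    have "continuous_map (top_of_set (disc m)) (FB L) (\<lambda>v. (\<lambda>(v, s). Y v s) (v, 1))"
      by (rule continuous_map_compose_continuous_on[OF Y]) (auto intro!: continuous_intros)
    then show ?thesis by simp
  qed
  have B: "continuous_map (top_of_set (sph m \<times> {0..1::real})) model (\<lambda>(v, s). B v s)"
    unfolding model_def
  proof (rule continuous_map_into_subtopology)
    have "continuous_map (top_of_set (sph m)) (powertop_real UNIV) (\<lambda>v. snd (a v))"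
      using a unfolding model_def continuous_map_in_subtopology by (simp add: continuous_map_pairwise o_def)
    then have \<alpha>c: "continuous_on (sph m) (\<lambda>v. \<alpha> v j)" for j
      unfolding continuous_map_componentwise_UNIV \<alpha>_def by simp
    have "continuous_on (sph m \<times> {0..1}) (\<lambda>w. (1 - q (snd w)) * \<alpha> (fst w) j + q (snd w) * \<beta> j (fst w))" for j
    proof -
      have "continuous_on (sph m \<times> {0..1::real}) (\<lambda>w. \<alpha> (fst w) j)"
        by (rule continuous_on_compose2[OF \<alpha>c]) (auto intro!: continuous_on_fst continuous_on_id)
      moreover have "continuous_on (sph m \<times> {0..1::real}) (\<lambda>w. \<beta> j (fst w))"
        by (rule continuous_on_compose2[OF \<beta>(1)]) (use sph_subset_disc in \<open>auto intro!: continuous_on_fst continuous_on_id\<close>)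
      moreover have "continuous_on (sph m \<times> {0..1::real}) (\<lambda>w. q (snd w))"
        unfolding q_def by (intro continuous_intros)
      ultimately show ?thesis by (intro continuous_on_add continuous_on_mult continuous_on_diff continuous_on_const)
    qed
    then have "continuous_map (top_of_set (sph m \<times> {0..1})) (powertop_real UNIV)
        (\<lambda>w. \<lambda>j. (1 - q (snd w)) * \<alpha> (fst w) j + q (snd w) * \<beta> j (fst w))"
      unfolding continuous_map_componentwise_UNIV by simp
    then show "continuous_map (top_of_set (sph m \<times> {0..1})) (prod_topology (FB L) (powertop_real UNIV)) (\<lambda>(v, s). B v s)"
      using Yp[OF sph_subset_disc] unfolding B_def case_prod_unfold by (intro continuous_map_pairedI)
    show "(\<lambda>(v, s). B v s) \<in> topspace (top_of_set (sph m \<times> {0..1})) \<rightarrow>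
      {(y, \<alpha>). (\<forall>i. 0 \<le> \<alpha> i) \<and> (\<forall>i. i \<notin> L \<longrightarrow> \<alpha> i = 0) \<and> (\<Sum>i\<in>L. \<alpha> i) = 1 \<and>
        (\<forall>i. \<alpha> i \<noteq> 0 \<longrightarrow> y \<in> topspace (FB (L - {i})))}"
    proof (rule funcsetI)
      fix w assume w0: "w \<in> topspace (top_of_set (sph m \<times> {0..1::real}))"
      then obtain v s where w: "w = (v, s)" "v \<in> sph m" "s \<in> {0..1}" by auto
      have v: "v \<in> disc m" using w sph_subset_disc by blast
      let ?\<gamma> = "\<lambda>j. (1 - q s) * \<alpha> v j + q s * \<beta> j v"
      have 1: "0 \<le> ?\<gamma> i" for i using pq(2)[OF w(3)] \<alpha>(1)[OF w(2)] \<beta>(2) by simp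
      have 2: "?\<gamma> i = 0" if "i \<notin> L" for i using \<alpha>(2)[OF w(2) that] \<beta>L[OF v that] by simp
      have 3: "(\<Sum>i\<in>L. ?\<gamma> i) = 1"
        using \<alpha>(3)[OF w(2)] \<beta>1[OF v] by (simp add: sum.distrib flip: sum_distrib_left)
      \<comment> \<open>A nonzero \<open>\<alpha> v i\<close> puts \<open>y v\<close>, and therefore
        all of \<open>Y v\<close>, into the member for \<open>i\<close>. Otherwise
        \<open>\<beta>\<close> contributes, which happens only in the second half, when
        \<open>Y\<close> has reached time 1.\<close>
      have 4: "Y v (p s) \<in> topspace (FB (L - {i}))" if "?\<gamma> i \<noteq> 0" for i
      proof (cases "\<alpha> v i = 0")
        case False
        then have "i \<in> L" using \<alpha>(2)[OF w(2)] by blast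
        then show ?thesis using Yj[OF _ v pq(1)[OF w(3)] \<alpha>(4)[OF w(2) False]] by simp
      next
        case True
        then have "q s \<noteq> 0" "\<beta> i v \<noteq> 0" using that by auto
        then have "p s = 1" by (auto simp: p_def q_def)
        then show ?thesis using V1 \<beta>V[OF v \<open>\<beta> i v \<noteq> 0\<close>] by simp
      qed
      show "(case w of (v, s) \<Rightarrow> B v s) \<in> {(y, \<alpha>). (\<forall>i. 0 \<le> \<alpha> i) \<and> (\<forall>i. i \<notin> L \<longrightarrow> \<alpha> i = 0) \<and> (\<Sum>i\<in>L. \<alpha> i) = 1 \<and>
        (\<forall>i. \<alpha> i \<noteq> 0 \<longrightarrow> y \<in> topspace (FB (L - {i})))}"
        unfolding w(1) B_def prod.case mem_Collect_eq using 1 2 3 4 by blast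
    qed
  qed
  have C: "continuous_map (top_of_set (disc m)) model C"
    unfolding model_def
  proof (rule continuous_map_into_subtopology)
    have "continuous_map (top_of_set (disc m)) (powertop_real UNIV) (\<lambda>v j. \<beta> j v)"
      unfolding continuous_map_componentwise_UNIV using \<beta>(1) by simp
    then show "continuous_map (top_of_set (disc m)) (prod_topology (FB L) (powertop_real UNIV)) C"
      unfolding C_def using Y1c by (intro continuous_map_pairedI)
    show "C \<in> topspace (top_of_set (disc m)) \<rightarrow>
      {(y, \<alpha>). (\<forall>i. 0 \<le> \<alpha> i) \<and> (\<forall>i. i \<notin> L \<longrightarrow> \<alpha> i = 0) \<and> (\<Sum>i\<in>L. \<alpha> i) = 1 \<and>
        (\<forall>i. \<alpha> i \<noteq> 0 \<longrightarrow> y \<in> topspace (FB (L - {i})))}"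
    proof (rule funcsetI)
      fix v assume "v \<in> topspace (top_of_set (disc m))"
      then have v: "v \<in> disc m" by simp
      have "Y v 1 \<in> topspace (FB (L - {i}))" if "\<beta> i v \<noteq> 0" for i
        using V1 \<beta>V[OF v that] by blast
      then show "C v \<in> {(y, \<alpha>). (\<forall>i. 0 \<le> \<alpha> i) \<and> (\<forall>i. i \<notin> L \<longrightarrow> \<alpha> i = 0) \<and> (\<Sum>i\<in>L. \<alpha> i) = 1 \<and>
          (\<forall>i. \<alpha> i \<noteq> 0 \<longrightarrow> y \<in> topspace (FB (L - {i})))}"
        unfolding C_def prod.case mem_Collect_eq using \<beta>(2) \<beta>L[OF v] \<beta>1[OF v] by blast
    qed
  qed
  show ?thesis
  proof (rule lifts_up_to_homotopyI[OF Yp[OF order_refl] B C])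
    fix v assume v: "v \<in> sph m"
    then have "v \<in> disc m" using sph_subset_disc by blast
    then have "B v 0 = (y v, \<alpha> v)" using Y0 by (simp add: B_def p_def q_def)
    then show "B v 0 = a v" using ay v by (simp add: \<alpha>_def prod_eq_iff)
  qed (use Y0 in \<open>auto simp: B_def C_def p_def q_def\<close>)
qed

text \<open>If some disc dimension \<open>m \<le> j\<close> has to be treated at all, then
  \<open>j\<close> is nonnegative, so there is a cell besides \<open>k\<close>, as the deformation
  requires.\<close>

lemma connectivity_fiber_cube:
  assumes x: "x \<in> carrier {k}"
    and j: "L = {} \<Longrightarrow> j < 0" "j + int (card J) < (\<Sum>j\<in>J. int (n j))"
  shows "n_connected_map j (hocolim {T. T \<subset> L} FB (\<lambda>S T. id)) (FB L) (hocolim_map (\<lambda>S T. id) L)"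
    and "n_connected_pair j (FB L) (\<Union>j\<in>L. topspace (FB (L - {j})))"
proof -
  interpret closed_cube L FB by (rule closed_cube_fiber_cube)
  have *: "L \<noteq> {} \<and> m + card J < (\<Sum>j\<in>J. n j)" if "int m \<le> j" for m
  proof
    show "L \<noteq> {}" using j(1) that by linarith
    have "int (m + card J) < int (\<Sum>j\<in>J. n j)" using that j(2) by simp
    then show "m + card J < (\<Sum>j\<in>J. n j)" by linarith
  qed
  show "n_connected_map j H (FB L) (hocolim_map (\<lambda>S T. id) L)"
  proof (rule n_connected_mapI[OF continuous_map_hocolim_map])
    fix m y b
    assume m: "int m \<le> j" and y: "continuous_map (top_of_set (disc m)) (FB L) y"
      and b: "continuous_map (top_of_set (sph m)) H b" "\<forall>v\<in>sph m. hocolim_map (\<lambda>S T. id) L (b v) = y v"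
    show "lifts_up_to_homotopy m H (FB L) (hocolim_map (\<lambda>S T. id) L) y b"
      by (rule hocolim_lifts[OF _ b]) (use lifts_to_model[OF _ x _ y] *[OF m] in blast)
  qed
  show "n_connected_pair j (FB L) (\<Union>j\<in>L. topspace (FB (L - {j})))"
    unfolding n_connected_pair_def
  proof
    show "(\<Union>j\<in>L. topspace (FB (L - {j}))) \<subseteq> topspace (FB L)"
      using mono[of "L - {_}" L] by blast
    show "n_connected_map j (subtopology (FB L) (\<Union>j\<in>L. topspace (FB (L - {j})))) (FB L) id"
      by (rule n_connected_mapI)
        (use * lifts_to_union[OF _ x] in \<open>auto intro: continuous_map_from_subtopology\<close>)
  qed
qed

end

end

theorem lemma1p2:
  fixes k :: nat
    and X0 :: "'a topology"
    and d :: "nat \<Rightarrow> int"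
    and \<phi> :: "nat \<Rightarrow> (nat \<Rightarrow> real) \<Rightarrow> 'a"
    and x :: "'a + nat \<times> (nat \<Rightarrow> real)"
  assumes "k \<ge> 1"
    and "\<And>j. j \<in> {1..k} \<Longrightarrow> d j \<ge> -1"
    and "\<And>j. j \<in> {1..k} \<Longrightarrow> continuous_map (cell_boundary (nat (d j + 1))) X0 (\<phi> j)"
    and "x \<in> topspace (attach_cells X0 (\<lambda>j. nat (d j + 1)) \<phi> {k})"
    and "k = 1 \<Longrightarrow> d 1 \<le> 0"
  shows "cocartesian (-1 + (\<Sum>j=1..k. d j)) (k - 1)
           (fiber_cube X0 (\<lambda>j. nat (d j + 1)) \<phi> k x) (\<lambda>S T. id)
       \<and> n_connected_pair (-1 + (\<Sum>j=1..k. d j))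
           (fiber_cube X0 (\<lambda>j. nat (d j + 1)) \<phi> k x {1..k-1})
           (\<Union>j\<in>{1..k-1}. topspace (fiber_cube X0 (\<lambda>j. nat (d j + 1)) \<phi> k x ({1..k-1} - {j})))"
proof -
  let ?n = "\<lambda>j. nat (d j + 1)" and ?j = "-1 + (\<Sum>j=1..k. d j)"
  interpret cell_attachment X0 ?n \<phi> "{1..k}"
    using assms(3) by unfold_locales
  have k: "k \<in> {1..k}" and L: "{1..k} - {k} = {1..k-1}" using assms(1) by auto
  interpret closed_cube "{1..k-1}" "fiber_cube X0 ?n \<phi> k x"
    using closed_cube_fiber_cube[OF finite_atLeastAtMost k, of x] unfolding L .
  have x: "x \<in> carrier {k}" using assms(4) topspace_XT[of "{k}"] k by auto
  \<comment> \<open>The bound \<open>d j \<ge> -1\<close> makes the conversion to a natural number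
    exact; the \<open>-1\<close> in \<open>?j\<close> then provides the strict inequality.\<close>
  have "(\<Sum>j=1..k. int (?n j)) = (\<Sum>j=1..k. d j + 1)"
    using assms(2) by (intro sum.cong) force+
  then have sum: "?j + int (card {1..k}) < (\<Sum>j=1..k. int (?n j))"
    by (simp add: sum.distrib)
  \<comment> \<open>For \<open>k = 1\<close> the union and the homotopy colimit are empty, and a map
    from the empty space to a nonempty one is \<open>?j\<close>-connected only for negative
    \<open>?j\<close>; here \<open>?j = d 1 - 1\<close>.\<close>
  have neg: "?j < 0" if "{1..k-1} = {}"
  proof -
    have "k = 1" using that assms(1) by auto
    then show ?thesis using assms(5) by simp
  qed
  have "diagram (Pow {1..k-1}) (fiber_cube X0 ?n \<phi> k x) (\<lambda>S T. id)"
    unfolding diagram_def using continuous_map_incl by auto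
  then show ?thesis
    using connectivity_fiber_cube[OF finite_atLeastAtMost k x _ sum] neg
    unfolding L cocartesian_def by blast
qed

end
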